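(* Let $\tau>0$ and $A_0,A_1\in\mathbb{R}^{n\times n}$. Suppose there exist $d \in \mathbb{N}$, a constant $\epsilon>0$, functions $S\in W_2^{n\times n}[-\tau,0]$, $R\in W_2^{n\times n}[[-\tau,0]\times [-\tau,0]]$, $\{F_1,H_1\}\in \Theta_{n,n,1}$, and $\{F_2,H_2\}\in \Theta_{2n,n,1}$, where $R(s,\theta) = R(\theta,s)^T$ and $S(s)$ is symmetric, such that $$\{M,N\} \in \Xi_{d,2n,1}\qquad\text{and}\qquad \{-D,-E\}\in \Xi_{d,3n,1},$$ where $$M(s)=\begin{bmatrix}\tau R(0,0) + \tau S(0)& \tau R(0,s) \\ \tau R(s,0)&\tau S(s)\end{bmatrix}+F_1(s) -\epsilon I_{2n},\qquad N(s,\theta)=\begin{bmatrix}0_{n} & 0_{n}\\0_{n}&R(s,\theta)\end{bmatrix}+H_1(s,\theta),$$ $$D(s):=\begin{bmatrix}D_0 & \tau V(s)\\ \tau V(s)^T & \tau \dot S(s)+\epsilon I_n \end{bmatrix}+F_2(s),\qquad D_0:=\begin{bmatrix}S_{11}+S_{11}^T +\epsilon I_n& S_{12} \\ S_{12}^T & S_{22}\end{bmatrix},\qquad V(s)=\begin{bmatrix}S_{13}(s)\\0\end{bmatrix},$$ $$S_{11} := \tau A_0(R(0,0)+S(0)) + \tau A_1 R(-\tau,0) +\tfrac{1}{2} S(0),\qquad S_{12} := \tau A_1 S(-\tau), \qquad S_{22} := - S(-\tau),$$ $$S_{13}(s) := A_0 R(0,s)+ A_1 R(-\tau,s)+ \dot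 R(s,0)^T,$$ $$E(s,\theta):=\begin{bmatrix}0_{2n} & 0_{2n\times n}\\0_{n\times 2n}&G(s,\theta)\end{bmatrix}+H_2(s,\theta),\qquad G(s,\theta):=\frac{\partial}{\partial s}R(s,\theta) + \frac{\partial}{\partial\theta} R(s,\theta),$$ with $\dot R(s,0)=\frac{d}{ds}R(s,0)$. Then the system $\dot x(t)=A_0x(t)+A_1x(t-\tau)$, $t\ge 0$, $x(t)=\phi_0(t)$ for $t\in[-\tau,0]$ with $\phi_0\in\mathcal{C}[-\tau,0]$, is exponentially stable.
   Context: $L_2^m[D]$ denotes the square-integrable functions $D\to\mathbb{R}^m$ and $W_2^m[D]=\{x: x,\dot x\in L_2^m[D]\}$; $W_2^{n\times m}$ is the matrix-valued analogue (for functions of two variables, first-order partial derivatives in $L_2$). Functions in $W_2$ are regarded as continuous, and kernels are assumed sufficiently smooth that the one-variable sections that occur (e.g. $s\mapsto R(s,0)$) are well defined and lie in $W_2$. $I_k$ is the identity matrix, $0_k$ the $k\times k$ zero matrix, $\mathcal{C}[-\tau,0]$ the continuous functions $[-\tau,0]\to\mathbb{R}^n$. **The set $\Theta_{m,n,1}$.** It is the set of pairs $\{F,H\}$ of the form $$F(s) = \begin{bmatrix}\mathbf{K}(s) + \frac{1}{\tau}\int_{-\tau}^0 \int_{-\tau}^0 L_{11}(\omega,t)\,d\omega\, dt& \int_{-\tau}^0 L_{12}(\omega,s)\,d\omega \\ \int_{-\tau}^0 L_{21}(s,\omega)\,d\omega & 0\end{bmatrix},\qquad H(s,\theta) = - \begin{bmatrix}L_{11}(s,\theta)&L_{12}(s,\theta)\\L_{21}(s,\theta)&0\end{bmatrix}$$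 for some square-integrable $\mathbf{K},L_{ij}$ with $\mathbf{K}(s),L_{11}(s,\theta)\in\mathbb{R}^{m\times m}$, $L_{12}(s,\theta)\in\mathbb{R}^{m\times n}$, $L_{21}(s,\theta)\in\mathbb{R}^{n\times m}$ and $\int_{-\tau}^0\mathbf{K}(s)\,ds=0$. **The set $\Xi_{d,p,1}$.** Let $Y_d(s)\in\mathbb{R}^{d+1}$ be the vector of monomials in $s$ of degree at most $d$, and $Y_d(s,\theta)\in\mathbb{R}^q$, $q=(d+1)(d+2)/2$, the vector of monomials in $(s,\theta)$ of total degree at most $d$. Set $Y_1(s)=Y_d(s)\otimes I_p$ and $Y_2(s,\theta)=Y_d(s,\theta)\otimes I_p$. For a function $g\ge0$ on $[-\tau,0]$, say that a pair $\{M,N\}$ of $p\times p$ matrix-valued functions is generated by $g$ if there is a symmetric positive semidefinite matrix $Q=\begin{bmatrix}Q_{11}&Q_{12}\\Q_{12}^T&Q_{22}\end{bmatrix}$ (blocks of conformable size) with $$M(s)=g(s)Y_1(s)^TQ_{11}Y_1(s),$$ $$N(s,\theta)=g(s)Y_1(s)^TQ_{12}Y_2(s,\theta)+g(\theta)Y_2(\theta,s)^TQ_{12}^TY_1(\theta)+\int_{-\tau}^0g(\omega)Y_2(\omega,s)^TQ_{22}Y_2(\omega,\theta)\,d\omega .$$ Then $\Xi_{d,p,1}$ is the set of pairs $\{M_1+M_2,N_1+N_2\}$ where $\{M_1,N_1\}$ is generated by $g(s)=1$ and $\{M_2,N_2\}$ is generated by $g(s)=-s(s+\tau)$. Exponential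 stability of the delay system: there are $M,\beta>0$ such that every solution satisfies $\|x(t)\|\le Me^{-\beta t}\sup_{s\in[-\tau,0]}\|\phi_0(s)\|$ for all $t\ge0$. *)

theory Defs
  imports "HOL-Analysis.Analysis"
begin

section \<open>Function spaces\<close>

text \<open>
  Elements of the spaces below are represented by functions, and identities between them are
  understood almost everywhere. Integrals over \<open>[-\<tau>,0]\<close> are Lebesgue integrals.
\<close>

definition L2_on :: "'a::euclidean_space set \<Rightarrow> ('a \<Rightarrow> 'b::euclidean_space) \<Rightarrow> bool" where
  "L2_on \<Omega> f \<longleftrightarrow>
     set_borel_measurable lborel \<Omega> f \<and> set_integrable lborel \<Omega> (\<lambda>x. (norm (f x))\<^sup>2)"

definition test_function :: "'a::euclidean_space set \<Rightarrow> ('a \<Rightarrow> real) \<Rightarrow> bool" where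
  "test_function \<Omega> \<phi> \<longleftrightarrow>
     (\<forall>x. \<phi> differentiable (at x)) \<and>
     (\<forall>b\<in>Basis. continuous_on UNIV (\<lambda>x. frechet_derivative \<phi> (at x) b)) \<and>
     (\<exists>C. compact C \<and> C \<subseteq> interior \<Omega> \<and> (\<forall>x. x \<notin> C \<longrightarrow> \<phi> x = 0))"

definition weak_partial_deriv_on ::
  "'a::euclidean_space set \<Rightarrow> 'a \<Rightarrow> ('a \<Rightarrow> 'b::euclidean_space) \<Rightarrow> ('a \<Rightarrow> 'b) \<Rightarrow> bool" where
  "weak_partial_deriv_on \<Omega> b f g \<longleftrightarrow>
     (\<forall>\<phi>. test_function \<Omega> \<phi> \<longrightarrow>
        (LINT x:\<Omega>|lborel. frechet_derivative \<phi> (at x) b *\<^sub>R f x) =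
        - (LINT x:\<Omega>|lborel. \<phi> x *\<^sub>R g x))"

text \<open>
  \<open>W2_interval \<tau> f f'\<close>: \<open>f\<close> is (the continuous representative of) an element of \<open>W\<^sub>2[-\<tau>,0]\<close> and
  \<open>f'\<close> represents its derivative. \<open>W2_square \<tau> f f\<^sub>1 f\<^sub>2\<close>: likewise on the square
  \<open>[-\<tau>,0] \<times> [-\<tau>,0]\<close>, with \<open>f\<^sub>1\<close> and \<open>f\<^sub>2\<close> the partial derivatives with respect to the first and
  the second variable.
\<close>

definition W2_interval ::
  "real \<Rightarrow> (real \<Rightarrow> 'b::euclidean_space) \<Rightarrow> (real \<Rightarrow> 'b) \<Rightarrow> bool" where
  "W2_interval \<tau> f f' \<longleftrightarrow>
     continuous_on {-\<tau>..0} f \<and> L2_on {-\<tau>..0} f \<and> L2_on {-\<tau>..0} f' \<and>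
     weak_partial_deriv_on {-\<tau>..0} 1 f f'"

definition W2_square ::
  "real \<Rightarrow> (real \<Rightarrow> real \<Rightarrow> 'b::euclidean_space) \<Rightarrow> (real \<Rightarrow> real \<Rightarrow> 'b) \<Rightarrow>
   (real \<Rightarrow> real \<Rightarrow> 'b) \<Rightarrow> bool" where
  "W2_square \<tau> f f1 f2 \<longleftrightarrow>
     (let Q = {-\<tau>..0} \<times> {-\<tau>..0} in
        continuous_on Q (case_prod f) \<and>
        L2_on Q (case_prod f) \<and> L2_on Q (case_prod f1) \<and> L2_on Q (case_prod f2) \<and>
        weak_partial_deriv_on Q (1, 0) (case_prod f) (case_prod f1) \<and>
        weak_partial_deriv_on Q (0, 1) (case_prod f) (case_prod f2))"

section \<open>Block matrices\<close>

text \<open>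
  A matrix with \<open>a + b\<close> rows is indexed by the sum type \<open>'a + 'b\<close>; recall that
  \<open>real^'c^'a\<close> has \<open>CARD('a)\<close> rows and \<open>CARD('c)\<close> columns.
\<close>

definition block ::
  "real^'c^'a \<Rightarrow> real^'d^'a \<Rightarrow> real^'c^'b \<Rightarrow> real^'d^'b \<Rightarrow> real^('c + 'd)^('a + 'b)" where
  "block A B C D = (\<chi> i j.
     case i of
       Inl a \<Rightarrow> (case j of Inl c \<Rightarrow> A $ a $ c | Inr d \<Rightarrow> B $ a $ d)
     | Inr b \<Rightarrow> (case j of Inl c \<Rightarrow> C $ b $ c | Inr d \<Rightarrow> D $ b $ d))"

definition block_col :: "real^'c^'a \<Rightarrow> real^'c^'b \<Rightarrow> real^'c^('a + 'b)" where
  "block_col A B = (\<chi> i. case i of Inl a \<Rightarrow> A $ a | Inr b \<Rightarrow> B $ b)"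

section \<open>The set of pairs \<open>\<Theta>\<close>\<close>

text \<open>The sizes \<open>m\<close> and \<open>n\<close> are the cardinalities of \<open>'m\<close> and \<open>'n\<close>.\<close>

definition Theta ::
  "real \<Rightarrow> ((real \<Rightarrow> real^('m::finite + 'n::finite)^('m + 'n)) \<times>
            (real \<Rightarrow> real \<Rightarrow> real^('m + 'n)^('m + 'n))) set" where
  "Theta \<tau> = {(F, H).
     \<exists>(K :: real \<Rightarrow> real^'m^'m) (L11 :: real \<Rightarrow> real \<Rightarrow> real^'m^'m)
       (L12 :: real \<Rightarrow> real \<Rightarrow> real^'n^'m) (L21 :: real \<Rightarrow> real \<Rightarrow> real^'m^'n).
       L2_on {-\<tau>..0} K \<and>
       L2_on ({-\<tau>..0} \<times> {-\<tau>..0}) (case_prod L11) \<and>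
       L2_on ({-\<tau>..0} \<times> {-\<tau>..0}) (case_prod L12) \<and>
       L2_on ({-\<tau>..0} \<times> {-\<tau>..0}) (case_prod L21) \<and>
       (LINT s:{-\<tau>..0}|lborel. K s) = 0 \<and>
       (AE s in lborel. s \<in> {-\<tau>..0} \<longrightarrow>
          F s = block
            (K s + (1 / \<tau>) *\<^sub>R (LINT t:{-\<tau>..0}|lborel. (LINT \<omega>:{-\<tau>..0}|lborel. L11 \<omega> t)))
            (LINT \<omega>:{-\<tau>..0}|lborel. L12 \<omega> s)
            (LINT \<omega>:{-\<tau>..0}|lborel. L21 s \<omega>)
            0) \<and>
       (AE (s, \<theta>) in lborel. s \<in> {-\<tau>..0} \<and> \<theta> \<in> {-\<tau>..0} \<longrightarrow>
          H s \<theta> = - block (L11 s \<theta>) (L12 s \<theta>) (L21 s \<theta>) 0)}"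

section \<open>The set of pairs \<open>\<Xi>\<close>\<close>

text \<open>
  Since the number of monomials depends on the degree \<open>d\<close>, matrices with such a dimension are
  functions on finite index sets: \<open>i \<le> d\<close> stands for the monomial \<open>s^i\<close> and \<open>(i, j)\<close> with
  \<open>i + j \<le> d\<close> for \<open>s^i * \<theta>^j\<close>. The rows of \<open>y \<otimes> I\<^sub>p\<close> are indexed by pairs (monomial, element
  of \<open>'p\<close>), its columns by \<open>'p\<close>, where \<open>p = CARD('p)\<close>.
\<close>

definition idx1 :: "nat \<Rightarrow> (nat \<times> 'p::finite) set" where
  "idx1 d = {i. i \<le> d} \<times> UNIV"

definition idx2 :: "nat \<Rightarrow> ((nat \<times> nat) \<times> 'p::finite) set" where
  "idx2 d = {(i, j). i + j \<le> d} \<times> UNIV"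

definition kron_id :: "('i \<Rightarrow> real) \<Rightarrow> 'i \<times> 'p \<Rightarrow> 'p \<Rightarrow> real" where
  "kron_id y = (\<lambda>(i, a) b. y i * (if a = b then 1 else 0))"

definition Y1 :: "real \<Rightarrow> nat \<times> 'p \<Rightarrow> 'p \<Rightarrow> real" where
  "Y1 s = kron_id (\<lambda>i. s ^ i)"

definition Y2 :: "real \<Rightarrow> real \<Rightarrow> (nat \<times> nat) \<times> 'p \<Rightarrow> 'p \<Rightarrow> real" where
  "Y2 s \<theta> = kron_id (\<lambda>(i, j). s ^ i * \<theta> ^ j)"

text \<open>The product \<open>X\<^sup>T Q Z\<close>, where \<open>Q\<close> has rows \<open>I\<close> and columns \<open>J\<close>.\<close>

definition tmult3 ::
  "'i set \<Rightarrow> 'j set \<Rightarrow> ('i \<Rightarrow> 'p::finite \<Rightarrow> real) \<Rightarrow> ('i \<Rightarrow> 'j \<Rightarrow> real) \<Rightarrow> ('j \<Rightarrow> 'p \<Rightarrow> real) \<Rightarrow>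
   real^'p^'p" where
  "tmult3 I J X Q Z = (\<chi> a b. \<Sum>i\<in>I. \<Sum>j\<in>J. X i a * Q i j * Z j b)"

definition sym_psd_on :: "'i set \<Rightarrow> ('i \<Rightarrow> 'i \<Rightarrow> real) \<Rightarrow> bool" where
  "sym_psd_on I Q \<longleftrightarrow>
     (\<forall>i\<in>I. \<forall>j\<in>I. Q i j = Q j i) \<and> (\<forall>v. 0 \<le> (\<Sum>i\<in>I. \<Sum>j\<in>I. v i * Q i j * v j))"

definition generated_by ::
  "real \<Rightarrow> nat \<Rightarrow> (real \<Rightarrow> real) \<Rightarrow> (real \<Rightarrow> real^'p::finite^'p) \<Rightarrow>
   (real \<Rightarrow> real \<Rightarrow> real^'p^'p) \<Rightarrow> bool" where
  "generated_by \<tau> d g M N \<longleftrightarrow>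
     (\<exists>Q :: (nat \<times> 'p) + ((nat \<times> nat) \<times> 'p) \<Rightarrow> (nat \<times> 'p) + ((nat \<times> nat) \<times> 'p) \<Rightarrow> real.
        sym_psd_on (idx1 d <+> idx2 d) Q \<and>
        (let Q11 = (\<lambda>i j. Q (Inl i) (Inl j));
             Q12 = (\<lambda>i j. Q (Inl i) (Inr j));
             Q12T = (\<lambda>j i. Q12 i j);
             Q22 = (\<lambda>i j. Q (Inr i) (Inr j))
         in (\<forall>s\<in>{-\<tau>..0}. M s = g s *\<^sub>R tmult3 (idx1 d) (idx1 d) (Y1 s) Q11 (Y1 s)) \<and>
            (\<forall>s\<in>{-\<tau>..0}. \<forall>\<theta>\<in>{-\<tau>..0}.
               N s \<theta> =
                 g s *\<^sub>R tmult3 (idx1 d) (idx2 d) (Y1 s) Q12 (Y2 s \<theta>)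
               + g \<theta> *\<^sub>R tmult3 (idx2 d) (idx1 d) (Y2 \<theta> s) Q12T (Y1 \<theta>)
               + (LINT \<omega>:{-\<tau>..0}|lborel.
                    g \<omega> *\<^sub>R tmult3 (idx2 d) (idx2 d) (Y2 \<omega> s) Q22 (Y2 \<omega> \<theta>)))))"

definition Xi ::
  "real \<Rightarrow> nat \<Rightarrow> ((real \<Rightarrow> real^'p::finite^'p) \<times> (real \<Rightarrow> real \<Rightarrow> real^'p^'p)) set" where
  "Xi \<tau> d = {(M, N).
     \<exists>M1 N1 M2 N2.
       generated_by \<tau> d (\<lambda>s. 1) M1 N1 \<and>
       generated_by \<tau> d (\<lambda>s. - s * (s + \<tau>)) M2 N2 \<and>
       (AE s in lborel. s \<in> {-\<tau>..0} \<longrightarrow> M s = M1 s + M2 s) \<and>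
       (AE (s, \<theta>) in lborel. s \<in> {-\<tau>..0} \<and> \<theta> \<in> {-\<tau>..0} \<longrightarrow> N s \<theta> = N1 s \<theta> + N2 s \<theta>)}"

section \<open>The delay system\<close>

definition dde_solution ::
  "real \<Rightarrow> real^'n^'n \<Rightarrow> real^'n^'n \<Rightarrow> (real \<Rightarrow> real^'n) \<Rightarrow> (real \<Rightarrow> real^'n) \<Rightarrow> bool" where
  "dde_solution \<tau> A0 A1 \<phi>0 x \<longleftrightarrow>
     (\<forall>t\<in>{-\<tau>..0}. x t = \<phi>0 t) \<and>
     (\<forall>t\<ge>0. (x has_vector_derivative (A0 *v x t + A1 *v x (t - \<tau>))) (at t within {0..}))"

definition exponentially_stable :: "real \<Rightarrow> real^'n^'n \<Rightarrow> real^'n^'n \<Rightarrow> bool" where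
  "exponentially_stable \<tau> A0 A1 \<longleftrightarrow>
     (\<exists>M>0. \<exists>\<beta>>0. \<forall>\<phi>0 x.
        continuous_on {-\<tau>..0} \<phi>0 \<and> dde_solution \<tau> A0 A1 \<phi>0 x \<longrightarrow>
        (\<forall>t\<ge>0. norm (x t) \<le> M * exp (- \<beta> * t) * (SUP s\<in>{-\<tau>..0}. norm (\<phi>0 s))))"

end

theory Submission
  imports Defs
begin

text \<open>
  The hypotheses are a dual Lyapunov condition. On continuous \<open>\<phi>\<close> consider the inner product
  \<open>\<langle>f, g\<rangle> = \<tau> f(0)\<^sup>T g(0) + \<integral> f\<^sup>T g\<close> and the operator
  \<open>(P \<phi>)(s) = \<tau> R(s,0) \<phi>(0) + \<tau> S(s) \<phi>(s) + \<integral> R(s,\<theta>) \<phi>(\<theta>) d\<theta>\<close>.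
  The elements of \<open>\<Theta>\<close> contribute nothing to the quadratic forms and those of \<open>\<Xi>\<close> are sums of squares,
  so the condition on \<open>{M, N}\<close> says that \<open>P\<close> is coercive, and the condition on \<open>{-D, -E}\<close> says that
  \<open>2 \<langle>A P z, z\<rangle> \<le> - \<epsilon> \<langle>z, z\<rangle>\<close>, where \<open>A\<close> is the generator of the delay equation. Hence, for the
  segment \<open>x\<^sub>t\<close> of a solution, \<open>V(t) = \<langle>x\<^sub>t, P\<inverse> x\<^sub>t\<rangle>\<close> decays exponentially.

  The inverse is elementary here: the lower right blocks of the elements of \<open>\<Theta>\<close> vanish, so \<open>S\<close> and \<open>R\<close>
  inherit from \<open>{M, N}\<close> that they are polynomials. Therefore \<open>P\<close> is a finite rank perturbation of
  multiplication by \<open>\<tau> S\<close>, and injectivity implies surjectivity. Being polynomials, \<open>S\<close> and \<open>R\<close> also have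
  classical derivatives, which agree almost everywhere with the given weak ones.
\<close>

section \<open>Preliminaries from linear algebra and calculus\<close>

text \<open>The obstacle is regularity. The preimage z of a segment under P is continuous in s and
  nothing more, so neither z(s) nor its dependence on t may be differentiated. In s, only the
  product tau S z is differentiable, being P z minus the terms with R. As S is symmetric, this
  suffices to differentiate the scalar z . (tau S z), which is the integration by parts behind the
  dissipation inequality. In t, symmetry of P reduces the difference quotient of V to difference
  quotients of x alone. A second obstacle is that the initial function is merely continuous: a
  segment is continuously differentiable on its whole interval from t = tau on. The decay of V is
  therefore proved from t = tau, and Gronwall's inequality bounds the solution on [0, tau]. Elements
  of the set Theta drop out because the forms are evaluated at vectors whose upper part
  (\<open>\<phi> 0\<close>, or \<open>\<phi> 0\<close> together with
  \<open>\<phi> (-\<tau>)\<close>) does not depend on s.\<close>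

lemma finite_rank_surj:
  fixes T :: "'a::real_vector \<Rightarrow> 'a"
  assumes T: "linear T" and inj: "\<And>z. T z = 0 \<Longrightarrow> z = 0"
    and B: "finite B" and range: "\<And>z. T z - z \<in> span B"
  shows "\<exists>z. T z = y"
proof -
  obtain C where C: "C \<subseteq> B" "independent C" "B \<subseteq> span C"
    using maximal_independent_subset by metis
  have finC: "finite C" using C(1) B finite_subset by blast
  have spanC: "span C = span B"
    by (metis C(1) C(3) span_mono span_span subset_antisym)
  have injT: "inj T" using inj linear_injective_0[OF T] by blast
  have ind: "independent (T ` C)"
    using linear_independent_injective_image[OF T C(2)] injT by (meson inj_on_subset top_greatest)
  have card: "card (T ` C) = card C" using card_image injT by (meson inj_on_subset top_greatest)
  have maps: "T z \<in> span C" if "z \<in> span C" for z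
  proof -
    have "(T z - z) + z \<in> span C" using range[of z] that spanC by (intro span_add) auto
    then show ?thesis by simp
  qed
  \<comment> \<open>Dimension count: a vector of \<open>span C\<close> outside the span of the image
    of \<open>C\<close> could be added to that image, giving more than \<open>card C\<close>
    independent vectors inside \<open>span C\<close>.\<close>
  have sub: "span C \<subseteq> span (T ` C)"
  proof
    fix v assume v: "v \<in> span C"
    show "v \<in> span (T ` C)"
    proof (rule ccontr)
      assume nv: "v \<notin> span (T ` C)"
      then have "independent (insert v (T ` C))" using ind independent_insertI by blast
      moreover have "insert v (T ` C) \<subseteq> span C" using v maps by (auto intro: span_base)
      ultimately have "card (insert v (T ` C)) \<le> card C"
        using independent_span_bound[OF finC] by blast
      moreover have "v \<notin> T ` C" using nv span_superset[of "T ` C"] by auto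
      ultimately show False using card finC by simp
    qed
  qed
  \<comment> \<open>Taking \<open>y\<close> itself as an approximate preimage leaves a defect in the
    finite-dimensional part, where \<open>T\<close> is already onto; \<open>u\<close> corrects
    it.\<close>
  have "y - T y \<in> span C" using range[of y] spanC span_neg[of "T y - y" B] by simp
  then have "y - T y \<in> T ` span C" using sub linear_span_image[OF T] by blast
  then obtain u where "T u = y - T y" by auto
  then have "T (y + u) = y" using linear_add[OF T] by simp
  then show ?thesis by blast
qed

lemma bounded_bilinear_matrix_vector_mult:
  "bounded_bilinear ((*v) :: real^'m^'n \<Rightarrow> real^'m \<Rightarrow> real^'n)"
proof -
  have "bilinear ((*v) :: real^'m^'n \<Rightarrow> real^'m \<Rightarrow> real^'n)"
    unfolding bilinear_def
    by (auto intro!: linearI simp: algebra_simps scaleR_matrix_vector_assoc)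
  then show ?thesis by (simp add: bilinear_conv_bounded_bilinear)
qed

lemmas continuous_on_matrix_vector_mult =
  bounded_bilinear.continuous_on[OF bounded_bilinear_matrix_vector_mult]
lemmas has_vector_derivative_matrix_vector_mult =
  bounded_bilinear.has_vector_derivative[OF bounded_bilinear_matrix_vector_mult]

lemma bounded_linear_transpose: "bounded_linear (transpose :: real^'m^'n \<Rightarrow> real^'n^'m)"
  unfolding linear_conv_bounded_linear[symmetric]
  by (rule linearI) (simp_all add: transpose_def vec_eq_iff)

lemmas continuous_on_transpose = bounded_linear.continuous_on[OF bounded_linear_transpose]

lemma matrix_scaleR_vector: "(c *\<^sub>R A) *v x = c *\<^sub>R (A *v (x::real^'m))" for A :: "real^'m^'n"
  by (simp add: scaleR_matrix_vector_assoc)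

lemma inner_transpose: "x \<bullet> (transpose A *v y) = (A *v x) \<bullet> (y :: real^'n)" for A :: "real^'m^'n"
  by (metis dot_lmul_matrix inner_commute transpose_matrix_vector)

lemma continuous_on_section:
  assumes "continuous_on (A \<times> B) (\<lambda>(x, y). f x y)" "x \<in> A"
  shows "continuous_on B (\<lambda>y. f x y)"
  using continuous_on_compose2[OF assms(1), of B "\<lambda>y. (x, y)", OF continuous_on_Pair[OF continuous_on_const continuous_on_id]] assms(2)
  by auto

lemma continuous_on_section':
  assumes "continuous_on (A \<times> B) (\<lambda>(x, y). f x y)" "y \<in> B"
  shows "continuous_on A (\<lambda>x. f x y)"
  using continuous_on_compose2[OF assms(1), of A "\<lambda>x. (x, y)", OF continuous_on_Pair[OF continuous_on_id continuous_on_const]] assms(2)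
  by auto

text \<open>A derivative in terms of signed difference quotients. The derivative of a product with a
  merely continuous factor is later assembled from such limits.\<close>

lemma has_vector_derivative_quotient:
  assumes "(f has_vector_derivative D) (at x within A)"
  shows "((\<lambda>y. (1 / (y - x)) *\<^sub>R (f y - f x)) \<longlongrightarrow> D) (at x within A)"
proof -
  have "((\<lambda>y. norm ((1 / norm (y - x)) *\<^sub>R (f y - (f x + (y - x) *\<^sub>R D)))) \<longlongrightarrow> 0) (at x within A)"
    using assms unfolding has_vector_derivative_def has_derivative_within
    by (intro tendsto_norm_zero) auto
  then have "((\<lambda>y. norm ((1 / (y - x)) *\<^sub>R (f y - f x) - D)) \<longlongrightarrow> 0) (at x within A)"
  proof (rule Lim_transform_eventually)
    show "\<forall>\<^sub>F y in at x within A. norm ((1 / norm (y - x)) *\<^sub>R (f y - (f x + (y - x) *\<^sub>R D)))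
        = norm ((1 / (y - x)) *\<^sub>R (f y - f x) - D)"
      unfolding eventually_at_filter
    proof (intro always_eventually allI impI)
      fix y assume "y \<noteq> x"
      then have "(1 / (y - x)) *\<^sub>R (f y - f x) - D = (1 / (y - x)) *\<^sub>R (f y - (f x + (y - x) *\<^sub>R D))"
        by (simp add: diff_diff_eq[symmetric] scaleR_diff_right[of _ "f y - f x"])
      then show "norm ((1 / norm (y - x)) *\<^sub>R (f y - (f x + (y - x) *\<^sub>R D)))
        = norm ((1 / (y - x)) *\<^sub>R (f y - f x) - D)" by simp
    qed
  qed
  then show ?thesis by (rule LIM_zero_cancel[OF tendsto_norm_zero_cancel])
qed

lemma inner_integral_right:
  fixes f :: "real \<Rightarrow> 'a::euclidean_space"
  assumes "continuous_on {a..b} f"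
  shows "c \<bullet> integral {a..b} f = integral {a..b} (\<lambda>s. c \<bullet> f s)"
  using integral_linear[OF integrable_continuous_real[OF assms] bounded_linear_inner_right[of c]]
  by (simp add: o_def)

lemma integral_matrix_vector:
  fixes f :: "real \<Rightarrow> real^'n" and A :: "real^'n^'m"
  assumes "continuous_on {a..b} f"
  shows "A *v integral {a..b} f = integral {a..b} (\<lambda>s. A *v f s)"
  using integral_linear[OF integrable_continuous_real[OF assms] matrix_vector_mul_bounded_linear[of A]]
  by (simp add: o_def)

lemma continuous_on_kernel_integral:
  fixes K :: "real \<Rightarrow> real \<Rightarrow> real^'m^'n"
  assumes "continuous_on (U \<times> {a..b}) (\<lambda>(s, \<theta>). K s \<theta>)" "continuous_on {a..b} \<phi>"
  shows "continuous_on U (\<lambda>s. integral {a..b} (\<lambda>\<theta>. K s \<theta> *v \<phi> \<theta>))"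
proof -
  have "continuous_on (U \<times> {a..b}) (\<lambda>z. K (fst z) (snd z) *v \<phi> (snd z))"
    using assms(1)
    by (intro continuous_on_matrix_vector_mult continuous_on_compose2[OF assms(2)] continuous_intros)
      (auto simp: split_beta)
  then show ?thesis
    using integral_continuous_on_param[of U a b "\<lambda>s \<theta>. K s \<theta> *v \<phi> \<theta>"] by (simp add: split_beta)
qed

text \<open>Fubini for the form of a continuous kernel. The first identity exchanges the variables,
  so that a kernel with \<open>K s \<theta>\<close> the transpose of \<open>K \<theta> s\<close>
  gives a symmetric form; the second only moves the inner product under the integral.\<close>

lemma double_integral_inner_swap:
  fixes K :: "real \<Rightarrow> real \<Rightarrow> real^'n^'n"
  assumes K: "continuous_on ({a..b} \<times> {a..b}) (\<lambda>(s, \<theta>). K s \<theta>)"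
    and \<phi>: "continuous_on {a..b} \<phi>" and \<psi>: "continuous_on {a..b} \<psi>"
  shows "integral {a..b} (\<lambda>s. \<psi> s \<bullet> integral {a..b} (\<lambda>\<theta>. K s \<theta> *v \<phi> \<theta>)) =
         integral {a..b} (\<lambda>s. integral {a..b} (\<lambda>\<theta>. \<psi> \<theta> \<bullet> (K \<theta> s *v \<phi> s)))" (is "?l = ?r")
    and "integral {a..b} (\<lambda>s. \<psi> s \<bullet> integral {a..b} (\<lambda>\<theta>. K s \<theta> *v \<phi> \<theta>)) =
         integral {a..b} (\<lambda>s. integral {a..b} (\<lambda>\<theta>. \<psi> s \<bullet> (K s \<theta> *v \<phi> \<theta>)))" (is "?l = ?m")
proof -
  have c: "continuous_on ({a..b} \<times> {a..b}) (\<lambda>z. \<psi> (fst z) \<bullet> (K (fst z) (snd z) *v \<phi> (snd z)))"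
    using K by (intro continuous_on_matrix_vector_mult continuous_on_compose2[OF \<phi>] continuous_on_compose2[OF \<psi>]
        continuous_intros) (auto simp: split_beta)
  show 1: "?l = ?m"
  proof (rule integral_cong)
    fix s assume s: "s \<in> {a..b}"
    have "continuous_on {a..b} (\<lambda>\<theta>. K s \<theta> *v \<phi> \<theta>)"
      by (intro continuous_on_matrix_vector_mult \<phi> continuous_on_section[OF K] s)
    then show "\<psi> s \<bullet> integral {a..b} (\<lambda>\<theta>. K s \<theta> *v \<phi> \<theta>) = integral {a..b} (\<lambda>\<theta>. \<psi> s \<bullet> (K s \<theta> *v \<phi> \<theta>))"
      by (rule inner_integral_right)
  qed
  have "?m = integral (cbox a b) (\<lambda>y. integral (cbox a b) (\<lambda>x. \<psi> x \<bullet> (K x y *v \<phi> y)))"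
    using integral_swap_continuous[of a a b b "\<lambda>s \<theta>. \<psi> s \<bullet> (K s \<theta> *v \<phi> \<theta>)"] c
    by (simp add: split_beta cbox_Pair_eq)
  then show "?l = ?r" using 1 by simp
qed

section \<open>Inner product on continuous functions and elementary estimates\<close>

text \<open>The point value carries the weight \<open>\<tau>\<close> because an expression in
  \<open>f 0\<close> alone picks up this factor when it stands under an integral over
  \<open>{-\<tau>..0}\<close>, as it does in the quadratic forms of the hypotheses.\<close>

definition ip :: "real \<Rightarrow> (real \<Rightarrow> 'a::euclidean_space) \<Rightarrow> (real \<Rightarrow> 'a) \<Rightarrow> real" where
  "ip \<tau> f g = \<tau> * (f 0 \<bullet> g 0) + integral {-\<tau>..0} (\<lambda>s. f s \<bullet> g s)"

lemma ip_cong: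
  assumes "\<tau> > 0" "\<And>s. s \<in> {-\<tau>..0} \<Longrightarrow> f s = f' s" "\<And>s. s \<in> {-\<tau>..0} \<Longrightarrow> g s = g' s"
  shows "ip \<tau> f g = ip \<tau> f' g'"
proof -
  have "integral {-\<tau>..0} (\<lambda>s. f s \<bullet> g s) = integral {-\<tau>..0} (\<lambda>s. f' s \<bullet> g' s)"
    by (rule integral_cong) (simp add: assms)
  then show ?thesis using assms by (simp add: ip_def)
qed

lemma ip_commute: "ip \<tau> f g = ip \<tau> g f"
  by (simp add: ip_def inner_commute)

lemma ip_integrable:
  assumes "continuous_on {-\<tau>..0::real} f" "continuous_on {-\<tau>..0} g"
  shows "(\<lambda>s. f s \<bullet> g s) integrable_on {-\<tau>..0}"
  by (intro integrable_continuous_real continuous_intros assms)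

lemma ip_add:
  assumes "continuous_on {-\<tau>..0::real} f" "continuous_on {-\<tau>..0} g" "continuous_on {-\<tau>..0} h"
  shows "ip \<tau> (\<lambda>s. f s + g s) h = ip \<tau> f h + ip \<tau> g h"
  using assms by (simp add: ip_def inner_add_left integral_add ip_integrable algebra_simps)

lemma ip_diff:
  assumes "continuous_on {-\<tau>..0::real} f" "continuous_on {-\<tau>..0} g" "continuous_on {-\<tau>..0} h"
  shows "ip \<tau> (\<lambda>s. f s - g s) h = ip \<tau> f h - ip \<tau> g h"
  using assms by (simp add: ip_def inner_diff_left integral_diff ip_integrable algebra_simps)

lemma ip_scale: "ip \<tau> (\<lambda>s. c *\<^sub>R f s) h = c * ip \<tau> f h"
  by (simp add: ip_def algebra_simps)

lemma ip_nonneg: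
  assumes "\<tau> > 0" shows "0 \<le> ip \<tau> f f"
proof -
  have "0 \<le> integral {-\<tau>..0} (\<lambda>s. f s \<bullet> f s)"
  proof (cases "(\<lambda>s. f s \<bullet> f s) integrable_on {-\<tau>..0}")
    case True then show ?thesis by (intro integral_nonneg) auto
  next
    case False then show ?thesis by (simp add: not_integrable_integral)
  qed
  then show ?thesis using assms by (simp add: ip_def)
qed

text \<open>Gronwall in differential form: multiplied by the exponential of
  \<open>- k * (t - a)\<close>, the function \<open>f\<close> has a nonpositive derivative.\<close>

lemma exp_bound:
  fixes f f' :: "real \<Rightarrow> real"
  assumes ab: "a \<le> b"
    and d: "\<And>t. t \<in> {a..b} \<Longrightarrow> (f has_real_derivative f' t) (at t within {a..b})"
    and le: "\<And>t. t \<in> {a..b} \<Longrightarrow> f' t \<le> k * f t"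
  shows "f b \<le> exp (k * (b - a)) * f a"
proof -
  define g where "g t = exp (- k * (t - a)) * f t" for t
  have "(g has_real_derivative (exp (- k * (t - a)) * (f' t - k * f t))) (at t within {a..b})" if "t \<in> {a..b}" for t
    unfolding g_def by (rule derivative_eq_intros d[OF that] refl)+ (simp add: algebra_simps)
  then have g: "(g has_derivative (*) (exp (- k * (t - a)) * (f' t - k * f t))) (at t within {a..b})" if "a \<le> t" "t \<le> b" for t
    using that unfolding has_field_derivative_def by simp
  obtain t where t: "t \<in> {a..b}" "g b - g a = exp (- k * (t - a)) * (f' t - k * f t) * (b - a)"
    using mvt_very_simple[OF ab g] by blast
  have "exp (- k * (t - a)) * (f' t - k * f t) * (b - a) \<le> 0"
    using le[OF t(1)] ab by (intro mult_nonpos_nonneg mult_nonneg_nonpos) auto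
  then have "exp (- k * (b - a)) * f b \<le> f a" using t(2) by (simp add: g_def)
  then have "exp (k * (b - a)) * (exp (- k * (b - a)) * f b) \<le> exp (k * (b - a)) * f a"
    by (intro mult_left_mono) auto
  moreover have "exp (k * (b - a)) * exp (- k * (b - a)) = 1"
    using exp_minus_inverse[of "k * (b - a)"] by simp
  ultimately show ?thesis by (simp only: mult.assoc[symmetric] mult_1)
qed

text \<open>The integral of the square of \<open>f - m\<close>, with \<open>m\<close> the mean of
  \<open>f\<close>, is nonnegative; expanding it gives Cauchy-Schwarz against the constant
  1.\<close>

lemma integral_square_le:
  fixes f :: "real \<Rightarrow> real"
  assumes "\<tau> > 0" and f: "continuous_on {-\<tau>..0} f"
  shows "(integral {-\<tau>..0} f)\<^sup>2 \<le> \<tau> * integral {-\<tau>..0} (\<lambda>s. (f s)\<^sup>2)"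
proof -
  define m where "m = integral {-\<tau>..0} f / \<tau>"
  have i1: "f integrable_on {-\<tau>..0}" and i2: "(\<lambda>s. (f s)\<^sup>2) integrable_on {-\<tau>..0}"
    by (intro integrable_continuous_real continuous_intros f)+
  have c: "((\<lambda>s. m\<^sup>2) has_integral (\<tau> * m\<^sup>2)) {-\<tau>..0}"
    using has_integral_const_real[of "m\<^sup>2" "-\<tau>" 0] assms(1) by simp
  have "((\<lambda>s. (f s)\<^sup>2 - 2 * m * f s + m\<^sup>2) has_integral
      (integral {-\<tau>..0} (\<lambda>s. (f s)\<^sup>2) - 2 * m * integral {-\<tau>..0} f + \<tau> * m\<^sup>2)) {-\<tau>..0}"
    by (intro has_integral_add has_integral_diff has_integral_mult_right integrable_integral i1 i2 c)
  moreover have "(f s)\<^sup>2 - 2 * m * f s + m\<^sup>2 \<ge> 0" for s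
    using zero_le_power2[of "f s - m"] by (simp add: power2_diff algebra_simps)
  ultimately have "0 \<le> integral {-\<tau>..0} (\<lambda>s. (f s)\<^sup>2) - 2 * m * integral {-\<tau>..0} f + \<tau> * m\<^sup>2"
    by (rule has_integral_nonneg)
  then have "0 \<le> \<tau> * (integral {-\<tau>..0} (\<lambda>s. (f s)\<^sup>2) - 2 * m * integral {-\<tau>..0} f + \<tau> * m\<^sup>2)"
    using assms(1) by simp
  also have "\<dots> = \<tau> * integral {-\<tau>..0} (\<lambda>s. (f s)\<^sup>2) - (integral {-\<tau>..0} f)\<^sup>2"
    using assms(1) unfolding m_def by (simp add: field_simps power2_eq_square)
  finally show ?thesis by simp
qed

text \<open>Expand the nonnegative form at \<open>f\<close> minus \<open>c / k\<close> times
  \<open>g\<close>, with \<open>c\<close> equal to 1 or -1, and multiply by \<open>k\<close>. The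
  free weight \<open>k\<close> later serves to absorb terms and to balance factors of different
  order.\<close>

lemma ip_young:
  assumes "\<tau> > 0" and f: "continuous_on {-\<tau>..0} f" and g: "continuous_on {-\<tau>..0} g" and k: "k > 0"
  shows "2 * \<bar>ip \<tau> f g\<bar> \<le> k * ip \<tau> f f + ip \<tau> g g / k"
proof -
  have *: "0 \<le> k * ip \<tau> f f + ip \<tau> g g / k - 2 * c * ip \<tau> f g" if "c = 1 \<or> c = -1" for c :: real
  proof -
    have cg: "continuous_on {-\<tau>..0} (\<lambda>s. (c / k) *\<^sub>R g s)" by (intro continuous_intros g)
    have cd: "continuous_on {-\<tau>..0} (\<lambda>s. f s - (c / k) *\<^sub>R g s)" by (intro continuous_intros f g)
    have "ip \<tau> (\<lambda>s. f s - (c / k) *\<^sub>R g s) (\<lambda>s. f s - (c / k) *\<^sub>R g s)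
        = ip \<tau> f (\<lambda>s. f s - (c / k) *\<^sub>R g s) - (c / k) * ip \<tau> g (\<lambda>s. f s - (c / k) *\<^sub>R g s)"
      by (subst ip_diff[OF f cg cd]) (simp add: ip_scale)
    also have "ip \<tau> f (\<lambda>s. f s - (c / k) *\<^sub>R g s) = ip \<tau> f f - (c / k) * ip \<tau> f g"
      by (subst ip_commute, subst ip_diff[OF f cg f], simp add: ip_scale, simp add: ip_commute)
    also have "ip \<tau> g (\<lambda>s. f s - (c / k) *\<^sub>R g s) = ip \<tau> f g - (c / k) * ip \<tau> g g"
      by (subst ip_commute, subst ip_diff[OF f cg g], simp add: ip_scale)
    finally have "0 \<le> k * (ip \<tau> f f - (c / k) * ip \<tau> f g - (c / k) * (ip \<tau> f g - (c / k) * ip \<tau> g g))"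
      using ip_nonneg[OF assms(1), of "\<lambda>s. f s - (c / k) *\<^sub>R g s"] k by simp
    also have "\<dots> = k * ip \<tau> f f + (c * c) * ip \<tau> g g / k - 2 * c * ip \<tau> f g"
      using k by (simp add: field_simps)
    finally show ?thesis using that by auto
  qed
  show ?thesis using *[of 1] *[of "-1"] by (simp add: abs_if)
qed

text \<open>One \<open>\<tau>\<close> comes from the point value, the other from the length of the
  interval.\<close>

lemma ip_le_sup:
  assumes "\<tau> > 0" and f: "continuous_on {-\<tau>..0} f" and e: "\<And>s. s \<in> {-\<tau>..0} \<Longrightarrow> norm (f s) \<le> e"
  shows "ip \<tau> f f \<le> 2 * \<tau> * e\<^sup>2"
proof -
  have le: "f s \<bullet> f s \<le> e\<^sup>2" if "s \<in> {-\<tau>..0}" for s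
    using power_mono[OF e[OF that], of 2] by (simp add: dot_square_norm)
  have "integral {-\<tau>..0} (\<lambda>s. f s \<bullet> f s) \<le> integral {-\<tau>..0} (\<lambda>s. e\<^sup>2)"
    by (intro integral_le ip_integrable f le) auto
  also have "\<dots> = \<tau> * e\<^sup>2" using assms(1) by simp
  finally have "integral {-\<tau>..0} (\<lambda>s. f s \<bullet> f s) \<le> \<tau> * e\<^sup>2" .
  moreover have "\<tau> * (f 0 \<bullet> f 0) \<le> \<tau> * e\<^sup>2" using le[of 0] assms(1) by simp
  ultimately show ?thesis by (simp add: ip_def)
qed

lemma abs_add_le_half:
  fixes a b m p q :: real
  assumes "m = (p + q) / 2" "2 * \<bar>a\<bar> \<le> p" "2 * \<bar>b\<bar> \<le> q"
  shows "\<bar>a + b\<bar> \<le> m"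
proof -
  have "2 * \<bar>a + b\<bar> \<le> 2 * (\<bar>a\<bar> + \<bar>b\<bar>)" by (intro mult_left_mono abs_triangle_ineq) simp
  also have "\<dots> \<le> p + q" using assms(2,3) by simp
  also have "\<dots> = 2 * m" using assms(1) by simp
  finally show ?thesis by simp
qed

text \<open>The difference quotients in \<open>t\<close> of a whole segment converge uniformly in
  \<open>s\<close>, since \<open>x\<close> and its derivative are uniformly continuous on a compact
  interval. With \<open>t\<close> and \<open>t'\<close> at least \<open>\<tau>\<close>, all
  arguments stay in \<open>{0..}\<close>, where \<open>x\<close> is differentiable.\<close>

lemma uniform_quotient:
  fixes x X :: "real \<Rightarrow> 'a::euclidean_space"
  assumes d: "\<And>r. r \<ge> 0 \<Longrightarrow> (x has_vector_derivative X r) (at r within {0..})"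
    and cX: "continuous_on {0..} X" and t: "t \<ge> \<tau>" and e: "e > 0"
  shows "\<exists>\<delta>>0. \<forall>t'\<ge>\<tau>. t' \<noteq> t \<and> \<bar>t' - t\<bar> < \<delta> \<longrightarrow> (\<forall>s\<in>{-\<tau>..0}. norm (x (t' + s) - x (t + s)) \<le> e \<and>
      norm ((1 / (t' - t)) *\<^sub>R (x (t' + s) - x (t + s)) - X (t + s)) \<le> e)"
proof -
  have "continuous_on {0..} x"
    using continuous_on_vector_derivative[of "{0..}" x X] d by simp
  then have "uniformly_continuous_on {0..t+1} x"
    by (intro compact_uniformly_continuous) (auto intro: continuous_on_subset)
  then obtain d1 where d1: "d1 > 0" "\<And>a b. a \<in> {0..t+1} \<Longrightarrow> b \<in> {0..t+1} \<Longrightarrow> dist b a < d1 \<Longrightarrow> dist (x b) (x a) < e"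
    by (rule uniformly_continuous_onE[OF _ e]) (rule that)
  have "uniformly_continuous_on {0..t+1} X" using cX
    by (intro compact_uniformly_continuous) (auto intro: continuous_on_subset)
  then obtain d2 where d2: "d2 > 0" "\<And>a b. a \<in> {0..t+1} \<Longrightarrow> b \<in> {0..t+1} \<Longrightarrow> dist b a < d2 \<Longrightarrow> dist (X b) (X a) < e"
    by (rule uniformly_continuous_onE[OF _ e]) (rule that)
  \<comment> \<open>The bound 1 keeps the shifted arguments within \<open>{0..t+1}\<close>, for
    which \<open>d1\<close> and \<open>d2\<close> were chosen.\<close>
  show ?thesis
  proof (intro exI[of _ "min 1 (min d1 d2)"] conjI allI impI ballI)
    show "0 < min 1 (min d1 d2)" using d1 d2 by simp
    fix t' s assume t': "\<tau> \<le> t'" "t' \<noteq> t \<and> \<bar>t' - t\<bar> < min 1 (min d1 d2)" and s: "s \<in> {-\<tau>..0}"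
    let ?a = "t + s" and ?b = "t' + s"
    have ab: "?a \<in> {0..t+1}" "?b \<in> {0..t+1}" "dist ?b ?a < d1" "dist ?b ?a < d2"
      using t t' s by (auto simp: dist_real_def)
    show "norm (x ?b - x ?a) \<le> e" using d1(2)[OF ab(1-3)] by (simp add: dist_norm)
    have seg: "closed_segment ?a ?b \<subseteq> {0..t+1}"
      using ab(1,2) by (intro closed_segment_subset) auto
    have "norm (x ?b - x ?a - (?b - ?a) *\<^sub>R X ?a) \<le> norm (?b - ?a) * e"
    proof (rule vector_differentiable_bound_linearization)
      show "(x has_vector_derivative X r) (at r within closed_segment ?a ?b)" if "r \<in> closed_segment ?a ?b" for r
        by (rule has_vector_derivative_within_subset[OF d[of r]]) (use that seg in auto)
      show "norm (X r - X ?a) \<le> e" if r: "r \<in> closed_segment ?a ?b" for r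
      proof -
        have "dist r ?a \<le> dist ?b ?a" using dist_in_closed_segment[OF r] by (simp add: dist_commute)
        then show ?thesis using d2(2)[of ?a r] ab seg r by (simp add: dist_norm) force
      qed
    qed auto
    moreover have "norm (?b - ?a) = \<bar>t' - t\<bar>" by simp
    moreover define u where "u = x ?b - x ?a - (?b - ?a) *\<^sub>R X ?a"
    ultimately have u: "norm u \<le> \<bar>t' - t\<bar> * e" by simp
    have "(1 / (t' - t)) *\<^sub>R (x ?b - x ?a) - X ?a = (1 / (t' - t)) *\<^sub>R u"
      unfolding u_def using t'(2) by (simp add: scaleR_diff_right[of _ "x ?b - x ?a"])
    then have "norm ((1 / (t' - t)) *\<^sub>R (x ?b - x ?a) - X ?a) = norm u / \<bar>t' - t\<bar>" by simp
    also have "\<dots> \<le> e" using u t'(2) by (simp add: divide_le_eq mult.commute)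
    finally show "norm ((1 / (t' - t)) *\<^sub>R (x ?b - x ?a) - X ?a) \<le> e" .
  qed
qed

lemma ip_add_right:
  assumes "continuous_on {-\<tau>..0::real} f" "continuous_on {-\<tau>..0} g" "continuous_on {-\<tau>..0} h"
  shows "ip \<tau> h (\<lambda>s. f s + g s) = ip \<tau> h f + ip \<tau> h g"
  using ip_add[OF assms] by (simp only: ip_commute[of _ h])

lemma ip_diff_right:
  assumes "continuous_on {-\<tau>..0::real} f" "continuous_on {-\<tau>..0} g" "continuous_on {-\<tau>..0} h"
  shows "ip \<tau> h (\<lambda>s. f s - g s) = ip \<tau> h f - ip \<tau> h g"
  using ip_diff[OF assms] by (simp only: ip_commute[of _ h])

section \<open>The dual Lyapunov argument\<close>

text \<open>
  The assumptions \<open>pos\<close> and \<open>neg\<close> are the two integral inequalities that remain of the membership in \<open>\<Xi>\<close>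
  after the elements of \<open>\<Theta>\<close> have dropped out, with classical derivatives \<open>S'\<close> of \<open>S\<close> and \<open>Rs\<close> of \<open>R\<close> in
  its first argument.
\<close>

locale dual_lyapunov =
  fixes \<tau> \<epsilon> :: real and A0 A1 :: "real^'n^'n" and S S' :: "real \<Rightarrow> real^'n^'n"
    and R Rs :: "real \<Rightarrow> real \<Rightarrow> real^'n^'n"
  assumes tau: "\<tau> > 0" and eps: "\<epsilon> > 0"
    and S_deriv: "\<And>s. s \<in> {-\<tau>..0} \<Longrightarrow> (S has_vector_derivative S' s) (at s within {-\<tau>..0})"
    and S'_cont: "continuous_on {-\<tau>..0} S'"
    and R_cont: "continuous_on ({-\<tau>..0} \<times> {-\<tau>..0}) (\<lambda>(s, \<theta>). R s \<theta>)"
    and R_deriv: "\<And>s \<theta>. s \<in> {-\<tau>..0} \<Longrightarrow> \<theta> \<in> {-\<tau>..0} \<Longrightarrow>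
          ((\<lambda>s. R s \<theta>) has_vector_derivative Rs s \<theta>) (at s within {-\<tau>..0})"
    and Rs_cont: "continuous_on ({-\<tau>..0} \<times> {-\<tau>..0}) (\<lambda>(s, \<theta>). Rs s \<theta>)"
    and R_sym: "\<And>s \<theta>. s \<in> {-\<tau>..0} \<Longrightarrow> \<theta> \<in> {-\<tau>..0} \<Longrightarrow> R s \<theta> = transpose (R \<theta> s)"
    and S_sym: "\<And>s. s \<in> {-\<tau>..0} \<Longrightarrow> transpose (S s) = S s"
    and S_coercive: "\<And>s w. s \<in> {-\<tau>..0} \<Longrightarrow> \<epsilon> * (w \<bullet> w) \<le> \<tau> * (w \<bullet> (S s *v w))"
    and R_separable: "\<exists>(K::nat) p q. (\<forall>k<K. continuous_on {-\<tau>..0} (p k) \<and> continuous_on {-\<tau>..0} (q k)) \<and>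
          (\<forall>s\<in>{-\<tau>..0}. \<forall>\<theta>\<in>{-\<tau>..0}. R s \<theta> = (\<Sum>k<K. p k s *\<^sub>R q k \<theta>))"
    and pos: "\<And>\<phi>. continuous_on {-\<tau>..0} \<phi> \<Longrightarrow>
        0 \<le> integral {-\<tau>..0} (\<lambda>s. \<phi> 0 \<bullet> ((\<tau> *\<^sub>R R 0 0 + \<tau> *\<^sub>R S 0) *v \<phi> 0) + \<phi> 0 \<bullet> ((\<tau> *\<^sub>R R 0 s) *v \<phi> s)
              + \<phi> s \<bullet> ((\<tau> *\<^sub>R R s 0) *v \<phi> 0) + \<phi> s \<bullet> ((\<tau> *\<^sub>R S s) *v \<phi> s)
              - \<epsilon> * (\<phi> 0 \<bullet> \<phi> 0 + \<phi> s \<bullet> \<phi> s))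
          + integral {-\<tau>..0} (\<lambda>s. integral {-\<tau>..0} (\<lambda>\<theta>. \<phi> s \<bullet> (R s \<theta> *v \<phi> \<theta>)))"
    and neg: "\<And>\<phi>. continuous_on {-\<tau>..0} \<phi> \<Longrightarrow>
        integral {-\<tau>..0} (\<lambda>s. 2 * (\<phi> 0 \<bullet> ((\<tau> *\<^sub>R (A0 ** (R 0 0 + S 0)) + \<tau> *\<^sub>R (A1 ** R (- \<tau>) 0) + (1/2) *\<^sub>R S 0) *v \<phi> 0))
              + \<epsilon> * (\<phi> 0 \<bullet> \<phi> 0)
              + 2 * (\<phi> 0 \<bullet> ((\<tau> *\<^sub>R (A1 ** S (-\<tau>))) *v \<phi> (-\<tau>)))
              - \<phi> (-\<tau>) \<bullet> (S (-\<tau>) *v \<phi> (-\<tau>))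
              + 2 * (\<phi> 0 \<bullet> ((\<tau> *\<^sub>R (A0 ** R 0 s + A1 ** R (-\<tau>) s + transpose (Rs s 0))) *v \<phi> s))
              + \<phi> s \<bullet> ((\<tau> *\<^sub>R S' s) *v \<phi> s) + \<epsilon> * (\<phi> s \<bullet> \<phi> s))
          + integral {-\<tau>..0} (\<lambda>s. integral {-\<tau>..0} (\<lambda>\<theta>. \<phi> s \<bullet> ((Rs s \<theta> + transpose (Rs \<theta> s)) *v \<phi> \<theta>))) \<le> 0"
begin

abbreviation "I \<equiv> {-\<tau>..0}"

lemma zero_in [simp]: "0 \<in> I" and mtau_in [simp]: "-\<tau> \<in> I"
  using tau by auto

lemma has_int_const: "((\<lambda>s. c) has_integral (\<tau> * c)) I" for c :: real
  using has_integral_const_real[of c "-\<tau>" 0] tau by simp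

lemma S_cont: "continuous_on I S"
  using S_deriv continuous_on_vector_derivative by blast

section \<open>The operator \<open>P\<close>: coercivity, symmetry and the dissipation
  inequality\<close>

definition P :: "(real \<Rightarrow> real^'n) \<Rightarrow> real \<Rightarrow> real^'n" where
  "P \<phi> s = \<tau> *\<^sub>R (R s 0 *v \<phi> 0) + \<tau> *\<^sub>R (S s *v \<phi> s) + integral I (\<lambda>\<theta>. R s \<theta> *v \<phi> \<theta>)"

lemma R_section: "s \<in> I \<Longrightarrow> continuous_on I (\<lambda>\<theta>. R s \<theta>)" "\<theta> \<in> I \<Longrightarrow> continuous_on I (\<lambda>s. R s \<theta>)"
  using continuous_on_section[OF R_cont] continuous_on_section'[OF R_cont] by auto

lemma Rs_section: "s \<in> I \<Longrightarrow> continuous_on I (\<lambda>\<theta>. Rs s \<theta>)" "\<theta> \<in> I \<Longrightarrow> continuous_on I (\<lambda>s. Rs s \<theta>)"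
  using continuous_on_section[OF Rs_cont] continuous_on_section'[OF Rs_cont] by auto

lemma P_cont: assumes "continuous_on I \<phi>" shows "continuous_on I (P \<phi>)"
  unfolding P_def
  by (intro continuous_intros continuous_on_matrix_vector_mult R_section S_cont assms zero_in
      continuous_on_kernel_integral R_cont)

text \<open>This is \<open>pos\<close> after integration: the terms in \<open>\<phi> 0\<close> alone
  are constants and acquire the factor \<open>\<tau>\<close>, which is the weight of the point value
  in \<open>ip\<close>.\<close>

lemma coercive:
  assumes \<phi>: "continuous_on I \<phi>"
  shows "\<epsilon> * ip \<tau> \<phi> \<phi> \<le> ip \<tau> \<phi> (P \<phi>)"
proof -
  define a where "a s = \<phi> 0 \<bullet> (R 0 s *v \<phi> s)" for s
  define b where "b s = \<phi> s \<bullet> (R s 0 *v \<phi> 0)" for s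
  define c where "c s = \<phi> s \<bullet> (S s *v \<phi> s)" for s
  define e where "e s = \<phi> s \<bullet> integral I (\<lambda>\<theta>. R s \<theta> *v \<phi> \<theta>)" for s
  define f where "f s = \<phi> s \<bullet> \<phi> s" for s
  have ca: "a integrable_on I" and cb: "b integrable_on I" and cc: "c integrable_on I" and ce: "e integrable_on I"
    and cf: "f integrable_on I"
    unfolding a_def b_def c_def e_def f_def
    by (intro integrable_continuous_real continuous_intros continuous_on_matrix_vector_mult R_section S_cont \<phi> zero_in
      continuous_on_kernel_integral R_cont)+
  have 1: "ip \<tau> \<phi> (P \<phi>) = \<tau> * (\<tau> * (\<phi> 0 \<bullet> (R 0 0 *v \<phi> 0) + \<phi> 0 \<bullet> (S 0 *v \<phi> 0)) + integral I a)
      + integral I (\<lambda>s. \<tau> * b s + \<tau> * c s + e s)"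
    unfolding ip_def P_def a_def b_def c_def e_def
    using inner_integral_right[OF continuous_on_matrix_vector_mult[OF R_section(1)[OF zero_in] \<phi>], of "\<phi> 0"]
    by (simp add: inner_add_right distrib_left)
  have 2: "integral I (\<lambda>s. \<tau> * b s + \<tau> * c s + e s) = \<tau> * integral I b + \<tau> * integral I c + integral I e"
    by (rule integral_unique) (intro has_integral_add has_integral_diff has_integral_mult_right integrable_integral has_int_const cb cc ce)
  have 3: "integral I (\<lambda>s. \<phi> 0 \<bullet> ((\<tau> *\<^sub>R R 0 0 + \<tau> *\<^sub>R S 0) *v \<phi> 0) + \<phi> 0 \<bullet> ((\<tau> *\<^sub>R R 0 s) *v \<phi> s)
              + \<phi> s \<bullet> ((\<tau> *\<^sub>R R s 0) *v \<phi> 0) + \<phi> s \<bullet> ((\<tau> *\<^sub>R S s) *v \<phi> s)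
              - \<epsilon> * (\<phi> 0 \<bullet> \<phi> 0 + \<phi> s \<bullet> \<phi> s))
    = integral I (\<lambda>s. (\<tau> * (\<phi> 0 \<bullet> (R 0 0 *v \<phi> 0) + \<phi> 0 \<bullet> (S 0 *v \<phi> 0)) - \<epsilon> * (\<phi> 0 \<bullet> \<phi> 0)) + \<tau> * a s + \<tau> * b s + \<tau> * c s - \<epsilon> * f s)"
    by (rule integral_cong) (simp add: a_def b_def c_def f_def matrix_scaleR_vector algebra_simps inner_add_right)
  have 4: "\<dots> = \<tau> * (\<tau> * (\<phi> 0 \<bullet> (R 0 0 *v \<phi> 0) + \<phi> 0 \<bullet> (S 0 *v \<phi> 0)) - \<epsilon> * (\<phi> 0 \<bullet> \<phi> 0)) + \<tau> * integral I a
      + \<tau> * integral I b + \<tau> * integral I c - \<epsilon> * integral I f"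
    by (rule integral_unique) (intro has_integral_add has_integral_diff has_integral_mult_right integrable_integral has_int_const ca cb cc cf)
  have 5: "integral I (\<lambda>s. integral I (\<lambda>\<theta>. \<phi> s \<bullet> (R s \<theta> *v \<phi> \<theta>))) = integral I e"
    unfolding e_def by (rule double_integral_inner_swap(2)[OF R_cont \<phi> \<phi>, symmetric])
  have 6: "ip \<tau> \<phi> \<phi> = \<tau> * (\<phi> 0 \<bullet> \<phi> 0) + integral I f" unfolding ip_def f_def by simp
  show ?thesis using pos[OF \<phi>] unfolding 3 4 5 1 2 6 by (simp add: algebra_simps)
qed


text \<open>Rests on the symmetry of \<open>S\<close>, the relation between
  \<open>R s \<theta>\<close> and \<open>R \<theta> s\<close>, and Fubini. It is what later spares
  the differentiation of preimages in time.\<close>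

lemma P_symmetric:
  assumes f: "continuous_on I f" and g: "continuous_on I g"
  shows "ip \<tau> (P f) g = ip \<tau> f (P g)"
proof -
  \<comment> \<open>The form of \<open>P\<close> written out. The two single integrals with
    \<open>R\<close> change places when \<open>f\<close> and \<open>g\<close> are swapped; every
    other term is symmetric by itself.\<close>
  define B where "B f g = \<tau> * (\<tau> * (g 0 \<bullet> (R 0 0 *v f 0)) + \<tau> * (g 0 \<bullet> (S 0 *v f 0)) + integral I (\<lambda>s. g 0 \<bullet> (R 0 s *v f s)))
    + \<tau> * integral I (\<lambda>s. g s \<bullet> (R s 0 *v f 0)) + \<tau> * integral I (\<lambda>s. g s \<bullet> (S s *v f s))
    + integral I (\<lambda>s. g s \<bullet> integral I (\<lambda>\<theta>. R s \<theta> *v f \<theta>))" for f g :: "real \<Rightarrow> real^'n"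
  have B: "ip \<tau> g (P f) = B f g" if f: "continuous_on I f" and g: "continuous_on I g" for f g
  proof -
    have "integral I (\<lambda>s. g s \<bullet> P f s) = integral I (\<lambda>s. \<tau> * (g s \<bullet> (R s 0 *v f 0)) + \<tau> * (g s \<bullet> (S s *v f s))
      + g s \<bullet> integral I (\<lambda>\<theta>. R s \<theta> *v f \<theta>))"
      unfolding P_def by (simp add: inner_add_right)
    also have "\<dots> = \<tau> * integral I (\<lambda>s. g s \<bullet> (R s 0 *v f 0)) + \<tau> * integral I (\<lambda>s. g s \<bullet> (S s *v f s))
      + integral I (\<lambda>s. g s \<bullet> integral I (\<lambda>\<theta>. R s \<theta> *v f \<theta>))"
      by (subst integral_add, (intro integrable_continuous_real continuous_intros continuous_on_matrix_vector_mult R_section S_cont f g zero_in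
      continuous_on_kernel_integral R_cont)+)
        (subst integral_add, (intro integrable_continuous_real continuous_intros continuous_on_matrix_vector_mult R_section S_cont f g zero_in
      continuous_on_kernel_integral R_cont)+, simp)
    finally show ?thesis unfolding ip_def B_def
      using inner_integral_right[OF continuous_on_matrix_vector_mult[OF R_section(1)[OF zero_in] f], of "g 0"]
      by (simp add: P_def inner_add_right algebra_simps)
  qed
  have adj: "u \<bullet> (R s \<theta> *v w) = w \<bullet> (R \<theta> s *v u)" if "s \<in> I" "\<theta> \<in> I" for s \<theta> u w
    by (subst R_sym[OF that], subst inner_transpose, rule inner_commute)
  have adjS: "u \<bullet> (S s *v w) = w \<bullet> (S s *v u)" if "s \<in> I" for s u w
    by (subst S_sym[OF that, symmetric], subst inner_transpose, rule inner_commute)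
  have "B f g = B g f"
  proof -
    have 1: "integral I (\<lambda>s. g 0 \<bullet> (R 0 s *v f s)) = integral I (\<lambda>s. f s \<bullet> (R s 0 *v g 0))"
      by (rule integral_cong) (rule adj, auto)
    have 2: "integral I (\<lambda>s. g s \<bullet> (R s 0 *v f 0)) = integral I (\<lambda>s. f 0 \<bullet> (R 0 s *v g s))"
      by (rule integral_cong) (rule adj, auto)
    have 3: "integral I (\<lambda>s. g s \<bullet> (S s *v f s)) = integral I (\<lambda>s. f s \<bullet> (S s *v g s))"
      by (rule integral_cong) (rule adjS)
    have "integral I (\<lambda>s. g s \<bullet> integral I (\<lambda>\<theta>. R s \<theta> *v f \<theta>))
      = integral I (\<lambda>s. integral I (\<lambda>\<theta>. g \<theta> \<bullet> (R \<theta> s *v f s)))"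
      by (rule double_integral_inner_swap(1)[OF R_cont f g])
    also have "\<dots> = integral I (\<lambda>s. integral I (\<lambda>\<theta>. f s \<bullet> (R s \<theta> *v g \<theta>)))"
      by (rule integral_cong, rule integral_cong, rule adj)
    also have "\<dots> = integral I (\<lambda>s. f s \<bullet> integral I (\<lambda>\<theta>. R s \<theta> *v g \<theta>))"
      by (rule double_integral_inner_swap(2)[OF R_cont g f, symmetric])
    finally show ?thesis unfolding B_def 1 2 3 using adj[OF zero_in zero_in, of "g 0" "f 0"] adjS[OF zero_in, of "g 0" "f 0"]
      by (simp add: algebra_simps)
  qed
  then show ?thesis using B[OF f g] B[OF g f] by (simp add: ip_commute)
qed

text \<open>With \<open>\<psi>\<close> in the role of \<open>P \<phi>\<close>,
  \<open>\<psi>'\<close> is its image under the generator and \<open>dom\<close> the boundary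
  condition that defines the generator's domain. The pairing is computed by integrating the part
  with \<open>S\<close> by parts. The boundary values at \<open>0\<close> and \<open>-\<tau>\<close>
  are the terms with \<open>(1/2) *\<^sub>R S 0\<close> and \<open>S (-\<tau>)\<close> in
  \<open>neg\<close>, and the two terms with \<open>\<epsilon>\<close> there make up
  \<open>\<epsilon> * ip \<tau> \<phi> \<phi>\<close>.\<close>

lemma dissipative:
  assumes \<phi>: "continuous_on I \<phi>"
    and \<psi>: "\<And>s. s \<in> I \<Longrightarrow> P \<phi> s = \<psi> s"
    and \<psi>': "\<And>s. s \<in> I \<Longrightarrow> (\<psi> has_vector_derivative \<psi>' s) (at s within I)"
    and c\<psi>': "continuous_on I \<psi>'"
    and dom: "\<psi>' 0 = A0 *v \<psi> 0 + A1 *v \<psi> (-\<tau>)"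
  shows "2 * ip \<tau> \<psi>' \<phi> \<le> - \<epsilon> * ip \<tau> \<phi> \<phi>"
proof -
  define y where "y = \<phi> (-\<tau>)"
  \<comment> \<open>The multiplication part of \<open>P \<phi>\<close>. It is differentiable,
    although \<open>\<phi>\<close> need not be, because \<open>\<psi>\<close> and the parts with
    \<open>R\<close> are.\<close>
  define u where "u s = \<tau> *\<^sub>R (S s *v \<phi> s)" for s
  define u' where "u' s = \<psi>' s - \<tau> *\<^sub>R (Rs s 0 *v \<phi> 0) - integral I (\<lambda>\<theta>. Rs s \<theta> *v \<phi> \<theta>)" for s
  have u'_cont: "continuous_on I u'" unfolding u'_def
    by (intro continuous_intros continuous_on_matrix_vector_mult Rs_section c\<psi>' \<phi> zero_in continuous_on_kernel_integral Rs_cont)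
  have u_deriv: "(u has_vector_derivative u' s) (at s within I)" if s: "s \<in> I" for s
  proof -
    have "((\<lambda>s. integral (cbox (-\<tau>) 0) (\<lambda>\<theta>. R s \<theta> *v \<phi> \<theta>)) has_vector_derivative
        integral (cbox (-\<tau>) 0) (\<lambda>\<theta>. Rs s \<theta> *v \<phi> \<theta>)) (at s within I)"
    proof (rule leibniz_rule_vector_derivative)
      fix x t assume "x \<in> I" "t \<in> cbox (-\<tau>) 0"
      then show "((\<lambda>x. R x t *v \<phi> t) has_vector_derivative Rs x t *v \<phi> t) (at x within I)"
        using has_vector_derivative_matrix_vector_mult[OF R_deriv[of x t] has_vector_derivative_const[of "\<phi> t"]]
        by simp
    next
      fix x assume "x \<in> I"
      then show "(\<lambda>\<theta>. R x \<theta> *v \<phi> \<theta>) integrable_on cbox (-\<tau>) 0"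
        by (intro integrable_continuous continuous_on_matrix_vector_mult) (use R_section \<phi> in auto)
    next
      show "continuous_on (I \<times> cbox (-\<tau>) 0) (\<lambda>(x, t). Rs x t *v \<phi> t)"
        unfolding split_beta using Rs_cont
        by (intro continuous_on_matrix_vector_mult continuous_on_compose2[OF \<phi>] continuous_intros)
          (auto simp: split_beta)
    qed (use s in auto)
    then have 1: "((\<lambda>s. integral I (\<lambda>\<theta>. R s \<theta> *v \<phi> \<theta>)) has_vector_derivative
        integral I (\<lambda>\<theta>. Rs s \<theta> *v \<phi> \<theta>)) (at s within I)" by simp
    have 2: "((\<lambda>s. \<tau> *\<^sub>R (R s 0 *v \<phi> 0)) has_vector_derivative \<tau> *\<^sub>R (Rs s 0 *v \<phi> 0)) (at s within I)"
      using has_vector_derivative_matrix_vector_mult[OF R_deriv[OF s zero_in] has_vector_derivative_const[of "\<phi> 0"]]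
      by (intro bounded_linear.has_vector_derivative[OF bounded_linear_scaleR_right]) simp
    have "((\<lambda>s. \<psi> s - \<tau> *\<^sub>R (R s 0 *v \<phi> 0) - integral I (\<lambda>\<theta>. R s \<theta> *v \<phi> \<theta>)) has_vector_derivative u' s) (at s within I)"
      unfolding u'_def by (intro has_vector_derivative_diff 1 2 \<psi>'[OF s])
    then show ?thesis
      by (rule has_vector_derivative_transform[OF s, rotated]) (simp add: u_def \<psi>[symmetric] P_def)
  qed
  define b where "b s = \<phi> s \<bullet> u s" for s
  have u_inner: "u s \<bullet> \<phi> r = \<tau> * (\<phi> s \<bullet> (S s *v \<phi> r))" if "s \<in> I" for s r
    by (simp only: u_def inner_scaleR_left inner_transpose[symmetric] S_sym[OF that])
  \<comment> \<open>\<open>\<phi>\<close> is only continuous; by symmetry of \<open>S\<close> the difference quotient of \<open>b\<close> only involves those of \<open>u\<close> and \<open>S\<close>.\<close>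
  have b_deriv: "(b has_vector_derivative (2 * (u' s \<bullet> \<phi> s) - \<tau> * (\<phi> s \<bullet> (S' s *v \<phi> s)))) (at s within I)"
    if s: "s \<in> I" for s
  proof -
    let ?F = "at s within I"
    have ne: "\<forall>\<^sub>F r in ?F. r \<noteq> s \<and> r \<in> I" unfolding eventually_at_filter by simp
    have lim\<phi>: "(\<phi> \<longlongrightarrow> \<phi> s) ?F" using \<phi> s by (simp add: continuous_on_def)
    have limu: "((\<lambda>r. (1 / (r - s)) *\<^sub>R (u r - u s)) \<longlongrightarrow> u' s) ?F"
      by (rule has_vector_derivative_quotient[OF u_deriv[OF s]])
    have limS: "((\<lambda>r. (1 / (r - s)) *\<^sub>R (S r - S s)) \<longlongrightarrow> S' s) ?F"
      by (rule has_vector_derivative_quotient[OF S_deriv[OF s]])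
    have "((\<lambda>r. ((1 / (r - s)) *\<^sub>R (u r - u s)) \<bullet> (\<phi> r + \<phi> s)
        - \<tau> * (\<phi> s \<bullet> (((1 / (r - s)) *\<^sub>R (S r - S s)) *v \<phi> r))) \<longlongrightarrow>
        u' s \<bullet> (\<phi> s + \<phi> s) - \<tau> * (\<phi> s \<bullet> (S' s *v \<phi> s))) ?F"
      by (intro tendsto_intros bounded_bilinear.tendsto[OF bounded_bilinear_matrix_vector_mult] limu limS lim\<phi>)
    moreover have "\<forall>\<^sub>F r in ?F. ((1 / (r - s)) *\<^sub>R (u r - u s)) \<bullet> (\<phi> r + \<phi> s)
        - \<tau> * (\<phi> s \<bullet> (((1 / (r - s)) *\<^sub>R (S r - S s)) *v \<phi> r)) = (1 / (r - s)) *\<^sub>R (b r - b s)"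
      using ne
    proof eventually_elim
      case (elim r)
      have "u s \<bullet> \<phi> r = \<tau> * (\<phi> s \<bullet> (S s *v \<phi> r))" "u r \<bullet> \<phi> s = \<tau> * (\<phi> s \<bullet> (S r *v \<phi> r))"
        using u_inner[OF s] by (simp, simp add: u_def inner_commute)
      then have "(u r - u s) \<bullet> (\<phi> r + \<phi> s) - \<tau> * (\<phi> s \<bullet> ((S r - S s) *v \<phi> r)) = b r - b s"
        by (simp add: b_def algebra_simps inner_commute)
      moreover have "((1 / (r - s)) *\<^sub>R (u r - u s)) \<bullet> (\<phi> r + \<phi> s)
        - \<tau> * (\<phi> s \<bullet> (((1 / (r - s)) *\<^sub>R (S r - S s)) *v \<phi> r))
        = (1 / (r - s)) * ((u r - u s) \<bullet> (\<phi> r + \<phi> s) - \<tau> * (\<phi> s \<bullet> ((S r - S s) *v \<phi> r)))"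
        unfolding matrix_scaleR_vector right_diff_distrib inner_scaleR_left inner_scaleR_right by (simp only: mult.left_commute)
      ultimately show ?case by simp
    qed
    ultimately have "((\<lambda>r. (1 / (r - s)) *\<^sub>R (b r - b s)) \<longlongrightarrow> u' s \<bullet> (\<phi> s + \<phi> s) - \<tau> * (\<phi> s \<bullet> (S' s *v \<phi> s))) ?F"
      by (rule Lim_transform_eventually)
    moreover have "u' s \<bullet> (\<phi> s + \<phi> s) = 2 * (u' s \<bullet> \<phi> s)" by (simp only: inner_add_right mult_2)
    ultimately show ?thesis
      unfolding has_real_derivative_iff_has_vector_derivative[symmetric] has_field_derivative_iff
      by simp
  qed
  \<comment> \<open>\<open>b\<close> is \<open>\<tau>\<close> times the form of \<open>S\<close> at
    \<open>\<phi>\<close>, so its end values supply the boundary terms without \<open>\<phi>\<close>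
    being differentiated.\<close>
  have ftc: "((\<lambda>s. 2 * (u' s \<bullet> \<phi> s) - \<tau> * (\<phi> s \<bullet> (S' s *v \<phi> s))) has_integral (b 0 - b (-\<tau>))) I"
    by (rule fundamental_theorem_of_calculus) (use tau in simp, rule b_deriv)
  define a where "a s = \<psi>' s \<bullet> \<phi> s" for s
  define c where "c s = \<phi> s \<bullet> (Rs s 0 *v \<phi> 0)" for s
  define e where "e s = \<phi> s \<bullet> integral I (\<lambda>\<theta>. Rs s \<theta> *v \<phi> \<theta>)" for s
  define h where "h s = \<phi> s \<bullet> (S' s *v \<phi> s)" for s
  define f where "f s = \<phi> s \<bullet> \<phi> s" for s
  define k where "k s = \<phi> 0 \<bullet> (A0 *v (R 0 s *v \<phi> s))" for s
  define l where "l s = \<phi> 0 \<bullet> (A1 *v (R (-\<tau>) s *v \<phi> s))" for s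
  have ca: "a integrable_on I" and cc: "c integrable_on I" and ce: "e integrable_on I" and ch: "h integrable_on I"
    and cf: "f integrable_on I" and ck: "k integrable_on I" and cl: "l integrable_on I"
    unfolding a_def c_def e_def f_def h_def k_def l_def
    by (intro integrable_continuous_real continuous_intros continuous_on_matrix_vector_mult R_section Rs_section S'_cont \<phi> c\<psi>' zero_in mtau_in
      continuous_on_kernel_integral Rs_cont)+
  have I1: "2 * integral I a - 2 * \<tau> * integral I c - 2 * integral I e - \<tau> * integral I h
      = \<tau> * (\<phi> 0 \<bullet> (S 0 *v \<phi> 0)) - \<tau> * (y \<bullet> (S (-\<tau>) *v y))"
  proof -
    have "integral I (\<lambda>s. 2 * (u' s \<bullet> \<phi> s) - \<tau> * (\<phi> s \<bullet> (S' s *v \<phi> s)))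
      = integral I (\<lambda>s. 2 * a s - 2 * \<tau> * c s - 2 * e s - \<tau> * h s)"
      by (rule integral_cong) (simp add: u'_def a_def c_def e_def h_def inner_diff_left inner_diff_right inner_commute right_diff_distrib)
    also have "\<dots> = 2 * integral I a - 2 * \<tau> * integral I c - 2 * integral I e - \<tau> * integral I h"
      by (rule integral_unique) (intro has_integral_add has_integral_diff has_integral_mult_right integrable_integral has_int_const ca cc ce ch)
    finally show ?thesis using integral_unique[OF ftc] by (simp add: b_def u_def y_def)
  qed
  \<comment> \<open>The point value in \<open>ip\<close> is where the delay equation enters:
    \<open>dom\<close> expresses \<open>\<psi>' 0\<close> through \<open>P \<phi>\<close> at
    \<open>0\<close> and at \<open>-\<tau>\<close>.\<close>
  have I2: "\<psi>' 0 \<bullet> \<phi> 0 = \<tau> * (\<phi> 0 \<bullet> (A0 *v ((R 0 0 + S 0) *v \<phi> 0))) + integral I k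
      + \<tau> * (\<phi> 0 \<bullet> (A1 *v (R (-\<tau>) 0 *v \<phi> 0))) + \<tau> * (\<phi> 0 \<bullet> (A1 *v (S (-\<tau>) *v y))) + integral I l"
  proof -
    have c1: "continuous_on I (\<lambda>s. R 0 s *v \<phi> s)" and c2: "continuous_on I (\<lambda>s. R (-\<tau>) s *v \<phi> s)"
      by (intro continuous_on_matrix_vector_mult R_section \<phi> zero_in mtau_in)+
    have c3: "continuous_on I (\<lambda>s. A0 *v (R 0 s *v \<phi> s))" and c4: "continuous_on I (\<lambda>s. A1 *v (R (-\<tau>) s *v \<phi> s))"
      by (intro continuous_on_matrix_vector_mult R_section \<phi> zero_in mtau_in continuous_intros)+
    have "A0 *v P \<phi> 0 = \<tau> *\<^sub>R (A0 *v ((R 0 0 + S 0) *v \<phi> 0)) + integral I (\<lambda>s. A0 *v (R 0 s *v \<phi> s))"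
      unfolding P_def integral_matrix_vector[OF c1, symmetric]
      by (simp add: matrix_vector_right_distrib matrix_vector_mult_scaleR matrix_vector_mult_add_rdistrib scaleR_add_right)
    then have 1: "\<phi> 0 \<bullet> (A0 *v P \<phi> 0) = \<tau> * (\<phi> 0 \<bullet> (A0 *v ((R 0 0 + S 0) *v \<phi> 0))) + integral I k"
      unfolding k_def by (simp add: inner_add_right inner_integral_right[OF c3])
    have "A1 *v P \<phi> (-\<tau>) = \<tau> *\<^sub>R (A1 *v (R (-\<tau>) 0 *v \<phi> 0)) + \<tau> *\<^sub>R (A1 *v (S (-\<tau>) *v y))
        + integral I (\<lambda>s. A1 *v (R (-\<tau>) s *v \<phi> s))"
      unfolding P_def integral_matrix_vector[OF c2, symmetric] y_def
      by (simp add: matrix_vector_right_distrib matrix_vector_mult_scaleR)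
    then have 2: "\<phi> 0 \<bullet> (A1 *v P \<phi> (-\<tau>)) = \<tau> * (\<phi> 0 \<bullet> (A1 *v (R (-\<tau>) 0 *v \<phi> 0)))
        + \<tau> * (\<phi> 0 \<bullet> (A1 *v (S (-\<tau>) *v y))) + integral I l"
      unfolding l_def by (simp add: inner_add_right inner_integral_right[OF c4])
    have "\<psi>' 0 \<bullet> \<phi> 0 = \<phi> 0 \<bullet> (A0 *v P \<phi> 0) + \<phi> 0 \<bullet> (A1 *v P \<phi> (-\<tau>))"
      unfolding dom \<psi>[OF zero_in] \<psi>[OF mtau_in] by (simp only: inner_add_right inner_commute[of "_ + _"])
    then show ?thesis unfolding 1 2 by simp
  qed
  \<comment> \<open>The kernel is the sum of two mutually adjoint kernels, which contribute equally
    to the quadratic form.\<close>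
  have G: "integral I (\<lambda>s. integral I (\<lambda>\<theta>. \<phi> s \<bullet> ((Rs s \<theta> + transpose (Rs \<theta> s)) *v \<phi> \<theta>))) = 2 * integral I e"
  proof -
    have c0: "continuous_on (I \<times> I) (\<lambda>z. Rs (fst z) (snd z))" using Rs_cont by (simp add: split_beta)
    have "continuous_on (I \<times> I) (\<lambda>z. (snd z, fst z))" by (intro continuous_intros)
    moreover have "(\<lambda>z. (snd z, fst z)) ` (I \<times> I) \<subseteq> I \<times> I" by (rule image_subsetI) (simp add: mem_Times_iff)
    ultimately have c1: "continuous_on (I \<times> I) (\<lambda>z. Rs (snd z) (fst z))"
      using continuous_on_compose2[OF Rs_cont, of "I \<times> I" "\<lambda>z. (snd z, fst z)"] by simp
    have cK: "continuous_on (I \<times> I) (\<lambda>(s, \<theta>). Rs s \<theta> + transpose (Rs \<theta> s))"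
      unfolding split_beta by (intro continuous_on_add continuous_on_transpose c0 c1)
    have cT: "continuous_on (I \<times> I) (\<lambda>(s, \<theta>). transpose (Rs \<theta> s))"
      unfolding split_beta by (intro continuous_on_transpose c1)
    define e2 where "e2 s = \<phi> s \<bullet> integral I (\<lambda>\<theta>. transpose (Rs \<theta> s) *v \<phi> \<theta>)" for s
    have "integral I e2 = integral I (\<lambda>s. integral I (\<lambda>\<theta>. \<phi> \<theta> \<bullet> (transpose (Rs s \<theta>) *v \<phi> s)))"
      unfolding e2_def by (rule double_integral_inner_swap(1)[OF cT \<phi> \<phi>])
    also have "\<dots> = integral I (\<lambda>s. integral I (\<lambda>\<theta>. \<phi> s \<bullet> (Rs s \<theta> *v \<phi> \<theta>)))"
      unfolding inner_transpose by (simp add: inner_commute)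
    also have "\<dots> = integral I e" unfolding e_def by (rule double_integral_inner_swap(2)[OF Rs_cont \<phi> \<phi>, symmetric])
    finally have e2: "integral I e2 = integral I e" .
    have ce2: "e2 integrable_on I" unfolding e2_def
      by (intro integrable_continuous_real continuous_intros \<phi> continuous_on_kernel_integral cT)
    have "integral I (\<lambda>s. integral I (\<lambda>\<theta>. \<phi> s \<bullet> ((Rs s \<theta> + transpose (Rs \<theta> s)) *v \<phi> \<theta>)))
      = integral I (\<lambda>s. \<phi> s \<bullet> integral I (\<lambda>\<theta>. (Rs s \<theta> + transpose (Rs \<theta> s)) *v \<phi> \<theta>))"
      by (rule double_integral_inner_swap(2)[OF cK \<phi> \<phi>, symmetric])
    also have "\<dots> = integral I (\<lambda>s. e s + e2 s)"
    proof (rule integral_cong)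
      fix s assume s: "s \<in> I"
      have "(\<lambda>\<theta>. Rs s \<theta> *v \<phi> \<theta>) integrable_on I" "(\<lambda>\<theta>. transpose (Rs \<theta> s) *v \<phi> \<theta>) integrable_on I"
        by (intro integrable_continuous_real continuous_on_matrix_vector_mult continuous_on_transpose Rs_section s \<phi>)+
      then show "\<phi> s \<bullet> integral I (\<lambda>\<theta>. (Rs s \<theta> + transpose (Rs \<theta> s)) *v \<phi> \<theta>) = e s + e2 s"
        unfolding e_def e2_def matrix_vector_mult_add_rdistrib
        by (simp add: integral_add inner_add_right del: transpose_matrix_vector)
    qed
    also have "\<dots> = integral I e + integral I e2" by (rule integral_add[OF ce ce2])
    finally show ?thesis using e2 by simp
  qed
  have J: "integral I (\<lambda>s. 2 * (\<phi> 0 \<bullet> ((\<tau> *\<^sub>R (A0 ** (R 0 0 + S 0)) + \<tau> *\<^sub>R (A1 ** R (- \<tau>) 0) + (1/2) *\<^sub>R S 0) *v \<phi> 0))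
              + \<epsilon> * (\<phi> 0 \<bullet> \<phi> 0)
              + 2 * (\<phi> 0 \<bullet> ((\<tau> *\<^sub>R (A1 ** S (-\<tau>))) *v \<phi> (-\<tau>)))
              - \<phi> (-\<tau>) \<bullet> (S (-\<tau>) *v \<phi> (-\<tau>))
              + 2 * (\<phi> 0 \<bullet> ((\<tau> *\<^sub>R (A0 ** R 0 s + A1 ** R (-\<tau>) s + transpose (Rs s 0))) *v \<phi> s))
              + \<phi> s \<bullet> ((\<tau> *\<^sub>R S' s) *v \<phi> s) + \<epsilon> * (\<phi> s \<bullet> \<phi> s))
     = integral I (\<lambda>s. (2 * \<tau> * (\<phi> 0 \<bullet> (A0 *v ((R 0 0 + S 0) *v \<phi> 0))) + 2 * \<tau> * (\<phi> 0 \<bullet> (A1 *v (R (-\<tau>) 0 *v \<phi> 0)))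
          + \<phi> 0 \<bullet> (S 0 *v \<phi> 0) + \<epsilon> * (\<phi> 0 \<bullet> \<phi> 0) + 2 * \<tau> * (\<phi> 0 \<bullet> (A1 *v (S (-\<tau>) *v y))) - y \<bullet> (S (-\<tau>) *v y))
          + 2 * \<tau> * k s + 2 * \<tau> * l s + 2 * \<tau> * c s + \<tau> * h s + \<epsilon> * f s)"
  proof (rule integral_cong)
    fix s assume "s \<in> I"
    have 1: "\<phi> 0 \<bullet> (transpose (Rs s 0) *v \<phi> s) = c s" unfolding inner_transpose c_def by (simp add: inner_commute)
    have 2: "\<phi> 0 \<bullet> ((\<tau> *\<^sub>R (A0 ** R 0 s + A1 ** R (-\<tau>) s + transpose (Rs s 0))) *v \<phi> s) = \<tau> * k s + \<tau> * l s + \<tau> * c s"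
      unfolding 1[symmetric] k_def l_def matrix_scaleR_vector matrix_vector_mult_add_rdistrib inner_scaleR_right inner_add_right matrix_vector_mul_assoc
      by (simp add: algebra_simps)
    have q1: "\<phi> 0 \<bullet> ((\<tau> *\<^sub>R (A0 ** (R 0 0 + S 0)) + \<tau> *\<^sub>R (A1 ** R (- \<tau>) 0) + (1/2) *\<^sub>R S 0) *v \<phi> 0)
      = \<tau> * (\<phi> 0 \<bullet> (A0 *v ((R 0 0 + S 0) *v \<phi> 0))) + \<tau> * (\<phi> 0 \<bullet> (A1 *v (R (-\<tau>) 0 *v \<phi> 0))) + (1/2) * (\<phi> 0 \<bullet> (S 0 *v \<phi> 0))"
      by (simp only: matrix_vector_mult_add_rdistrib[of "_ + _" "(1/2) *\<^sub>R _"] matrix_vector_mult_add_rdistrib[of "\<tau> *\<^sub>R _"]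
          matrix_scaleR_vector inner_add_right inner_scaleR_right matrix_vector_mul_assoc)
    have q2: "\<phi> 0 \<bullet> ((\<tau> *\<^sub>R (A1 ** S (-\<tau>))) *v \<phi> (-\<tau>)) = \<tau> * (\<phi> 0 \<bullet> (A1 *v (S (-\<tau>) *v \<phi> (-\<tau>))))"
      by (simp only: matrix_scaleR_vector inner_scaleR_right matrix_vector_mul_assoc)
    show "2 * (\<phi> 0 \<bullet> ((\<tau> *\<^sub>R (A0 ** (R 0 0 + S 0)) + \<tau> *\<^sub>R (A1 ** R (- \<tau>) 0) + (1/2) *\<^sub>R S 0) *v \<phi> 0))
              + \<epsilon> * (\<phi> 0 \<bullet> \<phi> 0)
              + 2 * (\<phi> 0 \<bullet> ((\<tau> *\<^sub>R (A1 ** S (-\<tau>))) *v \<phi> (-\<tau>)))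
              - \<phi> (-\<tau>) \<bullet> (S (-\<tau>) *v \<phi> (-\<tau>))
              + 2 * (\<phi> 0 \<bullet> ((\<tau> *\<^sub>R (A0 ** R 0 s + A1 ** R (-\<tau>) s + transpose (Rs s 0))) *v \<phi> s))
              + \<phi> s \<bullet> ((\<tau> *\<^sub>R S' s) *v \<phi> s) + \<epsilon> * (\<phi> s \<bullet> \<phi> s)
      = (2 * \<tau> * (\<phi> 0 \<bullet> (A0 *v ((R 0 0 + S 0) *v \<phi> 0))) + 2 * \<tau> * (\<phi> 0 \<bullet> (A1 *v (R (-\<tau>) 0 *v \<phi> 0)))
          + \<phi> 0 \<bullet> (S 0 *v \<phi> 0) + \<epsilon> * (\<phi> 0 \<bullet> \<phi> 0) + 2 * \<tau> * (\<phi> 0 \<bullet> (A1 *v (S (-\<tau>) *v y))) - y \<bullet> (S (-\<tau>) *v y))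
          + 2 * \<tau> * k s + 2 * \<tau> * l s + 2 * \<tau> * c s + \<tau> * h s + \<epsilon> * f s"
      unfolding 2 q1 q2 h_def f_def y_def by (simp add: matrix_scaleR_vector algebra_simps)
  qed
  also have "\<dots> = \<tau> * (2 * \<tau> * (\<phi> 0 \<bullet> (A0 *v ((R 0 0 + S 0) *v \<phi> 0))) + 2 * \<tau> * (\<phi> 0 \<bullet> (A1 *v (R (-\<tau>) 0 *v \<phi> 0)))
          + \<phi> 0 \<bullet> (S 0 *v \<phi> 0) + \<epsilon> * (\<phi> 0 \<bullet> \<phi> 0) + 2 * \<tau> * (\<phi> 0 \<bullet> (A1 *v (S (-\<tau>) *v y))) - y \<bullet> (S (-\<tau>) *v y))
      + 2 * \<tau> * integral I k + 2 * \<tau> * integral I l + 2 * \<tau> * integral I c + \<tau> * integral I h + \<epsilon> * integral I f"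
    (is "integral I (\<lambda>s. ?c + _ + _ + _ + _ + _) = _")
    by (rule integral_unique) (intro has_integral_add has_integral_diff has_integral_mult_right integrable_integral has_int_const ck cl cc ch cf)
  finally have J': "\<dots> + 2 * integral I e \<le> 0" using neg[OF \<phi>] G by simp
  \<comment> \<open>\<open>I1\<close> accounts for the integral and \<open>I2\<close>, multiplied by
    \<open>2 * \<tau>\<close>, for the point value; together with the terms in
    \<open>\<epsilon>\<close> they add up to the left side of \<open>J'\<close>.\<close>
  have "2 * ip \<tau> \<psi>' \<phi> + \<epsilon> * ip \<tau> \<phi> \<phi> = 2 * \<tau> * (\<psi>' 0 \<bullet> \<phi> 0) + 2 * integral I a + \<epsilon> * \<tau> * (\<phi> 0 \<bullet> \<phi> 0) + \<epsilon> * integral I f"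
    unfolding ip_def a_def f_def by (simp add: algebra_simps)
  also have "\<dots> \<le> 0" using J' I1 unfolding I2 by (simp add: algebra_simps)
  finally show ?thesis by simp
qed

section \<open>Invertibility of \<open>P\<close> on continuous functions\<close>

lemma P_zero_imp_zero:
  assumes \<phi>: "continuous_on I \<phi>" and P: "\<And>s. s \<in> I \<Longrightarrow> P \<phi> s = 0" and s: "s \<in> I"
  shows "\<phi> s = 0"
proof -
  have "integral I (\<lambda>s. \<phi> s \<bullet> P \<phi> s) = integral I (\<lambda>s. 0)"
    by (rule integral_cong) (simp add: P)
  then have "ip \<tau> \<phi> (P \<phi>) = 0" using P[OF zero_in] by (simp add: ip_def)
  then have "\<epsilon> * ip \<tau> \<phi> \<phi> \<le> 0" using coercive[OF \<phi>] by simp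
  then have le: "ip \<tau> \<phi> \<phi> \<le> 0" using eps by (simp add: mult_le_0_iff)
  have "0 \<le> integral I (\<lambda>s. \<phi> s \<bullet> \<phi> s)"
    by (intro integral_nonneg ip_integrable \<phi>) auto
  moreover have "0 \<le> \<tau> * (\<phi> 0 \<bullet> \<phi> 0)" using tau by simp
  ultimately have "integral I (\<lambda>s. \<phi> s \<bullet> \<phi> s) = 0" using le unfolding ip_def by linarith
  then have "\<phi> s \<bullet> \<phi> s = 0"
    using s integral_eq_0_iff[of "-\<tau>" 0 "\<lambda>s. \<phi> s \<bullet> \<phi> s"] tau continuous_on_inner[OF \<phi> \<phi>]
    by simp
  then show ?thesis by simp
qed

definition Sinv where "Sinv s = matrix_inv (\<tau> *\<^sub>R S s)"

lemma Sinv: assumes "s \<in> I" shows "\<tau> *\<^sub>R (S s *v (Sinv s *v w)) = w"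
proof -
  have "w = 0" if "(\<tau> *\<^sub>R S s) *v w = 0" for w
  proof -
    have "S s *v w = 0" using that tau unfolding matrix_scaleR_vector by simp
    then have "\<epsilon> * (w \<bullet> w) \<le> 0" using S_coercive[OF assms, of w] by simp
    then have "w \<bullet> w = 0" using eps inner_ge_zero[of w] by (simp add: mult_le_0_iff)
    then show ?thesis by simp
  qed
  then have "invertible (\<tau> *\<^sub>R S s)"
    unfolding invertible_left_inverse matrix_left_invertible_ker by blast
  then have "\<exists>B. (\<tau> *\<^sub>R S s) ** B = mat 1 \<and> B ** (\<tau> *\<^sub>R S s) = mat 1"
    unfolding invertible_def .
  then have "(\<tau> *\<^sub>R S s) ** Sinv s = mat 1 \<and> Sinv s ** (\<tau> *\<^sub>R S s) = mat 1"
    unfolding Sinv_def matrix_inv_def by (rule someI_ex)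
  then have "((\<tau> *\<^sub>R S s) ** Sinv s) *v w = w" by simp
  then show ?thesis by (simp only: matrix_vector_mul_assoc[symmetric] matrix_scaleR_vector)
qed

text \<open>Cauchy-Schwarz applied to \<open>S_coercive\<close>. In other words, the inverse of
  \<open>\<tau>\<close> times \<open>S s\<close> is bounded by \<open>1 / \<epsilon>\<close>
  uniformly in \<open>s\<close>.\<close>

lemma S_norm: assumes "s \<in> I" shows "\<epsilon> * norm w \<le> norm (\<tau> *\<^sub>R (S s *v w))"
proof (cases "w = 0")
  case False
  have "\<epsilon> * (norm w * norm w) \<le> w \<bullet> (\<tau> *\<^sub>R (S s *v w))"
    using S_coercive[OF assms, of w] by (simp add: dot_square_norm power2_eq_square)
  also have "\<dots> \<le> norm w * norm (\<tau> *\<^sub>R (S s *v w))" by (rule norm_cauchy_schwarz)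
  finally have "norm w * (\<epsilon> * norm w) \<le> norm w * norm (\<tau> *\<^sub>R (S s *v w))" by (simp add: mult_ac)
  then show ?thesis using False by simp
qed simp

text \<open>Compare with the fixed vector \<open>Sinv s *v g s\<close>: \<open>\<tau>\<close> times
  \<open>S r\<close> maps the difference to an expression that tends to 0 by continuity of
  \<open>g\<close> and \<open>S\<close>, and \<open>S_norm\<close> carries this back uniformly in
  \<open>r\<close>.\<close>

lemma Sinv_cont:
  assumes g: "continuous_on I g"
  shows "continuous_on I (\<lambda>s. Sinv s *v g s)"
  unfolding continuous_on_def
proof
  fix s assume s: "s \<in> I"
  let ?w = "Sinv s *v g s"
  have "((\<lambda>r. (1 / \<epsilon>) * norm (g r - \<tau> *\<^sub>R (S r *v ?w))) \<longlongrightarrow> (1 / \<epsilon>) * norm (g s - \<tau> *\<^sub>R (S s *v ?w))) (at s within I)"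
    using S_cont g s unfolding continuous_on_def
    by (intro tendsto_intros bounded_bilinear.tendsto[OF bounded_bilinear_matrix_vector_mult]) auto
  then have lim: "((\<lambda>r. (1 / \<epsilon>) * norm (g r - \<tau> *\<^sub>R (S r *v ?w))) \<longlongrightarrow> 0) (at s within I)"
    by (simp add: Sinv[OF s])
  have "((\<lambda>r. norm (Sinv r *v g r - ?w)) \<longlongrightarrow> 0) (at s within I)"
  proof (rule Lim_null_comparison[OF _ lim])
    show "\<forall>\<^sub>F r in at s within I. norm (norm (Sinv r *v g r - ?w)) \<le> (1 / \<epsilon>) * norm (g r - \<tau> *\<^sub>R (S r *v ?w))"
      unfolding eventually_at_filter
    proof (intro always_eventually allI impI)
      fix r assume r: "r \<in> I"
      have "\<tau> *\<^sub>R (S r *v (Sinv r *v g r - ?w)) = g r - \<tau> *\<^sub>R (S r *v ?w)"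
        by (simp add: matrix_vector_mult_diff_distrib scaleR_diff_right Sinv[OF r])
      then have "\<epsilon> * norm (Sinv r *v g r - ?w) \<le> norm (g r - \<tau> *\<^sub>R (S r *v ?w))"
        using S_norm[OF r] by metis
      then show "norm (norm (Sinv r *v g r - ?w)) \<le> (1 / \<epsilon>) * norm (g r - \<tau> *\<^sub>R (S r *v ?w))"
        using eps by (simp add: field_simps)
    qed
  qed
  then show "((\<lambda>s. Sinv s *v g s) \<longlongrightarrow> ?w) (at s within I)"
    by (rule LIM_zero_cancel[OF tendsto_norm_zero_cancel])
qed

text \<open>After division by \<open>\<tau>\<close> times \<open>S\<close> the equation reads
  \<open>z + L z = y\<close>, with \<open>L\<close> of finite rank because \<open>R\<close> is a
  finite sum of products. As \<open>finite_rank_surj\<close> works in a vector space given as a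
  type, the unknown is taken from the bounded continuous functions on the whole line, of which only
  the restriction to \<open>I\<close> matters in the end.\<close>

lemma P_surj:
  assumes \<psi>: "continuous_on I \<psi>"
  shows "\<exists>\<phi>. continuous_on I \<phi> \<and> (\<forall>s\<in>I. P \<phi> s = \<psi> s)"
proof -
  obtain K :: nat and p q where pq0: "\<forall>k<K. continuous_on I (p k) \<and> continuous_on I (q k)"
    and R0: "\<forall>s\<in>I. \<forall>\<theta>\<in>I. R s \<theta> = (\<Sum>k<K. p k s *\<^sub>R q k \<theta>)"
    using R_separable by (elim exE conjE) (rule that)
  have pq: "continuous_on I (p k)" "continuous_on I (q k)" if "k < K" for k using pq0 that by blast+
  have R: "R s \<theta> = (\<Sum>k<K. p k s *\<^sub>R q k \<theta>)" if "s \<in> I" "\<theta> \<in> I" for s \<theta>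
    using R0 that by blast
  \<comment> \<open>These functions span the range of \<open>L\<close>. Clamping extends them beyond
    the interval by their end values, which keeps them continuous and bounded.\<close>
  have "\<exists>e :: real \<Rightarrow>\<^sub>C (real^'n). \<forall>s. e s = Sinv (clamp (-\<tau>) 0 s) *v (p k (clamp (-\<tau>) 0 s) *\<^sub>R axis i 1)" if "k < K" for k i
  proof -
    have "continuous_on I (\<lambda>s. Sinv s *v (p k s *\<^sub>R axis i 1))"
      by (intro Sinv_cont continuous_on_scaleR pq that continuous_on_const)
    then have "continuous_on (cbox (-\<tau>) 0) (\<lambda>s. Sinv s *v (p k s *\<^sub>R axis i 1))" by simp
    then show ?thesis by (rule continuous_on_cbox_bcontfunE) (rule exI, rule allI)
  qed
  then have "\<forall>k. \<forall>i. \<exists>e :: real \<Rightarrow>\<^sub>C (real^'n). k < K \<longrightarrow> (\<forall>s. e s = Sinv (clamp (-\<tau>) 0 s) *v (p k (clamp (-\<tau>) 0 s) *\<^sub>R axis i 1))"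
    by blast
  then obtain e :: "nat \<Rightarrow> 'n \<Rightarrow> real \<Rightarrow>\<^sub>C (real^'n)" where
    e0: "\<forall>k i. k < K \<longrightarrow> (\<forall>s. e k i s = Sinv (clamp (-\<tau>) 0 s) *v (p k (clamp (-\<tau>) 0 s) *\<^sub>R axis i 1))"
    unfolding choice_iff by (elim exE) (rule that)
  then have e: "e k i s = Sinv (clamp (-\<tau>) 0 s) *v (p k (clamp (-\<tau>) 0 s) *\<^sub>R axis i 1)" if "k < K" for k i s
    using that by blast
  have clamp: "clamp (-\<tau>) 0 s = s" if "s \<in> I" for s
    using that by (intro clamp_cancel_cbox) simp
  \<comment> \<open>Coefficient vectors of the terms with \<open>R\<close>: the second factors of
    \<open>R\<close> are paired with \<open>z\<close> once at the point \<open>0\<close> and once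
    under the integral.\<close>
  define c where "c k z = \<tau> *\<^sub>R (q k 0 *v apply_bcontfun z 0) + integral I (\<lambda>\<theta>. q k \<theta> *v apply_bcontfun z \<theta>)" for k z
  define L where "L z = (\<Sum>k<K. \<Sum>i\<in>UNIV. (c k z $ i) *\<^sub>R e k i)" for z
  have cint: "(\<lambda>\<theta>. q k \<theta> *v apply_bcontfun z \<theta>) integrable_on I" if "k < K" for k z
    by (intro integrable_continuous_real continuous_on_matrix_vector_mult pq that continuous_on_apply_bcontfun)
  have c_add: "c k (x + y) = c k x + c k y" if "k < K" for k x y
    unfolding c_def using cint[OF that] by (simp add: plus_bcontfun.rep_eq algebra_simps integral_add)
  have c_scale: "c k (r *\<^sub>R x) = r *\<^sub>R c k x" for k r x
    unfolding c_def by (simp add: scaleR_bcontfun.rep_eq algebra_simps)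
  have Llin: "linear L"
    by (rule linearI) (simp_all add: L_def c_add c_scale scaleR_add_left sum.distrib scaleR_sum_right)
  have L: "L z s = Sinv s *v (\<tau> *\<^sub>R (R s 0 *v z 0) + integral I (\<lambda>\<theta>. R s \<theta> *v z \<theta>))" if s: "s \<in> I" for z s
  proof -
    have app: "(\<Sum>x\<in>X. h x) t = (\<Sum>x\<in>X. h x t)" if "finite X" for X t and h :: "'z \<Rightarrow> real \<Rightarrow>\<^sub>C (real^'n)"
      using that by (induction X) (auto simp: plus_bcontfun.rep_eq zero_bcontfun.rep_eq)
    have "L z s = (\<Sum>k<K. \<Sum>i\<in>UNIV. (c k z $ i) *\<^sub>R (Sinv s *v (p k s *\<^sub>R axis i 1)))"
      unfolding L_def by (simp add: app scaleR_bcontfun.rep_eq e clamp[OF s])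
    also have "\<dots> = Sinv s *v (\<Sum>k<K. p k s *\<^sub>R (\<Sum>i\<in>UNIV. (c k z $ i) *\<^sub>R axis i 1))"
      by (simp add: matrix_vector_mult_scaleR linear_sum[OF matrix_vector_mul_linear] scaleR_sum_right mult.commute)
    also have "(\<Sum>k<K. p k s *\<^sub>R (\<Sum>i\<in>UNIV. (c k z $ i) *\<^sub>R axis i 1)) = (\<Sum>k<K. p k s *\<^sub>R c k z)"
    proof -
      have "(\<Sum>i\<in>UNIV. (v $ i) *\<^sub>R axis i 1) = v" for v :: "real^'n"
        using basis_expansion[of v] by (simp add: scalar_mult_eq_scaleR)
      then show ?thesis by (simp only:)
    qed
    also have "\<dots> = \<tau> *\<^sub>R (R s 0 *v z 0) + integral I (\<lambda>\<theta>. R s \<theta> *v z \<theta>)"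
    proof -
      have mv: "(\<Sum>k<K. A k) *v w = (\<Sum>k<K. A k *v w)" for A :: "nat \<Rightarrow> real^'n^'n" and w
        by (rule bounded_bilinear.sum_left[OF bounded_bilinear_matrix_vector_mult])
      have "integral I (\<lambda>\<theta>. R s \<theta> *v z \<theta>) = integral I (\<lambda>\<theta>. \<Sum>k<K. p k s *\<^sub>R (q k \<theta> *v z \<theta>))"
        by (rule integral_cong) (simp only: R[OF s] mv matrix_scaleR_vector)
      also have "\<dots> = (\<Sum>k<K. p k s *\<^sub>R integral I (\<lambda>\<theta>. q k \<theta> *v z \<theta>))"
        using cint by (subst integral_sum) (auto intro: integrable_cmul)
      finally show ?thesis
        by (simp add: c_def R[OF s zero_in] mv matrix_scaleR_vector scaleR_add_right sum.distrib scaleR_sum_right mult.commute)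
    qed
    finally show ?thesis .
  qed
  \<comment> \<open>\<open>L z\<close> depends on \<open>z\<close> only through its values on
    \<open>I\<close>. Hence if \<open>z + L z = 0\<close> and \<open>z\<close> vanishes on
    \<open>I\<close>, then \<open>z\<close> vanishes on the whole line, which is injectivity on the
    chosen space.\<close>
  have L_out: "L z = 0" if "\<And>s. s \<in> I \<Longrightarrow> apply_bcontfun z s = 0" for z :: "real \<Rightarrow>\<^sub>C (real^'n)"
  proof -
    have "c k z = 0" for k
    proof -
      have "integral I (\<lambda>\<theta>. q k \<theta> *v z \<theta>) = integral I (\<lambda>\<theta>. 0)"
        by (rule integral_cong) (simp add: that)
      then show ?thesis using that[OF zero_in] by (simp add: c_def)
    qed
    then show ?thesis by (simp add: L_def)
  qed
  define B where "B = (\<lambda>(k, i). e k i) ` ({..<K} \<times> UNIV)"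
  \<comment> \<open>Multiplication by \<open>\<tau>\<close> times \<open>S\<close> turns the
    perturbed identity back into \<open>P\<close>.\<close>
  have key: "\<tau> *\<^sub>R (S s *v apply_bcontfun (z + L z) s) = P z s" if "s \<in> I" for z :: "real \<Rightarrow>\<^sub>C (real^'n)" and s
    using that by (simp add: plus_bcontfun.rep_eq L P_def matrix_vector_right_distrib scaleR_add_right Sinv)
  have cy: "continuous_on (cbox (-\<tau>) 0) (\<lambda>s. Sinv s *v \<psi> s)" using Sinv_cont[OF \<psi>] by simp
  obtain y :: "real \<Rightarrow>\<^sub>C (real^'n)" where y0: "\<And>s. s \<in> cbox (-\<tau>) 0 \<Longrightarrow> apply_bcontfun y s = Sinv s *v \<psi> s"
    by (rule continuous_on_cbox_bcontfunE[OF cy]) (rule that)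
  have y: "apply_bcontfun y s = Sinv s *v \<psi> s" if "s \<in> I" for s
    using y0[of s] that by simp
  have "\<exists>z. z + L z = y"
  proof (rule finite_rank_surj)
    show "linear (\<lambda>z. z + L z)" using Llin by (intro linear_compose_add linear_ident)
    show "finite B" by (simp add: B_def)
    show "z + L z - z \<in> span B" for z
    proof -
      have "L z \<in> span B" unfolding L_def
        by (intro span_sum span_scale span_base) (auto simp: B_def)
      then show ?thesis by simp
    qed
    show "z = 0" if "z + L z = 0" for z
    proof -
      have "P z s = 0" if "s \<in> I" for s using key[OF that, of z] \<open>z + L z = 0\<close> by (simp add: zero_bcontfun.rep_eq)
      then have "apply_bcontfun z s = 0" if "s \<in> I" for s using P_zero_imp_zero[OF continuous_on_apply_bcontfun, of z] that by simp
      then have "L z = 0" by (rule L_out)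
      then show ?thesis using that by simp
    qed
  qed
  then obtain z where z: "z + L z = y" ..
  have "P z s = \<psi> s" if "s \<in> I" for s
    using key[OF that, of z] unfolding z y[OF that] Sinv[OF that] by simp
  then show ?thesis by (intro exI[of _ "apply_bcontfun z"]) auto
qed

section \<open>Boundedness of \<open>P\<close>\<close>

lemma P_bounded: "\<exists>C>0. \<forall>\<phi>. continuous_on I \<phi> \<longrightarrow> ip \<tau> (P \<phi>) (P \<phi>) \<le> C * ip \<tau> \<phi> \<phi>"
proof -
  obtain B1 where B1: "norm A \<le> B1" if "A \<in> (\<lambda>(s, \<theta>). R s \<theta>) ` (I \<times> I)" for A
    using compact_imp_bounded[OF compact_continuous_image[OF R_cont compact_Times[OF compact_Icc compact_Icc]]]
    unfolding bounded_iff by blast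
  obtain B2 where B2: "norm A \<le> B2" if "A \<in> S ` I" for A
    using compact_imp_bounded[OF compact_continuous_image[OF S_cont compact_Icc]]
    unfolding bounded_iff by blast
  obtain k where k: "k \<ge> 0" "\<And>(A :: real^'n^'n) x. norm (A *v x) \<le> norm A * norm x * k"
    using bounded_bilinear.nonneg_bounded[OF bounded_bilinear_matrix_vector_mult] by blast
  \<comment> \<open>A common bound for the action of all \<open>R s \<theta>\<close> and all
    \<open>S s\<close>, so that the three terms of \<open>P\<close> are estimated alike.\<close>
  define r where "r = \<bar>B1\<bar> * k + \<bar>B2\<bar> * k"
  have r0: "r \<ge> 0" using k unfolding r_def by simp
  have rR: "norm (R s \<theta> *v w) \<le> r * norm w" if "s \<in> I" "\<theta> \<in> I" for s \<theta> w
  proof -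
    have "(s, \<theta>) \<in> I \<times> I" using that by (simp only: mem_Times_iff fst_conv snd_conv)
    then have "norm (R s \<theta>) \<le> B1" using B1[OF imageI, of "(s, \<theta>)"] by simp
    then have "norm (R s \<theta>) * norm w * k \<le> \<bar>B1\<bar> * norm w * k" using k(1) by (intro mult_right_mono) auto
    also have "\<dots> \<le> r * norm w" unfolding r_def using k(1) by (simp add: algebra_simps)
    finally show ?thesis using k(2)[of "R s \<theta>" w] by linarith
  qed
  have rS: "norm (S s *v w) \<le> r * norm w" if "s \<in> I" for s w
  proof -
    have "norm (S s) \<le> B2" using B2[OF imageI, of s] that by simp
    then have "norm (S s) * norm w * k \<le> \<bar>B2\<bar> * norm w * k" using k(1) by (intro mult_right_mono) auto
    also have "\<dots> \<le> r * norm w" unfolding r_def using k(1) by (simp add: algebra_simps)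
    finally show ?thesis using k(2)[of "S s" w] by linarith
  qed
  have main: "ip \<tau> (P \<phi>) (P \<phi>) \<le> (9 * \<tau>\<^sup>2 * r\<^sup>2) * ip \<tau> \<phi> \<phi>" if \<phi>: "continuous_on I \<phi>" for \<phi>
  proof -
    define a where "a = norm (\<phi> 0)"
    define n where "n = integral I (\<lambda>s. norm (\<phi> s))"
    define J where "J = integral I (\<lambda>s. \<phi> s \<bullet> \<phi> s)"
    have n2: "n\<^sup>2 \<le> \<tau> * J"
      using integral_square_le[OF tau continuous_on_norm[OF \<phi>]] by (simp add: n_def J_def dot_square_norm)
    \<comment> \<open>Three terms, hence the factor 3 for the square of their sum; \<open>n2\<close>
      handles the integral term. In \<open>ip\<close> the point value and the square integral of
      \<open>\<phi>\<close> are then each collected three times, which makes the constant 9.\<close>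
    have pw: "P \<phi> s \<bullet> P \<phi> s \<le> 3 * (\<tau>\<^sup>2 * r\<^sup>2 * a\<^sup>2 + \<tau>\<^sup>2 * r\<^sup>2 * (\<phi> s \<bullet> \<phi> s) + r\<^sup>2 * \<tau> * J)" if s: "s \<in> I" for s
    proof -
      have "norm (integral I (\<lambda>\<theta>. R s \<theta> *v \<phi> \<theta>)) \<le> integral I (\<lambda>\<theta>. r * norm (\<phi> \<theta>))"
        by (rule integral_norm_bound_integral)
          (intro integrable_continuous_real continuous_on_matrix_vector_mult R_section s \<phi> continuous_intros, 
           intro integrable_continuous_real \<phi> continuous_intros, rule rR[OF s])
      then have 3: "norm (integral I (\<lambda>\<theta>. R s \<theta> *v \<phi> \<theta>)) \<le> r * n" by (simp add: n_def)
      have 1: "norm (\<tau> *\<^sub>R (R s 0 *v \<phi> 0)) \<le> \<tau> * r * a" using rR[OF s zero_in, of "\<phi> 0"] tau by (simp add: a_def)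
      have 2: "norm (\<tau> *\<^sub>R (S s *v \<phi> s)) \<le> \<tau> * r * norm (\<phi> s)" using rS[OF s, of "\<phi> s"] tau by simp
      have "norm (P \<phi> s) \<le> \<tau> * r * a + \<tau> * r * norm (\<phi> s) + r * n"
        unfolding P_def using 1 2 3 by (intro order_trans[OF norm_triangle_ineq] add_mono) auto
      then have "(norm (P \<phi> s))\<^sup>2 \<le> (\<tau> * r * a + \<tau> * r * norm (\<phi> s) + r * n)\<^sup>2" by (intro power_mono) auto
      also have "\<dots> \<le> 3 * ((\<tau> * r * a)\<^sup>2 + (\<tau> * r * norm (\<phi> s))\<^sup>2 + (r * n)\<^sup>2)"
      proof -
        have "(x + y + z)\<^sup>2 \<le> 3 * (x\<^sup>2 + y\<^sup>2 + z\<^sup>2)" for x y z :: real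
          using zero_le_power2[of "x - y"] zero_le_power2[of "y - z"] zero_le_power2[of "x - z"]
          by (simp add: power2_eq_square algebra_simps)
        then show ?thesis .
      qed
      also have "(r * n)\<^sup>2 \<le> r\<^sup>2 * (\<tau> * J)" using n2 by (simp add: power_mult_distrib mult_left_mono)
      finally show ?thesis by (simp add: power_mult_distrib dot_square_norm)
    qed
    have f: "(\<lambda>s. \<phi> s \<bullet> \<phi> s) integrable_on I" by (rule ip_integrable[OF \<phi> \<phi>])
    have hi: "((\<lambda>s. 3 * (\<tau>\<^sup>2 * r\<^sup>2 * a\<^sup>2 + \<tau>\<^sup>2 * r\<^sup>2 * (\<phi> s \<bullet> \<phi> s) + r\<^sup>2 * \<tau> * J)) has_integral
        3 * (\<tau> * (\<tau>\<^sup>2 * r\<^sup>2 * a\<^sup>2) + \<tau>\<^sup>2 * r\<^sup>2 * J + \<tau> * (r\<^sup>2 * \<tau> * J))) I"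
      unfolding J_def by (intro has_integral_mult_right has_integral_add has_int_const integrable_integral f)
    have "integral I (\<lambda>s. P \<phi> s \<bullet> P \<phi> s) \<le> 3 * (\<tau> * (\<tau>\<^sup>2 * r\<^sup>2 * a\<^sup>2) + \<tau>\<^sup>2 * r\<^sup>2 * J + \<tau> * (r\<^sup>2 * \<tau> * J))"
      unfolding integral_unique[OF hi, symmetric]
      by (rule integral_le[OF ip_integrable[OF P_cont[OF \<phi>] P_cont[OF \<phi>]] has_integral_integrable[OF hi] pw])
    moreover have "\<tau> * (P \<phi> 0 \<bullet> P \<phi> 0) \<le> \<tau> * (3 * (\<tau>\<^sup>2 * r\<^sup>2 * a\<^sup>2 + \<tau>\<^sup>2 * r\<^sup>2 * a\<^sup>2 + r\<^sup>2 * \<tau> * J))"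
      using pw[OF zero_in] tau by (simp add: a_def dot_square_norm)
    ultimately have "ip \<tau> (P \<phi>) (P \<phi>) \<le> \<tau> * (3 * (\<tau>\<^sup>2 * r\<^sup>2 * a\<^sup>2 + \<tau>\<^sup>2 * r\<^sup>2 * a\<^sup>2 + r\<^sup>2 * \<tau> * J))
       + 3 * (\<tau> * (\<tau>\<^sup>2 * r\<^sup>2 * a\<^sup>2) + \<tau>\<^sup>2 * r\<^sup>2 * J + \<tau> * (r\<^sup>2 * \<tau> * J))" unfolding ip_def by linarith
    also have "\<dots> = (9 * \<tau>\<^sup>2 * r\<^sup>2) * (\<tau> * a\<^sup>2 + J)"
      by (simp add: algebra_simps power2_eq_square)
    finally show ?thesis by (simp add: ip_def a_def J_def dot_square_norm)
  qed
  \<comment> \<open>The summand 1 makes the constant positive whatever the value of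
    \<open>r\<close>.\<close>
  show ?thesis
  proof (intro exI[of _ "9 * \<tau>\<^sup>2 * r\<^sup>2 + 1"] conjI allI impI)
    show "0 < 9 * \<tau>\<^sup>2 * r\<^sup>2 + 1" by (simp add: add_nonneg_pos)
    fix \<phi> :: "real \<Rightarrow> real^'n" assume \<phi>: "continuous_on I \<phi>"
    show "ip \<tau> (P \<phi>) (P \<phi>) \<le> (9 * \<tau>\<^sup>2 * r\<^sup>2 + 1) * ip \<tau> \<phi> \<phi>"
      using main[OF \<phi>] ip_nonneg[OF tau, of \<phi>] unfolding distrib_right by linarith
  qed
qed

section \<open>The Lyapunov functional along solutions\<close>

lemma P_add:
  assumes "continuous_on I f" "continuous_on I g" "s \<in> I"
  shows "P (\<lambda>s. f s + g s) s = P f s + P g s"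
proof -
  have "(\<lambda>\<theta>. R s \<theta> *v f \<theta>) integrable_on I" "(\<lambda>\<theta>. R s \<theta> *v g \<theta>) integrable_on I"
    by (intro integrable_continuous_real continuous_on_matrix_vector_mult R_section assms)+
  then show ?thesis unfolding P_def by (simp add: algebra_simps integral_add)
qed

lemma P_diff:
  assumes "continuous_on I f" "continuous_on I g" "s \<in> I"
  shows "P (\<lambda>s. f s - g s) s = P f s - P g s"
proof -
  have "(\<lambda>\<theta>. R s \<theta> *v f \<theta>) integrable_on I" "(\<lambda>\<theta>. R s \<theta> *v g \<theta>) integrable_on I"
    by (intro integrable_continuous_real continuous_on_matrix_vector_mult R_section assms)+
  then show ?thesis unfolding P_def by (simp add: algebra_simps integral_diff)
qed

text \<open>Here \<open>ip \<tau> y z\<close> is the value of V at \<open>y = P z\<close>, compared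
  with the norms of \<open>z\<close> and of \<open>y\<close>. Young's inequality with weight
  \<open>1 / \<epsilon>\<close> produces exactly the term that coercivity absorbs. The third bound
  is continuity of the inverse of \<open>P\<close>.\<close>

lemma preimage_bounds:
  assumes z: "continuous_on I z" and y: "continuous_on I y" and Pz: "\<And>s. s \<in> I \<Longrightarrow> P z s = y s"
  shows "\<epsilon> * ip \<tau> z z \<le> ip \<tau> y z" "ip \<tau> y z \<le> ip \<tau> y y / \<epsilon>" "ip \<tau> z z \<le> ip \<tau> y y / \<epsilon>\<^sup>2"
proof -
  have "ip \<tau> z (P z) = ip \<tau> y z"
    unfolding ip_commute[of _ z] by (rule ip_cong) (auto simp: tau Pz)
  then show 1: "\<epsilon> * ip \<tau> z z \<le> ip \<tau> y z" using coercive[OF z] by simp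
  have 2: "2 * \<bar>ip \<tau> y z\<bar> \<le> ip \<tau> y y / \<epsilon> + \<epsilon> * ip \<tau> z z"
    using ip_young[OF tau y z, of "1 / \<epsilon>"] eps by (simp add: mult.commute)
  show 3: "ip \<tau> y z \<le> ip \<tau> y y / \<epsilon>" using 1 2 by linarith
  have "\<epsilon> * ip \<tau> z z \<le> ip \<tau> y y / \<epsilon>" using 1 3 by linarith
  then show "ip \<tau> z z \<le> ip \<tau> y y / \<epsilon>\<^sup>2" using eps by (simp add: field_simps power2_eq_square)
qed

text \<open>The difference quotient of V is the sum of the pairings of the difference quotient of
  the segments with the old and with the new preimage. Preimages enter through bounds on their sum
  and difference, which by linearity of \<open>P\<close> are preimages of sums and differences of
  segments; thus \<open>Z\<close> may be any choice of preimages.\<close>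

lemma lyapunov_deriv:
  fixes x X :: "real \<Rightarrow> real^'n"
  assumes d: "\<And>r. r \<ge> 0 \<Longrightarrow> (x has_vector_derivative X r) (at r within {0..})"
    and cX: "continuous_on {0..} X"
    and Z: "\<And>t. t \<ge> \<tau> \<Longrightarrow> continuous_on I (Z t)" "\<And>t s. t \<ge> \<tau> \<Longrightarrow> s \<in> I \<Longrightarrow> P (Z t) s = x (t + s)"
    and t: "t \<ge> \<tau>"
  shows "((\<lambda>t. ip \<tau> (\<lambda>s. x (t + s)) (Z t)) has_real_derivative 2 * ip \<tau> (\<lambda>s. X (t + s)) (Z t)) (at t within {\<tau>..})"
proof -
  have cx: "continuous_on {0..} x"
    using continuous_on_vector_derivative[of "{0..}" x X] d by simp
  have cy: "continuous_on I (\<lambda>s. x (t + s))" if "t \<ge> \<tau>" for t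
    by (rule continuous_on_compose2[OF cx]) (use that in \<open>auto intro!: continuous_intros\<close>)
  have cY: "continuous_on I (\<lambda>s. X (t + s))"
    by (rule continuous_on_compose2[OF cX]) (use t in \<open>auto intro!: continuous_intros\<close>)
  have "bounded (x ` {0..t+1})"
    by (intro compact_imp_bounded compact_continuous_image continuous_on_subset[OF cx]) auto
  then obtain B where B: "\<forall>v\<in>x ` {0..t+1}. norm v \<le> B" unfolding bounded_iff by blast
  \<comment> \<open>Half the sum of the right sides of \<open>b1\<close> and \<open>b2\<close>
    below, divided by \<open>e\<close>; the half undoes the factor 2 in Young's inequality.\<close>
  define M where "M = (2 * \<tau> + 2 * \<tau> * (2 * B)\<^sup>2 / \<epsilon>\<^sup>2 + ip \<tau> (\<lambda>s. X (t + s)) (\<lambda>s. X (t + s)) + 2 * \<tau> / \<epsilon>\<^sup>2) / 2"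
  have M0: "M \<ge> 0" unfolding M_def using tau ip_nonneg[OF tau, of "\<lambda>s. X (t + s)"] by simp
  have key: "\<bar>(ip \<tau> (\<lambda>s. x (t' + s)) (Z t') - ip \<tau> (\<lambda>s. x (t + s)) (Z t)) / (t' - t) - 2 * ip \<tau> (\<lambda>s. X (t + s)) (Z t)\<bar> \<le> e * M"
    if e: "e > 0" and t': "t' \<ge> \<tau>" "t' \<noteq> t" "\<bar>t' - t\<bar> < 1"
      and close: "\<And>s. s \<in> I \<Longrightarrow> norm (x (t' + s) - x (t + s)) \<le> e"
         "\<And>s. s \<in> I \<Longrightarrow> norm ((1 / (t' - t)) *\<^sub>R (x (t' + s) - x (t + s)) - X (t + s)) \<le> e" for t' e
  proof -
    let ?y = "\<lambda>s. x (t + s)" and ?y' = "\<lambda>s. x (t' + s)" and ?z = "Z t" and ?z' = "Z t'" and ?Y = "\<lambda>s. X (t + s)"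
    let ?q = "\<lambda>s. (1 / (t' - t)) *\<^sub>R (x (t' + s) - x (t + s))"
    note c = cy[OF t] cy[OF t'(1)] Z(1)[OF t] Z(1)[OF t'(1)] cY
    have cd: "continuous_on I (\<lambda>s. ?y' s - ?y s)" and cs: "continuous_on I (\<lambda>s. ?y' s + ?y s)"
      and zd: "continuous_on I (\<lambda>s. ?z' s - ?z s)" and zs: "continuous_on I (\<lambda>s. ?z' s + ?z s)"
      and cq: "continuous_on I ?q" and cqY: "continuous_on I (\<lambda>s. ?q s - ?Y s)"
      by (intro continuous_on_diff continuous_on_add continuous_on_scaleR continuous_on_const c)+
    \<comment> \<open>Symmetry of \<open>P\<close> replaces the derivative of \<open>P\<inverse> x\<^sub>t\<close> by continuity of \<open>P\<inverse> x\<^sub>t\<close>.\<close>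
    have sym: "ip \<tau> ?y ?z' = ip \<tau> ?y' ?z"
    proof -
      have "ip \<tau> ?y ?z' = ip \<tau> (P ?z) ?z'" by (rule ip_cong[OF tau]) (simp_all add: Z(2)[OF t])
      also have "\<dots> = ip \<tau> ?z (P ?z')" by (rule P_symmetric[OF c(3,4)])
      also have "\<dots> = ip \<tau> ?z ?y'" by (rule ip_cong[OF tau]) (simp_all add: Z(2)[OF t'(1)])
      finally show ?thesis by (simp only: ip_commute)
    qed
    have V: "ip \<tau> ?y' ?z' - ip \<tau> ?y ?z = (t' - t) * (ip \<tau> ?q ?z' + ip \<tau> ?q ?z)"
    proof -
      have "ip \<tau> (\<lambda>s. ?y' s - ?y s) ?z' + ip \<tau> (\<lambda>s. ?y' s - ?y s) ?z = ip \<tau> ?y' ?z' - ip \<tau> ?y ?z"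
        unfolding ip_diff[OF c(2) c(1) c(4)] ip_diff[OF c(2) c(1) c(3)] using sym by simp
      moreover have "h * ((1 / h) * a + (1 / h) * b) = a + b" if "h \<noteq> 0" for h a b :: real
        using that by (simp add: distrib_left)
      ultimately show ?thesis unfolding ip_scale using t'(2) by simp
    qed
    have "(ip \<tau> ?y' ?z' - ip \<tau> ?y ?z) / (t' - t) = ip \<tau> ?q ?z' + ip \<tau> ?q ?z"
      unfolding V using t'(2) by simp
    then have eq: "(ip \<tau> ?y' ?z' - ip \<tau> ?y ?z) / (t' - t) - 2 * ip \<tau> ?Y ?z
        = ip \<tau> (\<lambda>s. ?q s - ?Y s) (\<lambda>s. ?z' s + ?z s) + ip \<tau> ?Y (\<lambda>s. ?z' s - ?z s)"
      unfolding ip_add_right[OF c(4) c(3) cqY] ip_diff_right[OF c(4) c(3) c(5)] ip_diff[OF cq c(5) c(4)] ip_diff[OF cq c(5) c(3)]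
      by simp
    have b1: "2 * \<bar>ip \<tau> (\<lambda>s. ?q s - ?Y s) (\<lambda>s. ?z' s + ?z s)\<bar> \<le> e * (2 * \<tau> + 2 * \<tau> * (2 * B)\<^sup>2 / \<epsilon>\<^sup>2)"
    proof -
      have "norm (?y' s + ?y s) \<le> 2 * B" if s: "s \<in> I" for s
      proof -
        have "t' + s \<in> {0..t+1}" "t + s \<in> {0..t+1}" using s t t' by auto
        then have "norm (?y' s) \<le> B" "norm (?y s) \<le> B" using B by blast+
        then show ?thesis using norm_triangle_ineq[of "?y' s" "?y s"] by linarith
      qed
      then have "ip \<tau> (\<lambda>s. ?y' s + ?y s) (\<lambda>s. ?y' s + ?y s) \<le> 2 * \<tau> * (2 * B)\<^sup>2"
        by (rule ip_le_sup[OF tau cs])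
      moreover have "ip \<tau> (\<lambda>s. ?z' s + ?z s) (\<lambda>s. ?z' s + ?z s) \<le> ip \<tau> (\<lambda>s. ?y' s + ?y s) (\<lambda>s. ?y' s + ?y s) / \<epsilon>\<^sup>2"
        by (rule preimage_bounds(3)[OF zs cs]) (simp only: P_add[OF c(4) c(3)] Z(2)[OF t] Z(2)[OF t'(1)])
      ultimately have G: "ip \<tau> (\<lambda>s. ?z' s + ?z s) (\<lambda>s. ?z' s + ?z s) \<le> 2 * \<tau> * (2 * B)\<^sup>2 / \<epsilon>\<^sup>2"
        using eps divide_right_mono[of _ "2 * \<tau> * (2 * B)\<^sup>2" "\<epsilon>\<^sup>2"] by (meson order_trans zero_le_power2)
      have F: "ip \<tau> (\<lambda>s. ?q s - ?Y s) (\<lambda>s. ?q s - ?Y s) \<le> 2 * \<tau> * e\<^sup>2"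
        by (rule ip_le_sup[OF tau cqY]) (rule close(2))
      \<comment> \<open>The first argument is of order \<open>e\<close> and the second is bounded,
        so the weight \<open>1 / e\<close> makes both summands linear in \<open>e\<close>. In
        \<open>b2\<close> the orders are exchanged and the weight is \<open>e\<close>.\<close>
      have "2 * \<bar>ip \<tau> (\<lambda>s. ?q s - ?Y s) (\<lambda>s. ?z' s + ?z s)\<bar> \<le>
          (1 / e) * ip \<tau> (\<lambda>s. ?q s - ?Y s) (\<lambda>s. ?q s - ?Y s) + ip \<tau> (\<lambda>s. ?z' s + ?z s) (\<lambda>s. ?z' s + ?z s) / (1 / e)"
        using e by (intro ip_young[OF tau cqY zs]) simp
      also have "\<dots> \<le> (1 / e) * (2 * \<tau> * e\<^sup>2) + (2 * \<tau> * (2 * B)\<^sup>2 / \<epsilon>\<^sup>2) / (1 / e)"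
        using e F G by (intro add_mono mult_left_mono divide_right_mono) auto
      also have "\<dots> = e * (2 * \<tau> + 2 * \<tau> * (2 * B)\<^sup>2 / \<epsilon>\<^sup>2)"
        using e by (simp add: power2_eq_square distrib_left mult_ac)
      finally show ?thesis .
    qed
    have b2: "2 * \<bar>ip \<tau> ?Y (\<lambda>s. ?z' s - ?z s)\<bar> \<le> e * (ip \<tau> ?Y ?Y + 2 * \<tau> / \<epsilon>\<^sup>2)"
    proof -
      have "ip \<tau> (\<lambda>s. ?y' s - ?y s) (\<lambda>s. ?y' s - ?y s) \<le> 2 * \<tau> * e\<^sup>2"
        by (rule ip_le_sup[OF tau cd]) (rule close(1))
      moreover have "ip \<tau> (\<lambda>s. ?z' s - ?z s) (\<lambda>s. ?z' s - ?z s) \<le> ip \<tau> (\<lambda>s. ?y' s - ?y s) (\<lambda>s. ?y' s - ?y s) / \<epsilon>\<^sup>2"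
        by (rule preimage_bounds(3)[OF zd cd]) (simp only: P_diff[OF c(4) c(3)] Z(2)[OF t] Z(2)[OF t'(1)])
      ultimately have G: "ip \<tau> (\<lambda>s. ?z' s - ?z s) (\<lambda>s. ?z' s - ?z s) \<le> 2 * \<tau> * e\<^sup>2 / \<epsilon>\<^sup>2"
        using divide_right_mono[of _ "2 * \<tau> * e\<^sup>2" "\<epsilon>\<^sup>2"] by (meson order_trans zero_le_power2)
      have "2 * \<bar>ip \<tau> ?Y (\<lambda>s. ?z' s - ?z s)\<bar> \<le> e * ip \<tau> ?Y ?Y + ip \<tau> (\<lambda>s. ?z' s - ?z s) (\<lambda>s. ?z' s - ?z s) / e"
        by (rule ip_young[OF tau cY zd e])
      also have "\<dots> \<le> e * ip \<tau> ?Y ?Y + (2 * \<tau> * e\<^sup>2 / \<epsilon>\<^sup>2) / e"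
        using e G by (intro add_mono divide_right_mono) auto
      also have "\<dots> = e * (ip \<tau> ?Y ?Y + 2 * \<tau> / \<epsilon>\<^sup>2)"
        using e by (simp add: power2_eq_square distrib_left mult_ac)
      finally show ?thesis .
    qed
    have "e * M = (e * (2 * \<tau> + 2 * \<tau> * (2 * B)\<^sup>2 / \<epsilon>\<^sup>2) + e * (ip \<tau> ?Y ?Y + 2 * \<tau> / \<epsilon>\<^sup>2)) / 2"
      unfolding M_def by (simp only: distrib_left times_divide_eq_right add.assoc)
    then show ?thesis unfolding eq by (rule abs_add_le_half[OF _ b1 b2])
  qed
  show ?thesis unfolding has_field_derivative_iff
  proof (rule tendstoI)
    fix r :: real assume r: "r > 0"
    define e where "e = r / (M + 1)"
    have e: "e > 0" "e * M < r" using r M0 by (simp_all add: e_def field_simps)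
    obtain \<delta> where \<delta>: "\<delta> > 0" "\<forall>t'\<ge>\<tau>. t' \<noteq> t \<and> \<bar>t' - t\<bar> < \<delta> \<longrightarrow> (\<forall>s\<in>I. norm (x (t' + s) - x (t + s)) \<le> e \<and>
      norm ((1 / (t' - t)) *\<^sub>R (x (t' + s) - x (t + s)) - X (t + s)) \<le> e)"
      using uniform_quotient[OF d cX t e(1)] by blast
    show "\<forall>\<^sub>F t' in at t within {\<tau>..}. dist ((ip \<tau> (\<lambda>s. x (t' + s)) (Z t') - ip \<tau> (\<lambda>s. x (t + s)) (Z t)) / (t' - t))
        (2 * ip \<tau> (\<lambda>s. X (t + s)) (Z t)) < r"
      unfolding eventually_at
    proof (intro exI[of _ "min 1 \<delta>"] conjI ballI impI)
      show "0 < min 1 \<delta>" using \<delta>(1) by simp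
      fix t' assume t': "t' \<in> {\<tau>..}" "t' \<noteq> t \<and> dist t' t < min 1 \<delta>"
      then have *: "t' \<ge> \<tau>" "t' \<noteq> t" "\<bar>t' - t\<bar> < 1" "\<bar>t' - t\<bar> < \<delta>" by (auto simp: dist_real_def)
      show "dist ((ip \<tau> (\<lambda>s. x (t' + s)) (Z t') - ip \<tau> (\<lambda>s. x (t + s)) (Z t)) / (t' - t))
        (2 * ip \<tau> (\<lambda>s. X (t + s)) (Z t)) < r"
        unfolding dist_real_def
        by (rule le_less_trans[OF key[OF e(1) *(1-3)] e(2)]) (use \<delta>(2) * in blast)+
    qed
  qed
qed

text \<open>Along a solution the derivative of V is at most
  \<open>- \<epsilon> * ip \<tau> z z\<close>, where z is the preimage of the segment, and V is at
  most \<open>(C + 1) / 2\<close> times \<open>ip \<tau> z z\<close> by Young's inequality and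
  boundedness of \<open>P\<close>; this is the origin of the rate \<open>c\<close>. In the
  prefactor, one \<open>1 / \<epsilon>\<close> comes from bounding V at time \<open>\<tau>\<close>,
  the other from recovering the norm of z from V, and \<open>C\<close> from passing from z to the
  segment. The estimate starts at \<open>\<tau>\<close>, the first time at which the whole segment
  lies where the differential equation holds.\<close>

lemma decay: "\<exists>K>0. \<exists>c>0. \<forall>x :: real \<Rightarrow> real^'n. continuous_on {-\<tau>..} x \<and>
    (\<forall>t\<ge>0. (x has_vector_derivative (A0 *v x t + A1 *v x (t - \<tau>))) (at t within {0..})) \<longrightarrow>
    (\<forall>t\<ge>\<tau>. ip \<tau> (\<lambda>s. x (t + s)) (\<lambda>s. x (t + s)) \<le> K * exp (- c * (t - \<tau>)) * ip \<tau> (\<lambda>s. x (\<tau> + s)) (\<lambda>s. x (\<tau> + s)))"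
proof -
  obtain C where C: "C > 0" "\<And>\<phi>. continuous_on I \<phi> \<Longrightarrow> ip \<tau> (P \<phi>) (P \<phi>) \<le> C * ip \<tau> \<phi> \<phi>"
    using P_bounded by blast
  define c where "c = 2 * \<epsilon> / (C + 1)"
  have c0: "c > 0" using C eps by (simp add: c_def)
  have main: "ip \<tau> (\<lambda>s. x (T + s)) (\<lambda>s. x (T + s)) \<le> (C / \<epsilon>\<^sup>2) * exp (- c * (T - \<tau>)) * ip \<tau> (\<lambda>s. x (\<tau> + s)) (\<lambda>s. x (\<tau> + s))"
    if cx: "continuous_on {-\<tau>..} x" and d: "\<forall>t\<ge>0. (x has_vector_derivative (A0 *v x t + A1 *v x (t - \<tau>))) (at t within {0..})"
      and T: "T \<ge> \<tau>" for T and x :: "real \<Rightarrow> real^'n"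
  proof -
    define X where "X t = A0 *v x t + A1 *v x (t - \<tau>)" for t
    have d': "(x has_vector_derivative X t) (at t within {0..})" if "t \<ge> 0" for t using d that by (simp add: X_def)
    have cX: "continuous_on {0..} X" unfolding X_def
      by (intro continuous_on_add continuous_on_matrix_vector_mult continuous_on_const continuous_on_compose2[OF cx])
        (use tau in \<open>auto intro!: continuous_intros\<close>)
    have cy: "continuous_on I (\<lambda>s. x (t + s))" if "t \<ge> \<tau>" for t
      by (rule continuous_on_compose2[OF cx]) (use that tau in \<open>auto intro!: continuous_intros\<close>)
    have cY: "continuous_on I (\<lambda>s. X (t + s))" if "t \<ge> \<tau>" for t
      by (rule continuous_on_compose2[OF cX]) (use that in \<open>auto intro!: continuous_intros\<close>)
    define Z where "Z t = (SOME z. continuous_on I z \<and> (\<forall>s\<in>I. P z s = x (t + s)))" for t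
    have Z: "continuous_on I (Z t) \<and> (\<forall>s\<in>I. P (Z t) s = x (t + s))" if "t \<ge> \<tau>" for t
      using P_surj[OF cy[OF that]] unfolding Z_def by (rule someI_ex)
    then have Z1: "continuous_on I (Z t)" and Z2: "s \<in> I \<Longrightarrow> P (Z t) s = x (t + s)" if "t \<ge> \<tau>" for t s
      using that by blast+
    define V where "V t = ip \<tau> (\<lambda>s. x (t + s)) (Z t)" for t
    have PZ: "ip \<tau> (P (Z t)) (P (Z t)) = ip \<tau> (\<lambda>s. x (t + s)) (\<lambda>s. x (t + s))" if "t \<ge> \<tau>" for t
      by (rule ip_cong[OF tau]) (simp_all add: Z2[OF that])
    have V_le: "V t \<le> ((C + 1) / 2) * ip \<tau> (Z t) (Z t)" if "t \<ge> \<tau>" for t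
      using ip_young[OF tau cy[OF that] Z1[OF that], of 1] C(2)[OF Z1[OF that]] unfolding PZ[OF that] V_def
      by (simp add: distrib_right)
    have V': "2 * ip \<tau> (\<lambda>s. X (t + s)) (Z t) \<le> (- c) * V t" if t: "t \<ge> \<tau>" for t
    proof -
      have "2 * ip \<tau> (\<lambda>s. X (t + s)) (Z t) \<le> - \<epsilon> * ip \<tau> (Z t) (Z t)"
      proof (rule dissipative[OF Z1[OF t] Z2[OF t] _ cY[OF t]])
        fix s assume s: "s \<in> I"
        have "((\<lambda>s. t + s) has_vector_derivative 1) (at s within I)"
          by (auto intro!: derivative_eq_intros)
        moreover have "(x has_vector_derivative X (t + s)) (at (t + s) within (\<lambda>s. t + s) ` I)"
          by (rule has_vector_derivative_within_subset[OF d']) (use s t in auto)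
        ultimately have "(x \<circ> (\<lambda>s. t + s) has_vector_derivative 1 *\<^sub>R X (t + s)) (at s within I)"
          by (rule vector_diff_chain_within)
        then show "((\<lambda>s. x (t + s)) has_vector_derivative X (t + s)) (at s within I)" by (simp add: o_def)
      qed (simp_all add: X_def)
      moreover have "c * V t \<le> c * (((C + 1) / 2) * ip \<tau> (Z t) (Z t))"
        using V_le[OF t] c0 by (intro mult_left_mono) auto
      moreover have "c * (((C + 1) / 2) * ip \<tau> (Z t) (Z t)) = \<epsilon> * ip \<tau> (Z t) (Z t)"
        using C(1) unfolding c_def by (simp add: field_simps)
      ultimately show ?thesis by linarith
    qed
    have VT: "V T \<le> exp ((- c) * (T - \<tau>)) * V \<tau>"
    proof (rule exp_bound[OF T])
      fix t assume "t \<in> {\<tau>..T}"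
      then have t: "t \<ge> \<tau>" by simp
      show "(V has_real_derivative 2 * ip \<tau> (\<lambda>s. X (t + s)) (Z t)) (at t within {\<tau>..T})"
        unfolding V_def by (rule DERIV_subset[OF lyapunov_deriv[OF d' cX Z1 Z2 t]]) auto
      show "2 * ip \<tau> (\<lambda>s. X (t + s)) (Z t) \<le> (- c) * V t" by (rule V'[OF t])
    qed
    have "ip \<tau> (\<lambda>s. x (T + s)) (\<lambda>s. x (T + s)) \<le> C * ip \<tau> (Z T) (Z T)"
      using C(2)[OF Z1[OF T]] unfolding PZ[OF T] .
    also have "\<dots> \<le> C * (V T / \<epsilon>)"
      using preimage_bounds(1)[OF Z1[OF T] cy[OF T] Z2[OF T]] C(1) eps unfolding V_def
      by (intro mult_left_mono) (auto simp: field_simps)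
    also have "\<dots> \<le> C * ((exp ((- c) * (T - \<tau>)) * (ip \<tau> (\<lambda>s. x (\<tau> + s)) (\<lambda>s. x (\<tau> + s)) / \<epsilon>)) / \<epsilon>)"
    proof -
      have "V \<tau> \<le> ip \<tau> (\<lambda>s. x (\<tau> + s)) (\<lambda>s. x (\<tau> + s)) / \<epsilon>"
        unfolding V_def by (rule preimage_bounds(2)[OF Z1 cy Z2]) auto
      then have "exp ((- c) * (T - \<tau>)) * V \<tau> \<le> exp ((- c) * (T - \<tau>)) * (ip \<tau> (\<lambda>s. x (\<tau> + s)) (\<lambda>s. x (\<tau> + s)) / \<epsilon>)"
        by (intro mult_left_mono) auto
      then show ?thesis using VT C(1) eps by (intro mult_left_mono divide_right_mono) auto
    qed
    also have "\<dots> = (C / \<epsilon>\<^sup>2) * exp (- c * (T - \<tau>)) * ip \<tau> (\<lambda>s. x (\<tau> + s)) (\<lambda>s. x (\<tau> + s))"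
      by (simp add: power2_eq_square)
    finally show ?thesis .
  qed
  show ?thesis
    by (rule exI[of _ "C / \<epsilon>\<^sup>2"], rule conjI, use C(1) eps in simp, rule exI[of _ c], rule conjI, rule c0)
      (intro allI impI, elim conjE, rule main)
qed


section \<open>From decay of segments to exponential decay of the pointwise norm\<close>

lemma stable: "exponentially_stable \<tau> A0 A1"
proof -
  obtain K c where K: "K > 0" and c: "c > 0" and KC: "\<forall>x :: real \<Rightarrow> real^'n. continuous_on {-\<tau>..} x \<and>
    (\<forall>t\<ge>0. (x has_vector_derivative (A0 *v x t + A1 *v x (t - \<tau>))) (at t within {0..})) \<longrightarrow>
    (\<forall>t\<ge>\<tau>. ip \<tau> (\<lambda>s. x (t + s)) (\<lambda>s. x (t + s)) \<le> K * exp (- c * (t - \<tau>)) * ip \<tau> (\<lambda>s. x (\<tau> + s)) (\<lambda>s. x (\<tau> + s)))"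
    using decay by blast
  \<comment> \<open>Growth rate for Gronwall on \<open>{0..\<tau>}\<close>: twice the norm of
    \<open>A0\<close> from differentiating a square, once the norm of \<open>A1\<close> after the
    mixed term has been split into squares.\<close>
  define g where "g = 2 * onorm ((*v) A0) + onorm ((*v) A1)"
  have on: "norm (A0 *v v) \<le> onorm ((*v) A0) * norm v" "norm (A1 *v v) \<le> onorm ((*v) A1) * norm v"
    "0 \<le> onorm ((*v) A0)" "0 \<le> onorm ((*v) A1)" for v
    by (intro onorm onorm_pos_le matrix_vector_mul_bounded_linear)+
  \<comment> \<open>The factor 2 bounds the initial value of \<open>w\<close> below, a sum of two
    terms each at most the squared supremum of the initial function.\<close>
  define L where "L = 2 * exp (g * \<tau>)"
  have L: "L > 0" by (simp add: L_def)
  \<comment> \<open>One summand for the times after \<open>\<tau>\<close> and one for those before;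
    \<open>exp (c * \<tau>)\<close> compensates for the decay starting only at
    \<open>\<tau>\<close>. The square roots appear because the estimates are for squares, which also
    halves the rate to \<open>c / 2\<close>.\<close>
  define M where "M = sqrt (2 * K * exp (c * \<tau>) * L) + sqrt (exp (c * \<tau>) * L)"
  have M: "M > 0" unfolding M_def using K L by (intro add_pos_pos) auto
  have main: "norm (x t) \<le> M * exp (- (c / 2) * t) * (SUP s\<in>I. norm (\<phi>0 s))"
    if \<phi>0: "continuous_on I \<phi>0" and x: "dde_solution \<tau> A0 A1 \<phi>0 x" and t: "t \<ge> 0" for \<phi>0 x t
  proof -
    define \<Phi> where "\<Phi> = (SUP s\<in>I. norm (\<phi>0 s))"
    have bdd: "bdd_above ((\<lambda>s. norm (\<phi>0 s)) ` I)"
      by (intro bounded_imp_bdd_above compact_imp_bounded compact_continuous_image continuous_on_norm \<phi>0) simp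
    have \<Phi>: "norm (x s) \<le> \<Phi>" if "s \<in> I" for s
    proof -
      have "norm (\<phi>0 s) \<le> \<Phi>" unfolding \<Phi>_def by (rule cSUP_upper[OF that bdd])
      then show ?thesis using x that unfolding dde_solution_def by simp
    qed
    have \<Phi>0: "\<Phi> \<ge> 0" using \<Phi>[OF zero_in] norm_ge_zero[of "x 0"] by linarith
    have d: "(x has_vector_derivative (A0 *v x t + A1 *v x (t - \<tau>))) (at t within {0..})" if "t \<ge> 0" for t
      using x that unfolding dde_solution_def by blast
    have "continuous_on {0..} x"
      using continuous_on_vector_derivative[of "{0..}" x "\<lambda>t. A0 *v x t + A1 *v x (t - \<tau>)"] d by simp
    moreover have "continuous_on I x"
      using \<phi>0 by (rule continuous_on_eq) (use x in \<open>simp add: dde_solution_def\<close>)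
    ultimately have "continuous_on (I \<union> {0..}) x"
      by (intro continuous_on_closed_Un) auto
    moreover have "I \<union> {0..} = {-\<tau>..}" using tau by auto
    ultimately have cx: "continuous_on {-\<tau>..} x" by simp
    have init: "(norm (x r))\<^sup>2 \<le> L * \<Phi>\<^sup>2" if r: "r \<in> {0..\<tau>}" for r
    proof -
      \<comment> \<open>The added constant dominates the delayed term: for \<open>s\<close> up to
        \<open>\<tau>\<close> the argument \<open>s - \<tau>\<close> still lies in the initial
        interval.\<close>
      define w where "w r = x r \<bullet> x r + \<Phi>\<^sup>2" for r
      have "w r \<le> exp (g * (r - 0)) * w 0"
      proof (rule exp_bound)
        fix s assume s: "s \<in> {0..r}"
        let ?D = "A0 *v x s + A1 *v x (s - \<tau>)"
        have dx: "(x has_vector_derivative ?D) (at s within {0..r})"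
          by (rule has_vector_derivative_within_subset[OF d]) (use s in auto)
        have "((\<lambda>r. x r \<bullet> x r) has_vector_derivative (x s \<bullet> ?D + ?D \<bullet> x s)) (at s within {0..r})"
          by (rule bounded_bilinear.has_vector_derivative[OF bounded_bilinear_inner dx dx])
        then have "((\<lambda>r. x r \<bullet> x r) has_real_derivative (2 * (x s \<bullet> ?D))) (at s within {0..r})"
          unfolding has_real_derivative_iff_has_vector_derivative by (simp add: inner_commute)
        from DERIV_add[OF this DERIV_const[of "\<Phi>\<^sup>2"]]
        show "(w has_real_derivative (2 * (x s \<bullet> ?D))) (at s within {0..r})" unfolding w_def by simp
        have n1: "x s \<bullet> (A0 *v x s) \<le> onorm ((*v) A0) * (norm (x s))\<^sup>2"
        proof -
          have "x s \<bullet> (A0 *v x s) \<le> norm (x s) * norm (A0 *v x s)" by (rule norm_cauchy_schwarz)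
          also have "\<dots> \<le> norm (x s) * (onorm ((*v) A0) * norm (x s))" using on by (intro mult_left_mono) auto
          finally show ?thesis by (simp add: power2_eq_square mult_ac)
        qed
        have n2: "2 * (x s \<bullet> (A1 *v x (s - \<tau>))) \<le> onorm ((*v) A1) * ((norm (x s))\<^sup>2 + \<Phi>\<^sup>2)"
        proof -
          have "s - \<tau> \<in> I" using s r by auto
          then have p: "norm (x (s - \<tau>)) \<le> \<Phi>" by (rule \<Phi>)
          have "x s \<bullet> (A1 *v x (s - \<tau>)) \<le> norm (x s) * norm (A1 *v x (s - \<tau>))" by (rule norm_cauchy_schwarz)
          also have "\<dots> \<le> norm (x s) * (onorm ((*v) A1) * \<Phi>)"
            using on(2)[of "x (s - \<tau>)"] mult_left_mono[OF p on(4)] by (intro mult_left_mono) auto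
          finally have "2 * (x s \<bullet> (A1 *v x (s - \<tau>))) \<le> onorm ((*v) A1) * (2 * norm (x s) * \<Phi>)" by (simp add: mult_ac)
          also have "\<dots> \<le> onorm ((*v) A1) * ((norm (x s))\<^sup>2 + \<Phi>\<^sup>2)"
            using sum_squares_bound[of "norm (x s)" \<Phi>] on(4) by (intro mult_left_mono) auto
          finally show ?thesis .
        qed
        have "2 * (x s \<bullet> ?D) \<le> 2 * (onorm ((*v) A0) * (norm (x s))\<^sup>2) + onorm ((*v) A1) * ((norm (x s))\<^sup>2 + \<Phi>\<^sup>2)"
          using n1 n2 by (simp add: inner_add_right)
        also have "\<dots> \<le> g * ((norm (x s))\<^sup>2 + \<Phi>\<^sup>2)"
          using mult_nonneg_nonneg[OF on(3) zero_le_power2[of \<Phi>]] unfolding g_def by (simp add: algebra_simps)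
        finally show "2 * (x s \<bullet> ?D) \<le> g * w s" by (simp add: w_def dot_square_norm)
      qed (use r in auto)
      also have "\<dots> \<le> exp (g * \<tau>) * (2 * \<Phi>\<^sup>2)"
      proof (intro mult_mono)
        have "g \<ge> 0" using on(3,4) by (simp add: g_def)
        then show "exp (g * (r - 0)) \<le> exp (g * \<tau>)" using r by (simp add: mult_left_mono)
        show "w 0 \<le> 2 * \<Phi>\<^sup>2" using power_mono[OF \<Phi>[OF zero_in], of 2] by (simp add: w_def dot_square_norm)
      qed (auto simp: w_def)
      also have "\<dots> = L * \<Phi>\<^sup>2" by (simp add: L_def)
      finally have "w r \<le> L * \<Phi>\<^sup>2" .
      then show ?thesis using zero_le_power2[of \<Phi>] unfolding w_def dot_square_norm by linarith
    qed
    have sq: "norm (x t) \<le> sqrt B * exp (- (c / 2) * t) * \<Phi>" if B: "B \<ge> 0" and le: "(norm (x t))\<^sup>2 \<le> B * exp (- c * t) * \<Phi>\<^sup>2" for B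
    proof -
      have eq: "(sqrt B * exp (- (c / 2) * t) * \<Phi>)\<^sup>2 = B * exp (- c * t) * \<Phi>\<^sup>2"
        using B by (simp add: power_mult_distrib exp_double[symmetric])
      show ?thesis
      proof (rule power2_le_imp_le)
        show "(norm (x t))\<^sup>2 \<le> (sqrt B * exp (- (c / 2) * t) * \<Phi>)\<^sup>2" unfolding eq by (rule le)
        show "0 \<le> sqrt B * exp (- (c / 2) * t) * \<Phi>" using B \<Phi>0 by simp
      qed
    qed
    have le1: "sqrt (exp (c * \<tau>) * L) * exp (- (c / 2) * t) * \<Phi> \<le> M * exp (- (c / 2) * t) * \<Phi>"
      using K L \<Phi>0 unfolding M_def by (intro mult_right_mono) auto
    have le2: "sqrt (2 * K * exp (c * \<tau>) * L) * exp (- (c / 2) * t) * \<Phi> \<le> M * exp (- (c / 2) * t) * \<Phi>"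
      using K L \<Phi>0 unfolding M_def by (intro mult_right_mono) auto
    have "norm (x t) \<le> M * exp (- (c / 2) * t) * \<Phi>"
    proof (cases "t \<le> \<tau>")
      case True
      have "(norm (x t))\<^sup>2 \<le> L * \<Phi>\<^sup>2" using init t True by simp
      also have "\<dots> \<le> exp (c * \<tau>) * exp (- c * t) * (L * \<Phi>\<^sup>2)"
      proof -
        have "1 \<le> exp (c * (\<tau> - t))" using True c by simp
        also have "\<dots> = exp (c * \<tau>) * exp (- c * t)" by (simp add: exp_add[symmetric] algebra_simps)
        finally show ?thesis using L by (intro mult_right_mono[of 1 _ "L * \<Phi>\<^sup>2", simplified]) auto
      qed
      finally have "(norm (x t))\<^sup>2 \<le> exp (c * \<tau>) * L * exp (- c * t) * \<Phi>\<^sup>2" by (simp add: mult_ac)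
      then show ?thesis by (intro order_trans[OF sq le1]) (use L in auto)
    next
      case False
      then have t\<tau>: "t \<ge> \<tau>" by simp
      have cy: "continuous_on I (\<lambda>s. x (r + s))" if "r \<ge> \<tau>" for r
        by (rule continuous_on_compose2[OF cx]) (use that tau in \<open>auto intro!: continuous_intros\<close>)
      have init': "norm (x (\<tau> + s)) \<le> sqrt (L * \<Phi>\<^sup>2)" if "s \<in> I" for s
        using init[of "\<tau> + s"] that by (intro real_le_rsqrt) auto
      \<comment> \<open>The point value in \<open>ip\<close> is what turns the estimate for segments
        into a pointwise bound.\<close>
      have "\<tau> * (norm (x t))\<^sup>2 \<le> ip \<tau> (\<lambda>s. x (t + s)) (\<lambda>s. x (t + s))"
        unfolding ip_def using integral_nonneg[OF ip_integrable[OF cy[OF t\<tau>] cy[OF t\<tau>]]] by (simp add: dot_square_norm)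
      also have "\<dots> \<le> K * exp (- c * (t - \<tau>)) * ip \<tau> (\<lambda>s. x (\<tau> + s)) (\<lambda>s. x (\<tau> + s))"
        using KC cx d t\<tau> by blast
      also have "\<dots> \<le> K * exp (- c * (t - \<tau>)) * (2 * \<tau> * (sqrt (L * \<Phi>\<^sup>2))\<^sup>2)"
        using K by (intro mult_left_mono ip_le_sup[OF tau cy] init') auto
      also have "\<dots> = \<tau> * (2 * K * exp (c * \<tau>) * L * exp (- c * t) * \<Phi>\<^sup>2)"
      proof -
        have "exp (- c * (t - \<tau>)) = exp (c * \<tau>) * exp (- c * t)" by (simp add: exp_add[symmetric] algebra_simps)
        then show ?thesis using L by (simp add: mult_ac)
      qed
      finally have "(norm (x t))\<^sup>2 \<le> 2 * K * exp (c * \<tau>) * L * exp (- c * t) * \<Phi>\<^sup>2" using tau by simp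
      then show ?thesis by (intro order_trans[OF sq le2]) (use K L in auto)
    qed
    then show ?thesis unfolding \<Phi>_def .
  qed
  show ?thesis unfolding exponentially_stable_def
    by (rule exI[of _ M], rule conjI, rule M, rule exI[of _ "c / 2"], rule conjI, use c in simp)
      (intro allI impI, elim conjE, rule main)
qed

end

section \<open>Weak and classical derivatives\<close>

lemma set_integrable_continuous_compact:
  fixes f :: "'a::euclidean_space \<Rightarrow> 'b::euclidean_space"
  assumes "compact A" "continuous_on A f"
  shows "set_integrable lborel A f"
  unfolding set_integrable_def by (rule borel_integrable_compact[OF assms])

text \<open>Constants are integrable on a compact set, and \<open>norm (f x)\<close> is at most 1
  plus its square.\<close>

lemma L2_on_imp_set_integrable:
  fixes f :: "'a::euclidean_space \<Rightarrow> 'b::euclidean_space"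
  assumes L: "L2_on A f" and A: "compact A"
  shows "set_integrable lborel A f"
proof -
  have 1: "set_integrable lborel A (\<lambda>x. (norm (f x))\<^sup>2)" and m: "set_borel_measurable lborel A f"
    using L unfolding L2_on_def by auto
  have 2: "set_integrable lborel A (\<lambda>x. 1::real)"
    by (rule set_integrable_continuous_compact[OF A]) simp
  have 3: "set_integrable lborel A (\<lambda>x. 1 + (norm (f x))\<^sup>2)"
    by (rule set_integral_add(1)[OF 2 1])
  show ?thesis
    unfolding set_integrable_def
  proof (rule Bochner_Integration.integrable_bound)
    show "integrable lborel (\<lambda>x. indicator A x *\<^sub>R (1 + (norm (f x))\<^sup>2))"
      using 3 unfolding set_integrable_def .
    show "(\<lambda>x. indicator A x *\<^sub>R f x) \<in> borel_measurable lborel"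
      using m unfolding set_borel_measurable_def .
    show "AE x in lborel. norm (indicator A x *\<^sub>R f x) \<le> norm (indicator A x *\<^sub>R (1 + (norm (f x))\<^sup>2))"
    proof (rule AE_I2)
      fix x
      have "2 * norm (f x) \<le> 1 + (norm (f x))\<^sup>2" using zero_le_power2[of "norm (f x) - 1"] by (simp add: power2_diff)
      then have "norm (f x) \<le> 1 + (norm (f x))\<^sup>2" using norm_ge_zero[of "f x"] by linarith
      then show "norm (indicator A x *\<^sub>R f x) \<le> norm (indicator A x *\<^sub>R (1 + (norm (f x))\<^sup>2))"
        by (simp add: indicator_def)
    qed
  qed
qed

section \<open>Functions determined by their integrals over boxes\<close>

lemma AE_lborel_notin_negligible:
  assumes "negligible N" shows "AE x in lborel. x \<notin> N"
proof -
  have "N \<in> null_sets lebesgue" using assms by (simp add: negligible_iff_null_sets)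
  then have "AE x in lebesgue. x \<notin> N" by (rule AE_not_in)
  then show ?thesis unfolding AE_completion_iff .
qed

text \<open>Lebesgue differentiation: off a negligible set the value at \<open>x\<close> is the
  limit of averages over cubes with corner \<open>x\<close>. Only closed boxes inside the open box
  are tested, so that bump functions supported there are admissible test functions.\<close>

lemma AE_zero_if_box_integrals_zero:
  fixes h :: "'a::euclidean_space \<Rightarrow> 'b::euclidean_space"
  assumes h: "set_integrable lborel (cbox l u) h"
    and zero: "\<And>a b. cbox a b \<subseteq> box l u \<Longrightarrow> (LINT x:box a b|lborel. h x) = 0"
  shows "AE x in lborel. x \<in> cbox l u \<longrightarrow> h x = 0"
proof -
  define f where "f x = indicator (cbox l u) x *\<^sub>R h x" for x
  have f: "integrable lborel f" using h unfolding set_integrable_def f_def .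
  have "f integrable_on cbox a b" for a b
    using integrable_on_subcbox[OF integrable_on_lborel[OF f]] by simp
  then obtain N where N: "negligible N" and lim: "\<And>x e. x \<notin> N \<Longrightarrow> 0 < e \<Longrightarrow>
      \<exists>d>0. \<forall>h. 0 < h \<and> h < d \<longrightarrow> norm (integral (cbox x (x + h *\<^sub>R One)) f /\<^sub>R h ^ DIM('a) - f x) < e"
    by (rule integrable_ccontinuous_explicit[where f = f]) (rule that)
  have f0: "f x = 0" if x: "x \<in> box l u" "x \<notin> N" for x
  proof (rule ccontr)
    assume "f x \<noteq> 0"
    then obtain d where d: "d > 0" "\<And>h. 0 < h \<and> h < d \<Longrightarrow> norm (integral (cbox x (x + h *\<^sub>R One)) f /\<^sub>R h ^ DIM('a) - f x) < norm (f x)"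
      using lim[OF x(2), of "norm (f x)"] by auto
    obtain e where e: "e > 0" "ball x e \<subseteq> box l u" using open_contains_ball[of "box l u"] x(1) by auto
    \<comment> \<open>A cube of side below \<open>r\<close> has a diagonal shorter than
      \<open>e\<close>, so it stays in the ball; the added 1 keeps the denominator positive.\<close>
    define r where "r = e / (norm (One :: 'a) + 1)"
    define k where "k = min d r / 2"
    have n0: "norm (One :: 'a) + 1 > 0" by (simp add: add_nonneg_pos)
    have "r > 0" using e(1) n0 by (simp add: r_def)
    then have k: "0 < k" "k < d" and "k < r" using d(1) by (auto simp: k_def min_def)
    then have kn: "k * (norm (One :: 'a) + 1) < e" using n0 unfolding r_def by (simp add: pos_less_divide_eq)
    have sub: "cbox x (x + k *\<^sub>R One) \<subseteq> box l u"
    proof -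
      have "y \<in> ball x e" if "y \<in> cbox x (x + k *\<^sub>R One)" for y
      proof -
        have "norm (y - x) \<le> norm (k *\<^sub>R (One :: 'a))"
          by (rule norm_le_componentwise) (use that in \<open>auto simp: mem_box inner_diff_left inner_add_left\<close>)
        also have "\<dots> = k * norm (One :: 'a)" using k by simp
        also have "\<dots> < e" using kn k by (simp add: distrib_left)
        finally show ?thesis by (simp add: dist_norm norm_minus_commute)
      qed
      then show ?thesis using e(2) by blast
    qed
    have "integral (cbox x (x + k *\<^sub>R One)) f = integral (box x (x + k *\<^sub>R One)) f"
      by (rule integral_open_interval[symmetric])
    also have "\<dots> = integral (box x (x + k *\<^sub>R One)) h"
    proof (rule integral_cong)
      fix y assume "y \<in> box x (x + k *\<^sub>R One)"
      then have "y \<in> cbox l u" using sub box_subset_cbox by blast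
      then show "f y = h y" by (simp add: f_def)
    qed
    also have "\<dots> = (LINT x:box x (x + k *\<^sub>R One)|lborel. h x)"
    proof -
      have "box x (x + k *\<^sub>R One) \<subseteq> cbox l u" using sub box_subset_cbox by blast
      then have "set_integrable lborel (box x (x + k *\<^sub>R One)) h"
        by (intro set_integrable_subset[OF h]) auto
      then show ?thesis using set_borel_integral_eq_integral(2) by metis
    qed
    also have "\<dots> = 0" by (rule zero[OF sub])
    finally show False using d(2)[of k] k by simp
  qed
  have "AE x in lborel. x \<notin> N" "AE x in lborel. x \<notin> cbox l u - box l u"
    by (intro AE_lborel_notin_negligible N negligible_frontier_interval)+
  then show ?thesis
  proof eventually_elim
    case (elim x)
    then show ?case using f0[of x] by (auto simp: f_def)
  qed
qed

text \<open>Inside the open box the set where \<open>f\<close> and \<open>g\<close> differ is open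
  and negligible, hence empty; continuity reaches the boundary.\<close>

lemma AE_eq_imp_eq_on_cbox:
  fixes f g :: "'a::euclidean_space \<Rightarrow> 'b::real_normed_vector"
  assumes f: "continuous_on (cbox l u) f" and g: "continuous_on (cbox l u) g" and ne: "box l u \<noteq> {}"
    and ae: "AE x in lborel. x \<in> cbox l u \<longrightarrow> f x = g x"
    and x: "x \<in> cbox l u"
  shows "f x = g x"
proof -
  define U where "U = {x \<in> box l u. f x - g x \<in> - {0}}"
  have cd: "continuous_on (box l u) (\<lambda>x. f x - g x)"
    by (intro continuous_on_diff continuous_on_subset[OF f] continuous_on_subset[OF g] box_subset_cbox)
  have "open U" unfolding U_def
    using continuous_open_preimage[OF cd open_box open_Compl[OF closed_singleton[of 0]]]
    by (simp add: vimage_def Int_def)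
  moreover have "negligible U"
  proof -
    have "AE x in lborel. x \<notin> U" using ae
      by eventually_elim (use box_subset_cbox in \<open>auto simp: U_def\<close>)
    then have "AE x in lebesgue. x \<notin> U" unfolding AE_completion_iff .
    then show ?thesis using \<open>open U\<close>
      by (simp add: negligible_iff_null_sets AE_iff_null_sets)
  qed
  ultimately have "U = {}" using open_not_negligible by blast
  then have z: "f y - g y = 0" if "y \<in> box l u" for y using that unfolding U_def by auto
  have "closure (box l u) = cbox l u" using ne by (rule closure_box)
  then show ?thesis
    using continuous_constant_on_closure[of "box l u" "\<lambda>x. f x - g x" 0 x] z x f g
    by (auto intro: continuous_on_diff)
qed

section \<open>Bump functions and comparison of weak with classical derivatives\<close>

lemma max_square_deriv: "((\<lambda>u::real. (max 0 u)\<^sup>2) has_real_derivative 2 * max 0 u) (at u)"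
proof (cases "u = 0")
  case True
  have "((\<lambda>h::real. max 0 h) \<longlongrightarrow> max 0 0) (at 0)" by (intro tendsto_intros)
  then have l: "((\<lambda>h::real. max 0 h) \<longlongrightarrow> 0) (at 0)" by simp
  have "(max 0 h)\<^sup>2 / h = max 0 h" for h :: real by (simp add: max_def power2_eq_square)
  then show ?thesis using True l unfolding has_field_derivative_iff by simp
next
  case False
  show ?thesis
  proof (cases "u > 0")
    case True
    have "((\<lambda>u::real. u\<^sup>2) has_real_derivative 2 * u) (at u)"
      by (auto intro!: derivative_eq_intros)
    then have "((\<lambda>u::real. (max 0 u)\<^sup>2) has_real_derivative 2 * u) (at u)"
      by (rule has_field_derivative_transform_within_open[of _ _ _ "{0<..}"]) (use True in auto)
    then show ?thesis using True by simp
  next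
    case F: False
    have "((\<lambda>u::real. 0) has_real_derivative 0) (at u)" by simp
    then have "((\<lambda>u::real. (max 0 u)\<^sup>2) has_real_derivative 0) (at u)"
      by (rule has_field_derivative_transform_within_open[of _ _ _ "{..<0}"]) (use False F in auto)
    then show ?thesis using F by simp
  qed
qed

text \<open>\<open>w\<close> is the square of the positive part of a parabola: continuously
  differentiable, positive exactly on the open interval, and at most 1. Then
  \<open>1 - (1 - w s) ^ k\<close> increases to the indicator. Test functions need only one
  continuous derivative, so a square is smooth enough.\<close>

lemma bump_sequence:
  fixes a b :: real
  assumes ab: "a < b"
  shows "\<exists>\<beta> \<beta>' :: nat \<Rightarrow> real \<Rightarrow> real. (\<forall>k s. (\<beta> k has_real_derivative \<beta>' k s) (at s)) \<and> (\<forall>k. continuous_on UNIV (\<beta>' k))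
    \<and> (\<forall>k s. 0 \<le> \<beta> k s \<and> \<beta> k s \<le> 1) \<and> (\<forall>k s. s \<notin> {a..b} \<longrightarrow> \<beta> k s = 0)
    \<and> (\<forall>s. (\<lambda>k. \<beta> k s) \<longlonglongrightarrow> indicator {a<..<b} s)"
proof -
  \<comment> \<open>The parabola is divided by its maximum, attained at the midpoint, so that
    \<open>w\<close> stays at most 1.\<close>
  define u where "u s = (s - a) * (b - s) / ((b - a) / 2)\<^sup>2" for s
  define u' where "u' s = ((b - s) - (s - a)) / ((b - a) / 2)\<^sup>2" for s
  define w where "w s = (max 0 (u s))\<^sup>2" for s
  define w' where "w' s = 2 * max 0 (u s) * u' s" for s
  define \<beta> where "\<beta> k s = 1 - (1 - w s) ^ k" for k :: nat and s
  define \<beta>' where "\<beta>' k s = real k * (1 - w s) ^ (k - 1) * w' s" for k :: nat and s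
  have den: "((b - a) / 2)\<^sup>2 > 0" using ab by simp
  have u: "(u has_real_derivative u' s) (at s)" for s
  proof -
    have "((\<lambda>s. (s - a) * (b - s)) has_real_derivative ((b - s) - (s - a))) (at s)"
      by (auto intro!: derivative_eq_intros)
    from DERIV_cdivide[OF this] show ?thesis unfolding u_def u'_def .
  qed
  have w: "(w has_real_derivative w' s) (at s)" for s
    unfolding w_def w'_def by (rule DERIV_chain2[OF max_square_deriv u])
  have d: "(\<beta> k has_real_derivative \<beta>' k s) (at s)" for k s
    unfolding \<beta>_def \<beta>'_def by (rule derivative_eq_intros w refl)+ simp
  have cu: "continuous_on UNIV u" "continuous_on UNIV u'" unfolding u_def u'_def
    using den by (intro continuous_intros; simp)+
  have cw: "continuous_on UNIV w" "continuous_on UNIV w'" unfolding w_def w'_def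
    by (intro continuous_intros cu)+
  have c: "continuous_on UNIV (\<beta>' k)" for k unfolding \<beta>'_def
    by (intro continuous_intros cw)
  have u1: "u s \<le> 1" for s
  proof -
    have "(s - a) * (b - s) \<le> ((b - a) / 2)\<^sup>2"
      using zero_le_power2[of "s - (a + b) / 2"] by (simp add: power2_eq_square field_simps)
    then show ?thesis unfolding u_def using den by (simp add: divide_le_eq)
  qed
  have w01: "0 \<le> w s" "w s \<le> 1" for s
    unfolding w_def using power_mono[of "max 0 (u s)" 1 2] u1[of s] by auto
  have upos: "u s > 0 \<longleftrightarrow> s \<in> {a<..<b}" for s
    unfolding u_def using ab den by (auto simp: zero_less_divide_iff zero_less_mult_iff)
  have r: "0 \<le> \<beta> k s \<and> \<beta> k s \<le> 1" for k s
    unfolding \<beta>_def using w01[of s] by (auto intro: power_le_one)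
  have z: "w s = 0" if "s \<notin> {a<..<b}" for s
  proof -
    have "max 0 (u s) = 0" using upos[of s] that by (intro max_absorb1) auto
    then show ?thesis by (simp add: w_def)
  qed
  have out: "\<beta> k s = 0" if "s \<notin> {a..b}" for k s
    unfolding \<beta>_def using z[of s] that by auto
  have lim: "(\<lambda>k. \<beta> k s) \<longlonglongrightarrow> indicator {a<..<b} s" for s
  proof (cases "s \<in> {a<..<b}")
    case True
    then have "w s > 0" using upos[of s] by (simp add: w_def)
    then have "norm (1 - w s) < 1" using w01[of s] unfolding real_norm_def by linarith
    then have "(\<lambda>k. (1 - w s) ^ k) \<longlonglongrightarrow> 0" by (rule LIMSEQ_power_zero)
    then have "(\<lambda>k. 1 - (1 - w s) ^ k) \<longlonglongrightarrow> 1 - 0" by (rule tendsto_diff[OF tendsto_const])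
    then show ?thesis using True unfolding \<beta>_def by (simp add: indicator_def)
  next
    case False
    then show ?thesis unfolding \<beta>_def by (simp add: z)
  qed
  show ?thesis by (rule exI[of _ \<beta>], rule exI[of _ \<beta>']) (intro conjI allI impI d c r[THEN conjunct1] r[THEN conjunct2] out lim)
qed

lemma integral_by_parts_bump:
  fixes f p :: "real \<Rightarrow> 'b::euclidean_space"
  assumes lu: "l \<le> u" and \<beta>: "\<And>s. (\<beta> has_real_derivative \<beta>' s) (at s)" and c: "continuous_on UNIV \<beta>'"
    and z: "\<beta> l = 0" "\<beta> u = 0"
    and f: "\<And>s. s \<in> {l..u} \<Longrightarrow> (f has_vector_derivative p s) (at s within {l..u})" and p: "continuous_on {l..u} p"
  shows "integral {l..u} (\<lambda>s. \<beta>' s *\<^sub>R f s) = - integral {l..u} (\<lambda>s. \<beta> s *\<^sub>R p s)"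
proof -
  have cf: "continuous_on {l..u} f" using f continuous_on_vector_derivative by blast
  have cb: "continuous_on {l..u} \<beta>" using \<beta> by (meson DERIV_continuous_on has_field_derivative_at_within)
  have "((\<lambda>s. \<beta> s *\<^sub>R f s) has_vector_derivative (\<beta> s *\<^sub>R p s + \<beta>' s *\<^sub>R f s)) (at s within {l..u})" if "s \<in> {l..u}" for s
    by (rule has_vector_derivative_scaleR[OF has_field_derivative_at_within[OF \<beta>] f[OF that]])
  then have "((\<lambda>s. \<beta> s *\<^sub>R p s + \<beta>' s *\<^sub>R f s) has_integral (\<beta> u *\<^sub>R f u - \<beta> l *\<^sub>R f l)) {l..u}"
    by (rule fundamental_theorem_of_calculus[OF lu])
  then have "integral {l..u} (\<lambda>s. \<beta> s *\<^sub>R p s + \<beta>' s *\<^sub>R f s) = 0" using z by (simp add: integral_unique)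
  moreover have "integral {l..u} (\<lambda>s. \<beta> s *\<^sub>R p s + \<beta>' s *\<^sub>R f s) = integral {l..u} (\<lambda>s. \<beta> s *\<^sub>R p s) + integral {l..u} (\<lambda>s. \<beta>' s *\<^sub>R f s)"
    by (intro integral_add integrable_continuous_real continuous_on_scaleR cb p cf continuous_on_subset[OF c]) auto
  ultimately show ?thesis by (simp add: eq_neg_iff_add_eq_0 add.commute)
qed


lemma set_integrable_scaleR_unit:
  fixes g :: "'a::euclidean_space \<Rightarrow> 'b::euclidean_space"
  assumes g: "set_integrable lborel A g" and m: "\<beta> \<in> borel_measurable borel"
    and r: "\<And>x. 0 \<le> \<beta> x \<and> \<beta> x \<le> (1::real)"
  shows "set_integrable lborel A (\<lambda>x. \<beta> x *\<^sub>R g x)"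
proof -
  have "integrable lborel (\<lambda>x. \<beta> x *\<^sub>R (indicator A x *\<^sub>R g x))"
  proof (rule Bochner_Integration.integrable_bound)
    show gi: "integrable lborel (\<lambda>x. indicator A x *\<^sub>R g x)" using g unfolding set_integrable_def .
    have "\<beta> \<in> borel_measurable lborel" using m by simp
    then show "(\<lambda>x. \<beta> x *\<^sub>R (indicator A x *\<^sub>R g x)) \<in> borel_measurable lborel"
      by (intro borel_measurable_scaleR borel_measurable_integrable[OF gi])
    show "AE x in lborel. norm (\<beta> x *\<^sub>R (indicator A x *\<^sub>R g x)) \<le> norm (indicator A x *\<^sub>R g x)"
    proof (rule AE_I2)
      fix x
      have "\<bar>\<beta> x\<bar> * norm (indicator A x *\<^sub>R g x) \<le> 1 * norm (indicator A x *\<^sub>R g x)"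
        using r[of x] by (intro mult_right_mono) auto
      then show "norm (\<beta> x *\<^sub>R (indicator A x *\<^sub>R g x)) \<le> norm (indicator A x *\<^sub>R g x)"
        by (simp only: norm_scaleR mult_1)
    qed
  qed
  then show ?thesis unfolding set_integrable_def by (simp only: scaleR_left_commute)
qed

text \<open>Dominated convergence with the norm of \<open>h\<close> on \<open>A\<close> as
  dominating function; it passes from bumps to the indicator of a box.\<close>

lemma set_integral_limit_zero:
  fixes h :: "'a::euclidean_space \<Rightarrow> 'b::euclidean_space"
  assumes h: "set_integrable lborel A h" and B: "B \<subseteq> A" "B \<in> sets borel"
    and m: "\<And>k. \<beta> k \<in> borel_measurable borel" and r: "\<And>k x. 0 \<le> \<beta> k x \<and> \<beta> k x \<le> (1::real)"
    and lim: "\<And>x. (\<lambda>k. \<beta> k x) \<longlonglongrightarrow> indicator B x"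
    and zero: "\<And>k::nat. (LINT x:A|lborel. \<beta> k x *\<^sub>R h x) = 0"
  shows "(LINT x:B|lborel. h x) = 0"
proof -
  have hm: "(\<lambda>x. indicator A x *\<^sub>R h x) \<in> borel_measurable lborel" and hi: "integrable lborel (\<lambda>x. indicator A x *\<^sub>R h x)"
    using h unfolding set_integrable_def by auto
  have eq: "indicator A x *\<^sub>R (\<beta> k x *\<^sub>R h x) = \<beta> k x *\<^sub>R (indicator A x *\<^sub>R h x)" for k x by simp
  have eqB: "indicator B x *\<^sub>R h x = indicator B x *\<^sub>R (indicator A x *\<^sub>R h x)" for x
    using B(1) by (auto simp: indicator_def)
  have m': "\<beta> k \<in> borel_measurable lborel" for k using m[of k] by simp
  have "(\<lambda>k. LINT x|lborel. \<beta> k x *\<^sub>R (indicator A x *\<^sub>R h x)) \<longlonglongrightarrow> (LINT x|lborel. indicator B x *\<^sub>R (indicator A x *\<^sub>R h x))"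
  proof (rule integral_dominated_convergence[where w = "\<lambda>x. norm (indicator A x *\<^sub>R h x)"])
    show "(\<lambda>x. indicator B x *\<^sub>R (indicator A x *\<^sub>R h x)) \<in> borel_measurable lborel"
      using B(2) by (intro borel_measurable_scaleR borel_measurable_indicator hm) simp
    show "(\<lambda>x. \<beta> k x *\<^sub>R (indicator A x *\<^sub>R h x)) \<in> borel_measurable lborel" for k
      by (intro borel_measurable_scaleR m' hm)
    show "integrable lborel (\<lambda>x. norm (indicator A x *\<^sub>R h x))" using hi by (rule integrable_norm)
    show "AE x in lborel. (\<lambda>k. \<beta> k x *\<^sub>R (indicator A x *\<^sub>R h x)) \<longlonglongrightarrow> indicator B x *\<^sub>R (indicator A x *\<^sub>R h x)"
      by (intro AE_I2 tendsto_scaleR lim tendsto_const)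
    show "AE x in lborel. norm (\<beta> k x *\<^sub>R (indicator A x *\<^sub>R h x)) \<le> norm (indicator A x *\<^sub>R h x)" for k
    proof (rule AE_I2)
      fix x
      have "\<bar>\<beta> k x\<bar> * norm (indicator A x *\<^sub>R h x) \<le> 1 * norm (indicator A x *\<^sub>R h x)"
        using r[of k x] by (intro mult_right_mono) auto
      then show "norm (\<beta> k x *\<^sub>R (indicator A x *\<^sub>R h x)) \<le> norm (indicator A x *\<^sub>R h x)" by (simp only: norm_scaleR mult_1)
    qed
  qed
  moreover have "(LINT x|lborel. \<beta> k x *\<^sub>R (indicator A x *\<^sub>R h x)) = 0" for k
    using zero[of k] unfolding set_lebesgue_integral_def eq .
  ultimately have "(\<lambda>k. 0) \<longlonglongrightarrow> (LINT x|lborel. indicator B x *\<^sub>R (indicator A x *\<^sub>R h x))"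
    by (simp only:)
  from LIMSEQ_unique[OF this tendsto_const]
  have "(LINT x|lborel. indicator B x *\<^sub>R (indicator A x *\<^sub>R h x)) = 0" .
  then show ?thesis unfolding set_lebesgue_integral_def eqB .
qed

lemma frechet_derivative_real:
  fixes \<beta> :: "real \<Rightarrow> real"
  assumes "(\<beta> has_real_derivative d) (at s)"
  shows "frechet_derivative \<beta> (at s) h = d * h"
  using frechet_derivative_at[OF assms[unfolded has_field_derivative_def]] by simp

text \<open>By integration by parts \<open>p\<close> satisfies the identity that defines the weak
  derivative \<open>g\<close>, so \<open>g - p\<close> integrates to zero against the bumps and, in
  the limit, over subintervals.\<close>

lemma weak_deriv_eq_classical_interval:
  fixes f g p :: "real \<Rightarrow> 'b::euclidean_space"
  assumes tau: "\<tau> > 0" and weak: "weak_partial_deriv_on {-\<tau>..0} 1 f g" and g: "L2_on {-\<tau>..0} g"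
    and f: "\<And>s. s \<in> {-\<tau>..0} \<Longrightarrow> (f has_vector_derivative p s) (at s within {-\<tau>..0})"
    and p: "continuous_on {-\<tau>..0} p"
  shows "AE s in lborel. s \<in> {-\<tau>..0} \<longrightarrow> g s = p s"
proof -
  have gi: "set_integrable lborel {-\<tau>..0} g" by (rule L2_on_imp_set_integrable[OF g compact_Icc])
  have pi: "set_integrable lborel {-\<tau>..0} p" by (rule set_integrable_continuous_compact[OF compact_Icc p])
  have hi: "set_integrable lborel {-\<tau>..0} (\<lambda>s. g s - p s)" by (rule set_integral_diff(1)[OF gi pi])
  have cf: "continuous_on {-\<tau>..0} f" using f continuous_on_vector_derivative by blast
  have "AE s in lborel. s \<in> cbox (-\<tau>) 0 \<longrightarrow> g s - p s = 0"
  proof (rule AE_zero_if_box_integrals_zero)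
    show "set_integrable lborel (cbox (-\<tau>) 0) (\<lambda>s. g s - p s)" using hi by simp
    fix a b :: real assume sub: "cbox a b \<subseteq> box (-\<tau>) 0"
    show "(LINT s:box a b|lborel. g s - p s) = 0"
    proof (cases "a < b")
      case False
      then show ?thesis by (simp add: set_lebesgue_integral_def)
    next
      case True
      then have "a \<in> cbox a b" "b \<in> cbox a b" by auto
      then have "a \<in> box (-\<tau>) 0" "b \<in> box (-\<tau>) 0" using sub by blast+
      then have ab: "-\<tau> < a" "b < 0" by auto
      obtain \<beta> \<beta>' :: "nat \<Rightarrow> real \<Rightarrow> real" where b1: "\<forall>k s. (\<beta> k has_real_derivative \<beta>' k s) (at s)"
        and b2: "\<forall>k. continuous_on UNIV (\<beta>' k)" and b3: "\<forall>k s. 0 \<le> \<beta> k s \<and> \<beta> k s \<le> 1"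
        and b4: "\<forall>k s. s \<notin> {a..b} \<longrightarrow> \<beta> k s = 0" and b5: "\<forall>s. (\<lambda>k. \<beta> k s) \<longlonglongrightarrow> indicator {a<..<b} s"
        using bump_sequence[OF True] by (elim exE conjE) (rule that)
      have cb: "continuous_on A (\<beta> k)" for k A using b1 by (meson DERIV_continuous_on has_field_derivative_at_within)
      have cb': "continuous_on A (\<beta>' k)" for k A using b2 continuous_on_subset by blast
      have fr: "frechet_derivative (\<beta> k) (at s) h = \<beta>' k s * h" for k s h
        using b1 by (intro frechet_derivative_real) blast
      have zero: "(LINT s:{-\<tau>..0}|lborel. \<beta> k s *\<^sub>R (g s - p s)) = 0" for k
      proof -
        have "test_function {-\<tau>..0} (\<beta> k)"
          unfolding test_function_def
        proof (intro conjI allI ballI)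
          show "\<beta> k differentiable at s" for s using b1 real_differentiable_def by blast
          show "continuous_on UNIV (\<lambda>s. frechet_derivative (\<beta> k) (at s) c)" for c
            unfolding fr by (intro continuous_intros cb')
          show "\<exists>C. compact C \<and> C \<subseteq> interior {-\<tau>..0} \<and> (\<forall>s. s \<notin> C \<longrightarrow> \<beta> k s = 0)"
            using ab b4 by (intro exI[of _ "{a..b}"]) auto
        qed
        then have "(LINT s:{-\<tau>..0}|lborel. frechet_derivative (\<beta> k) (at s) 1 *\<^sub>R f s) = - (LINT s:{-\<tau>..0}|lborel. \<beta> k s *\<^sub>R g s)"
          using weak unfolding weak_partial_deriv_on_def by blast
        then have w: "(LINT s:{-\<tau>..0}|lborel. \<beta>' k s *\<^sub>R f s) = - (LINT s:{-\<tau>..0}|lborel. \<beta> k s *\<^sub>R g s)"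
          unfolding fr by simp
        have i1: "set_integrable lborel {-\<tau>..0} (\<lambda>s. \<beta>' k s *\<^sub>R f s)" and i2: "set_integrable lborel {-\<tau>..0} (\<lambda>s. \<beta> k s *\<^sub>R p s)"
          by (intro set_integrable_continuous_compact compact_Icc continuous_on_scaleR cb cb' cf p)+
        have "integral {-\<tau>..0} (\<lambda>s. \<beta>' k s *\<^sub>R f s) = - integral {-\<tau>..0} (\<lambda>s. \<beta> k s *\<^sub>R p s)"
          using b1 b2 b4 ab tau by (intro integral_by_parts_bump f p) auto
        then have "(LINT s:{-\<tau>..0}|lborel. \<beta> k s *\<^sub>R g s) = (LINT s:{-\<tau>..0}|lborel. \<beta> k s *\<^sub>R p s)"
          using w unfolding set_borel_integral_eq_integral(2)[OF i1] set_borel_integral_eq_integral(2)[OF i2] by simp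
        moreover have "set_integrable lborel {-\<tau>..0} (\<lambda>s. \<beta> k s *\<^sub>R g s)"
          by (rule set_integrable_scaleR_unit[OF gi borel_measurable_continuous_onI[OF cb]]) (use b3 in blast)
        ultimately show ?thesis using i2 by (simp add: scaleR_diff_right set_integral_diff(2))
      qed
      have "(LINT s:{a<..<b}|lborel. g s - p s) = 0"
      proof (rule set_integral_limit_zero[OF hi _ _ _ _ _ zero])
        show "{a<..<b} \<subseteq> {-\<tau>..0}" using ab by auto
        show "\<beta> k \<in> borel_measurable borel" for k by (rule borel_measurable_continuous_onI[OF cb])
      qed (use b3 b5 in auto)
      then show ?thesis by simp
    qed
  qed
  then show ?thesis by simp
qed

text \<open>As on the interval, with products of bumps in the two variables, which tend to
  indicators of rectangles. The direction \<open>e\<close> and the integration by parts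
  \<open>parts\<close> are left open so that one proof covers both partial derivatives.\<close>

lemma weak_deriv_eq_classical_square:
  fixes \<tau> :: real and f g p :: "real \<times> real \<Rightarrow> 'b::euclidean_space"
  defines "Q \<equiv> {-\<tau>..0} \<times> {-\<tau>..0}"
  assumes weak: "weak_partial_deriv_on Q e f g" and g: "L2_on Q g"
    and p: "continuous_on Q p"
    and parts: "\<And>\<beta> \<beta>' \<gamma> \<gamma>'. (\<And>s. (\<beta> has_real_derivative \<beta>' s) (at s)) \<Longrightarrow> continuous_on UNIV \<beta>' \<Longrightarrow> \<beta> (-\<tau>) = 0 \<Longrightarrow> \<beta> 0 = 0 \<Longrightarrow>
       (\<And>s. (\<gamma> has_real_derivative \<gamma>' s) (at s)) \<Longrightarrow> continuous_on UNIV \<gamma>' \<Longrightarrow> \<gamma> (-\<tau>) = 0 \<Longrightarrow> \<gamma> 0 = 0 \<Longrightarrow>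
       (LINT z:Q|lborel. (\<beta>' (fst z) * fst e * \<gamma> (snd z) + \<beta> (fst z) * (\<gamma>' (snd z) * snd e)) *\<^sub>R f z)
         = - (LINT z:Q|lborel. (\<beta> (fst z) * \<gamma> (snd z)) *\<^sub>R p z)"
  shows "AE z in lborel. z \<in> Q \<longrightarrow> g z = p z"
proof -
  have Qc: "Q = cbox (-\<tau>, -\<tau>) (0, 0)" unfolding Q_def by (simp add: cbox_Pair_eq)
  have cQ: "compact Q" unfolding Qc by (rule compact_cbox)
  have gi: "set_integrable lborel Q g" by (rule L2_on_imp_set_integrable[OF g cQ])
  have pi: "set_integrable lborel Q p" by (rule set_integrable_continuous_compact[OF cQ p])
  have hi: "set_integrable lborel Q (\<lambda>z. g z - p z)" by (rule set_integral_diff(1)[OF gi pi])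
  have "AE z in lborel. z \<in> cbox (-\<tau>, -\<tau>) (0, 0) \<longrightarrow> g z - p z = 0"
  proof (rule AE_zero_if_box_integrals_zero)
    show "set_integrable lborel (cbox (-\<tau>, -\<tau>) (0, 0)) (\<lambda>z. g z - p z)" using hi unfolding Qc .
    fix l u :: "real \<times> real" assume sub: "cbox l u \<subseteq> box (-\<tau>, -\<tau>) (0, 0)"
    obtain a c where l: "l = (a, c)" by (cases l)
    obtain b d where u: "u = (b, d)" by (cases u)
    have boxP: "box (x1, y1) (x2, y2) = {x1<..<x2} \<times> {y1<..<y2}" for x1 y1 x2 y2 :: real
      by (auto simp: mem_box Basis_prod_def)
    show "(LINT z:box l u|lborel. g z - p z) = 0"
    proof (cases "a < b \<and> c < d")
      case False
      then have "box l u = {}" unfolding l u boxP by auto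
      then show ?thesis by (simp add: set_lebesgue_integral_def)
    next
      case True
      then have ab: "a < b" and cd: "c < d" by auto
      have "l \<in> cbox l u" "u \<in> cbox l u" unfolding l u cbox_Pair_eq using ab cd by auto
      then have "l \<in> box (-\<tau>, -\<tau>) (0, 0)" "u \<in> box (-\<tau>, -\<tau>) (0, 0)" using sub by blast+
      then have in1: "-\<tau> < a" "b < 0" and in2: "-\<tau> < c" "d < 0" unfolding l u boxP by auto
      obtain \<beta> \<beta>' :: "nat \<Rightarrow> real \<Rightarrow> real" where b1: "\<forall>k s. (\<beta> k has_real_derivative \<beta>' k s) (at s)"
        and b2: "\<forall>k. continuous_on UNIV (\<beta>' k)" and b3: "\<forall>k s. 0 \<le> \<beta> k s \<and> \<beta> k s \<le> 1"
        and b4: "\<forall>k s. s \<notin> {a..b} \<longrightarrow> \<beta> k s = 0" and b5: "\<forall>s. (\<lambda>k. \<beta> k s) \<longlonglongrightarrow> indicator {a<..<b} s"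
        using bump_sequence[OF ab] by (elim exE conjE) (rule that)
      obtain \<gamma> \<gamma>' :: "nat \<Rightarrow> real \<Rightarrow> real" where c1: "\<forall>k s. (\<gamma> k has_real_derivative \<gamma>' k s) (at s)"
        and c2: "\<forall>k. continuous_on UNIV (\<gamma>' k)" and c3: "\<forall>k s. 0 \<le> \<gamma> k s \<and> \<gamma> k s \<le> 1"
        and c4: "\<forall>k s. s \<notin> {c..d} \<longrightarrow> \<gamma> k s = 0" and c5: "\<forall>s. (\<lambda>k. \<gamma> k s) \<longlonglongrightarrow> indicator {c<..<d} s"
        using bump_sequence[OF cd] by (elim exE conjE) (rule that)
      have cb: "continuous_on A (\<beta> k)" "continuous_on A (\<gamma> k)" for k A
        using b1 c1 by (meson DERIV_continuous_on has_field_derivative_at_within)+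
      have cb': "continuous_on A (\<beta>' k)" "continuous_on A (\<gamma>' k)" for k A using b2 c2 continuous_on_subset by blast+
      define \<phi> where "\<phi> k z = \<beta> k (fst z) * \<gamma> k (snd z)" for k and z :: "real \<times> real"
      have c\<phi>: "continuous_on A (\<phi> k)" for k A unfolding \<phi>_def
        by (intro continuous_on_mult continuous_on_compose2[OF cb(1)] continuous_on_compose2[OF cb(2)] continuous_on_fst continuous_on_snd continuous_on_id) auto
      have d\<phi>: "(\<phi> k has_derivative (\<lambda>h. \<beta>' k (fst z) * fst h * \<gamma> k (snd z) + \<beta> k (fst z) * (\<gamma>' k (snd z) * snd h))) (at z)" for k z
      proof -
        have "(\<beta> k has_derivative (*) (\<beta>' k (fst z))) (at (fst z))" "(\<gamma> k has_derivative (*) (\<gamma>' k (snd z))) (at (snd z))"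
          using b1 c1 unfolding has_field_derivative_def by blast+
        then have "((\<lambda>z. \<beta> k (fst z)) has_derivative (\<lambda>h. \<beta>' k (fst z) * fst h)) (at z)"
          "((\<lambda>z. \<gamma> k (snd z)) has_derivative (\<lambda>h. \<gamma>' k (snd z) * snd h)) (at z)"
          using has_derivative_compose[OF bounded_linear_imp_has_derivative[OF bounded_linear_fst], of "\<beta> k" _ z UNIV]
            has_derivative_compose[OF bounded_linear_imp_has_derivative[OF bounded_linear_snd], of "\<gamma> k" _ z UNIV]
          by auto
        from has_derivative_mult[OF this] show ?thesis unfolding \<phi>_def by (simp add: add.commute)
      qed
      have fr: "frechet_derivative (\<phi> k) (at z) h = \<beta>' k (fst z) * fst h * \<gamma> k (snd z) + \<beta> k (fst z) * (\<gamma>' k (snd z) * snd h)" for k z h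
        using frechet_derivative_at[OF d\<phi>] by metis
      have r\<phi>: "0 \<le> \<phi> k z \<and> \<phi> k z \<le> 1" for k z
        unfolding \<phi>_def using b3 c3 by (auto intro!: mult_nonneg_nonneg mult_le_one)
      have zero: "(LINT z:Q|lborel. \<phi> k z *\<^sub>R (g z - p z)) = 0" for k
      proof -
        have "test_function Q (\<phi> k)"
          unfolding test_function_def
        proof (intro conjI allI ballI)
          show "\<phi> k differentiable at z" for z using d\<phi> differentiableI by blast
          show "continuous_on UNIV (\<lambda>z. frechet_derivative (\<phi> k) (at z) h)" for h
            unfolding fr
            by (intro continuous_on_add continuous_on_mult continuous_on_const continuous_on_compose2[OF cb(1)] continuous_on_compose2[OF cb(2)]
                continuous_on_compose2[OF cb'(1)] continuous_on_compose2[OF cb'(2)] continuous_on_fst continuous_on_snd continuous_on_id) auto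
          show "\<exists>C. compact C \<and> C \<subseteq> interior Q \<and> (\<forall>z. z \<notin> C \<longrightarrow> \<phi> k z = 0)"
          proof (intro exI[of _ "{a..b} \<times> {c..d}"] conjI allI impI)
            show "compact ({a..b} \<times> {c..d})" by (intro compact_Times compact_Icc)
            show "{a..b} \<times> {c..d} \<subseteq> interior Q" unfolding Q_def interior_Times using in1 in2 by auto
            show "\<phi> k z = 0" if "z \<notin> {a..b} \<times> {c..d}" for z
            proof -
              have "fst z \<notin> {a..b} \<or> snd z \<notin> {c..d}" using that by (simp add: mem_Times_iff)
              then show ?thesis using b4 c4 unfolding \<phi>_def by auto
            qed
          qed
        qed
        then have w: "(LINT z:Q|lborel. frechet_derivative (\<phi> k) (at z) e *\<^sub>R f z) = - (LINT z:Q|lborel. \<phi> k z *\<^sub>R g z)"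
          using weak unfolding weak_partial_deriv_on_def by blast
        have "(LINT z:Q|lborel. frechet_derivative (\<phi> k) (at z) e *\<^sub>R f z) = - (LINT z:Q|lborel. \<phi> k z *\<^sub>R p z)"
          unfolding fr \<phi>_def by (rule parts) (use b1 b2 b4 c1 c2 c4 in1 in2 in auto)
        then have "(LINT z:Q|lborel. \<phi> k z *\<^sub>R g z) = (LINT z:Q|lborel. \<phi> k z *\<^sub>R p z)" using w by simp
        moreover have "set_integrable lborel Q (\<lambda>z. \<phi> k z *\<^sub>R p z)"
          by (intro set_integrable_continuous_compact cQ continuous_on_scaleR c\<phi> p)
        moreover have "set_integrable lborel Q (\<lambda>z. \<phi> k z *\<^sub>R g z)"
          by (rule set_integrable_scaleR_unit[OF gi borel_measurable_continuous_onI[OF c\<phi>] r\<phi>])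
        ultimately show ?thesis by (simp add: scaleR_diff_right set_integral_diff(2))
      qed
      show ?thesis
      proof (rule set_integral_limit_zero[OF hi _ _ _ r\<phi> _ zero])
        show "box l u \<subseteq> Q" unfolding l u boxP Q_def using in1 in2 by auto
        show "\<phi> k \<in> borel_measurable borel" for k by (rule borel_measurable_continuous_onI[OF c\<phi>])
        show "(\<lambda>k. \<phi> k z) \<longlonglongrightarrow> indicator (box l u) z" for z
        proof -
          have "(\<lambda>k. \<phi> k z) \<longlonglongrightarrow> indicator {a<..<b} (fst z) * indicator {c<..<d} (snd z)"
            unfolding \<phi>_def using b5 c5 by (intro tendsto_mult) blast+
          then show ?thesis unfolding l u boxP by (simp add: indicator_times)
        qed
      qed simp
    qed
  qed
  then show ?thesis unfolding Qc by simp
qed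


lemma set_integral_square_iterated:
  fixes F :: "real \<times> real \<Rightarrow> 'b::euclidean_space"
  assumes "continuous_on ({a..b} \<times> {a..b}) F"
  shows "(LINT z:{a..b} \<times> {a..b}|lborel. F z) = integral {a..b} (\<lambda>s. integral {a..b} (\<lambda>\<theta>. F (s, \<theta>)))"
    and "(LINT z:{a..b} \<times> {a..b}|lborel. F z) = integral {a..b} (\<lambda>\<theta>. integral {a..b} (\<lambda>s. F (s, \<theta>)))"
proof -
  have Q: "{a..b} \<times> {a..b} = cbox (a, a) (b, b)" by (simp add: cbox_Pair_eq)
  have i: "set_integrable lborel ({a..b} \<times> {a..b}) F"
    by (intro set_integrable_continuous_compact compact_Times compact_Icc assms)
  have c: "continuous_on (cbox (a, a) (b, b)) F" using assms unfolding Q .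
  have "(LINT z:{a..b} \<times> {a..b}|lborel. F z) = integral (cbox (a, a) (b, b)) F"
    using set_borel_integral_eq_integral(2)[OF i] unfolding Q .
  also have "\<dots> = integral (cbox a b) (\<lambda>s. integral (cbox a b) (\<lambda>\<theta>. F (s, \<theta>)))"
    by (rule integral_prod_continuous[OF c])
  finally show 1: "(LINT z:{a..b} \<times> {a..b}|lborel. F z) = integral {a..b} (\<lambda>s. integral {a..b} (\<lambda>\<theta>. F (s, \<theta>)))" by simp
  show "(LINT z:{a..b} \<times> {a..b}|lborel. F z) = integral {a..b} (\<lambda>\<theta>. integral {a..b} (\<lambda>s. F (s, \<theta>)))"
    using integral_swap_continuous[of a a b b "\<lambda>s \<theta>. F (s, \<theta>)"] c unfolding 1 by simp
qed

text \<open>Integrating over \<open>s\<close> first leaves the bump in \<open>\<theta>\<close> as a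
  constant factor, so that the one-variable integration by parts applies for each
  \<open>\<theta>\<close>.\<close>

lemma weak_deriv_eq_classical_fst:
  fixes f g p :: "real \<Rightarrow> real \<Rightarrow> 'b::euclidean_space"
  assumes tau: "\<tau> > 0" and weak: "weak_partial_deriv_on ({-\<tau>..0} \<times> {-\<tau>..0}) (1, 0) (case_prod f) (case_prod g)"
    and g: "L2_on ({-\<tau>..0} \<times> {-\<tau>..0}) (case_prod g)"
    and f: "\<And>s \<theta>. s \<in> {-\<tau>..0} \<Longrightarrow> \<theta> \<in> {-\<tau>..0} \<Longrightarrow> ((\<lambda>s. f s \<theta>) has_vector_derivative p s \<theta>) (at s within {-\<tau>..0})"
    and cf: "continuous_on ({-\<tau>..0} \<times> {-\<tau>..0}) (case_prod f)" and p: "continuous_on ({-\<tau>..0} \<times> {-\<tau>..0}) (case_prod p)"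
  shows "AE z in lborel. z \<in> {-\<tau>..0} \<times> {-\<tau>..0} \<longrightarrow> case_prod g z = case_prod p z"
proof (rule weak_deriv_eq_classical_square[OF weak g p])
  fix \<beta> \<beta>' \<gamma> \<gamma>' :: "real \<Rightarrow> real"
  assume b: "\<And>s. (\<beta> has_real_derivative \<beta>' s) (at s)" "continuous_on UNIV \<beta>'" "\<beta> (- \<tau>) = 0" "\<beta> 0 = 0"
    and c: "\<And>s. (\<gamma> has_real_derivative \<gamma>' s) (at s)"
  have cb: "continuous_on UNIV \<beta>" "continuous_on UNIV \<gamma>"
    using b(1) c by (meson DERIV_continuous_on has_field_derivative_at_within)+
  note cc = continuous_on_compose2[OF cb(1)] continuous_on_compose2[OF cb(2)] continuous_on_compose2[OF b(2)]
  have c1: "continuous_on ({-\<tau>..0} \<times> {-\<tau>..0}) (\<lambda>z. (\<beta>' (fst z) * \<gamma> (snd z)) *\<^sub>R case_prod f z)"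
    by (intro continuous_on_scaleR continuous_on_mult cc continuous_on_fst continuous_on_snd continuous_on_id cf) auto
  have c2: "continuous_on ({-\<tau>..0} \<times> {-\<tau>..0}) (\<lambda>z. (\<beta> (fst z) * \<gamma> (snd z)) *\<^sub>R case_prod p z)"
    by (intro continuous_on_scaleR continuous_on_mult cc continuous_on_fst continuous_on_snd continuous_on_id p) auto
  have "(LINT z:{-\<tau>..0} \<times> {-\<tau>..0}|lborel. (\<beta>' (fst z) * \<gamma> (snd z)) *\<^sub>R case_prod f z)
    = integral {-\<tau>..0} (\<lambda>\<theta>. integral {-\<tau>..0} (\<lambda>s. (\<beta>' s * \<gamma> \<theta>) *\<^sub>R f s \<theta>))"
    unfolding set_integral_square_iterated(2)[OF c1] by simp
  also have "\<dots> = integral {-\<tau>..0} (\<lambda>\<theta>. - integral {-\<tau>..0} (\<lambda>s. (\<beta> s * \<gamma> \<theta>) *\<^sub>R p s \<theta>))"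
  proof (rule integral_cong)
    fix \<theta> assume t: "\<theta> \<in> {-\<tau>..0}"
    have "integral {-\<tau>..0} (\<lambda>s. \<beta>' s *\<^sub>R f s \<theta>) = - integral {-\<tau>..0} (\<lambda>s. \<beta> s *\<^sub>R p s \<theta>)"
    proof (rule integral_by_parts_bump[OF _ b f[OF _ t]])
      show "continuous_on {-\<tau>..0} (\<lambda>s. p s \<theta>)"
        by (rule continuous_on_section'[OF p t])
    qed (use tau in auto)
    moreover have "integral {-\<tau>..0} (\<lambda>s. (\<delta> s * \<gamma> \<theta>) *\<^sub>R q s) = \<gamma> \<theta> *\<^sub>R integral {-\<tau>..0} (\<lambda>s. \<delta> s *\<^sub>R q s)"
      for \<delta> :: "real \<Rightarrow> real" and q :: "real \<Rightarrow> 'b"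
      unfolding integral_cmul[symmetric] by (simp add: mult.commute)
    ultimately show "integral {-\<tau>..0} (\<lambda>s. (\<beta>' s * \<gamma> \<theta>) *\<^sub>R f s \<theta>) = - integral {-\<tau>..0} (\<lambda>s. (\<beta> s * \<gamma> \<theta>) *\<^sub>R p s \<theta>)"
      by simp
  qed
  also have "\<dots> = - (LINT z:{-\<tau>..0} \<times> {-\<tau>..0}|lborel. (\<beta> (fst z) * \<gamma> (snd z)) *\<^sub>R case_prod p z)"
    unfolding set_integral_square_iterated(2)[OF c2] by simp
  finally show "(LINT z:{-\<tau>..0} \<times> {-\<tau>..0}|lborel. (\<beta>' (fst z) * fst (1::real, 0::real) * \<gamma> (snd z) + \<beta> (fst z) * (\<gamma>' (snd z) * snd (1::real, 0::real))) *\<^sub>R case_prod f z)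
      = - (LINT z:{-\<tau>..0} \<times> {-\<tau>..0}|lborel. (\<beta> (fst z) * \<gamma> (snd z)) *\<^sub>R case_prod p z)"
    by simp
qed

lemma weak_deriv_eq_classical_snd:
  fixes f g p :: "real \<Rightarrow> real \<Rightarrow> 'b::euclidean_space"
  assumes tau: "\<tau> > 0" and weak: "weak_partial_deriv_on ({-\<tau>..0} \<times> {-\<tau>..0}) (0, 1) (case_prod f) (case_prod g)"
    and g: "L2_on ({-\<tau>..0} \<times> {-\<tau>..0}) (case_prod g)"
    and f: "\<And>s \<theta>. s \<in> {-\<tau>..0} \<Longrightarrow> \<theta> \<in> {-\<tau>..0} \<Longrightarrow> ((\<lambda>\<theta>. f s \<theta>) has_vector_derivative p s \<theta>) (at \<theta> within {-\<tau>..0})"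
    and cf: "continuous_on ({-\<tau>..0} \<times> {-\<tau>..0}) (case_prod f)" and p: "continuous_on ({-\<tau>..0} \<times> {-\<tau>..0}) (case_prod p)"
  shows "AE z in lborel. z \<in> {-\<tau>..0} \<times> {-\<tau>..0} \<longrightarrow> case_prod g z = case_prod p z"
proof (rule weak_deriv_eq_classical_square[OF weak g p])
  fix \<beta> \<beta>' \<gamma> \<gamma>' :: "real \<Rightarrow> real"
  assume b: "\<And>s. (\<beta> has_real_derivative \<beta>' s) (at s)"
    and c: "\<And>s. (\<gamma> has_real_derivative \<gamma>' s) (at s)" "continuous_on UNIV \<gamma>'" "\<gamma> (- \<tau>) = 0" "\<gamma> 0 = 0"
  have cb: "continuous_on UNIV \<beta>" "continuous_on UNIV \<gamma>"
    using b c(1) by (meson DERIV_continuous_on has_field_derivative_at_within)+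
  note cc = continuous_on_compose2[OF cb(1)] continuous_on_compose2[OF cb(2)] continuous_on_compose2[OF c(2)]
  have c1: "continuous_on ({-\<tau>..0} \<times> {-\<tau>..0}) (\<lambda>z. (\<beta> (fst z) * \<gamma>' (snd z)) *\<^sub>R case_prod f z)"
    by (intro continuous_on_scaleR continuous_on_mult cc continuous_on_fst continuous_on_snd continuous_on_id cf) auto
  have c2: "continuous_on ({-\<tau>..0} \<times> {-\<tau>..0}) (\<lambda>z. (\<beta> (fst z) * \<gamma> (snd z)) *\<^sub>R case_prod p z)"
    by (intro continuous_on_scaleR continuous_on_mult cc continuous_on_fst continuous_on_snd continuous_on_id p) auto
  have "(LINT z:{-\<tau>..0} \<times> {-\<tau>..0}|lborel. (\<beta> (fst z) * \<gamma>' (snd z)) *\<^sub>R case_prod f z)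
    = integral {-\<tau>..0} (\<lambda>s. integral {-\<tau>..0} (\<lambda>\<theta>. (\<beta> s * \<gamma>' \<theta>) *\<^sub>R f s \<theta>))"
    unfolding set_integral_square_iterated(1)[OF c1] by simp
  also have "\<dots> = integral {-\<tau>..0} (\<lambda>s. - integral {-\<tau>..0} (\<lambda>\<theta>. (\<beta> s * \<gamma> \<theta>) *\<^sub>R p s \<theta>))"
  proof (rule integral_cong)
    fix s assume t: "s \<in> {-\<tau>..0}"
    have "integral {-\<tau>..0} (\<lambda>\<theta>. \<gamma>' \<theta> *\<^sub>R f s \<theta>) = - integral {-\<tau>..0} (\<lambda>\<theta>. \<gamma> \<theta> *\<^sub>R p s \<theta>)"
    proof (rule integral_by_parts_bump[OF _ c f[OF t]])
      show "continuous_on {-\<tau>..0} (\<lambda>\<theta>. p s \<theta>)"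
        by (rule continuous_on_section[OF p t])
    qed (use tau in auto)
    moreover have "integral {-\<tau>..0} (\<lambda>\<theta>. (\<beta> s * \<delta> \<theta>) *\<^sub>R q \<theta>) = \<beta> s *\<^sub>R integral {-\<tau>..0} (\<lambda>\<theta>. \<delta> \<theta> *\<^sub>R q \<theta>)"
      for \<delta> :: "real \<Rightarrow> real" and q :: "real \<Rightarrow> 'b"
      unfolding integral_cmul[symmetric] by simp
    ultimately show "integral {-\<tau>..0} (\<lambda>\<theta>. (\<beta> s * \<gamma>' \<theta>) *\<^sub>R f s \<theta>) = - integral {-\<tau>..0} (\<lambda>\<theta>. (\<beta> s * \<gamma> \<theta>) *\<^sub>R p s \<theta>)"
      by simp
  qed
  also have "\<dots> = - (LINT z:{-\<tau>..0} \<times> {-\<tau>..0}|lborel. (\<beta> (fst z) * \<gamma> (snd z)) *\<^sub>R case_prod p z)"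
    unfolding set_integral_square_iterated(1)[OF c2] by simp
  finally show "(LINT z:{-\<tau>..0} \<times> {-\<tau>..0}|lborel. (\<beta>' (fst z) * fst (0::real, 1::real) * \<gamma> (snd z) + \<beta> (fst z) * (\<gamma>' (snd z) * snd (0::real, 1::real))) *\<^sub>R case_prod f z)
      = - (LINT z:{-\<tau>..0} \<times> {-\<tau>..0}|lborel. (\<beta> (fst z) * \<gamma> (snd z)) *\<^sub>R case_prod p z)"
    by simp
qed

section \<open>Pairs generated by sums of squares\<close>

lemma inner_tmult3:
  "v \<bullet> (tmult3 A B X Q Z *v w) = (\<Sum>i\<in>A. \<Sum>j\<in>B. (\<Sum>a\<in>UNIV. X i a * v $ a) * Q i j * (\<Sum>b\<in>UNIV. Z j b * w $ b))"
proof -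
  let ?t = "\<lambda>a b i j. X i a * v $ a * Q i j * (Z j b * w $ b)"
  have "v \<bullet> (tmult3 A B X Q Z *v w) = (\<Sum>a\<in>UNIV. \<Sum>b\<in>UNIV. \<Sum>i\<in>A. \<Sum>j\<in>B. ?t a b i j)"
    unfolding inner_vec_def matrix_vector_mult_def tmult3_def
    by (simp add: sum_distrib_left sum_distrib_right mult_ac)
  also have "\<dots> = (\<Sum>a\<in>UNIV. \<Sum>i\<in>A. \<Sum>b\<in>UNIV. \<Sum>j\<in>B. ?t a b i j)"
    by (rule sum.cong[OF refl], rule sum.swap)
  also have "\<dots> = (\<Sum>i\<in>A. \<Sum>a\<in>UNIV. \<Sum>b\<in>UNIV. \<Sum>j\<in>B. ?t a b i j)" by (rule sum.swap)
  also have "\<dots> = (\<Sum>i\<in>A. \<Sum>a\<in>UNIV. \<Sum>j\<in>B. \<Sum>b\<in>UNIV. ?t a b i j)"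
    by (rule sum.cong[OF refl], rule sum.cong[OF refl], rule sum.swap)
  also have "\<dots> = (\<Sum>i\<in>A. \<Sum>j\<in>B. \<Sum>a\<in>UNIV. \<Sum>b\<in>UNIV. ?t a b i j)"
    by (rule sum.cong[OF refl], rule sum.swap)
  also have "\<dots> = (\<Sum>i\<in>A. \<Sum>j\<in>B. (\<Sum>a\<in>UNIV. X i a * v $ a) * Q i j * (\<Sum>b\<in>UNIV. Z j b * w $ b))"
    by (simp only: sum_product[symmetric] sum_distrib_right[symmetric])
  finally show ?thesis .
qed

text \<open>\<open>m1 s v\<close> is \<open>Y1 s\<close> applied to \<open>v\<close>; \<open>Y2 s \<theta>\<close> applied to \<open>v\<close> factors into \<open>w2 s\<close> and \<open>m2 \<theta> v\<close>.\<close>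

definition m1 :: "real \<Rightarrow> real^'p \<Rightarrow> nat \<times> 'p \<Rightarrow> real" where
  "m1 s v i = s ^ fst i * v $ snd i"

definition m2 :: "real \<Rightarrow> real^'p \<Rightarrow> (nat \<times> nat) \<times> 'p \<Rightarrow> real" where
  "m2 s v j = s ^ snd (fst j) * v $ snd j"

definition w2 :: "real \<Rightarrow> (nat \<times> nat) \<times> 'p \<Rightarrow> real" where
  "w2 s j = s ^ fst (fst j)"

lemma Y1_apply: "(\<Sum>b\<in>UNIV. Y1 s i b * w $ b) = m1 s w (i :: nat \<times> 'p::finite)"
proof -
  have "Y1 s i b * w $ b = (if snd i = b then s ^ fst i * w $ b else 0)" for b
    by (simp add: Y1_def kron_id_def split_beta)
  then show ?thesis by (simp add: m1_def)
qed

lemma Y2_apply: "(\<Sum>b\<in>UNIV. Y2 s \<theta> j b * w $ b) = w2 s j * m2 \<theta> w (j :: (nat \<times> nat) \<times> 'p::finite)"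
proof -
  have "Y2 s \<theta> j b * w $ b = (if snd j = b then s ^ fst (fst j) * (\<theta> ^ snd (fst j) * w $ b) else 0)" for b
    by (simp add: Y2_def kron_id_def split_beta)
  then show ?thesis by (simp add: m2_def w2_def)
qed

lemma finite_idx1: "finite (idx1 d :: (nat \<times> 'p::finite) set)"
  unfolding idx1_def by (intro finite_cartesian_product) auto

lemma finite_idx2: "finite (idx2 d :: ((nat \<times> nat) \<times> 'p::finite) set)"
proof -
  have "finite {(i, j). i + j \<le> d}"
    by (rule finite_subset[of _ "{..d} \<times> {..d}"]) auto
  then show ?thesis unfolding idx2_def by (intro finite_cartesian_product) auto
qed

lemma continuous_on_Y2: "continuous_on A (\<lambda>\<omega>. Y2 \<omega> s j b)"
  unfolding Y2_def kron_id_def split_beta by (intro continuous_intros)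

text \<open>Since \<open>Y2 \<omega> s\<close> splits into \<open>w2 \<omega>\<close> and
  \<open>m2 s\<close>, the integral over \<open>\<omega>\<close> collapses to constant coefficients.
  What remains is a finite sum of products of a function of \<open>s\<close> and a function of
  \<open>\<theta>\<close>, from which both positivity and separability of the kernel are read
  off.\<close>

lemma generated_form:
  fixes M :: "real \<Rightarrow> real^'p::finite^'p"
  assumes gen: "generated_by \<tau> d g M N" and g: "continuous_on {-\<tau>..0} g"
  obtains Q where "sym_psd_on (idx1 d <+> idx2 d) Q"
    and "\<And>s v w. s \<in> {-\<tau>..0} \<Longrightarrow> v \<bullet> (M s *v w) = g s * (\<Sum>i\<in>idx1 d. \<Sum>j\<in>idx1 d. m1 s v i * Q (Inl i) (Inl j) * m1 s w j)"
    and "\<And>s \<theta> v w. s \<in> {-\<tau>..0} \<Longrightarrow> \<theta> \<in> {-\<tau>..0} \<Longrightarrow> v \<bullet> (N s \<theta> *v w) =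
        g s * (\<Sum>i\<in>idx1 d. \<Sum>j\<in>idx2 d. m1 s v i * Q (Inl i) (Inr j) * (w2 s j * m2 \<theta> w j))
      + g \<theta> * (\<Sum>j\<in>idx2 d. \<Sum>i\<in>idx1 d. (w2 \<theta> j * m2 s v j) * Q (Inl i) (Inr j) * m1 \<theta> w i)
      + (\<Sum>j\<in>idx2 d. \<Sum>k\<in>idx2 d. integral {-\<tau>..0} (\<lambda>\<omega>. g \<omega> * w2 \<omega> j * w2 \<omega> k) * Q (Inr j) (Inr k) * (m2 s v j * m2 \<theta> w k))"
proof -
  obtain Q :: "(nat \<times> 'p) + ((nat \<times> nat) \<times> 'p) \<Rightarrow> (nat \<times> 'p) + ((nat \<times> nat) \<times> 'p) \<Rightarrow> real"
    where psd: "sym_psd_on (idx1 d <+> idx2 d) Q"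
    and M: "\<forall>s\<in>{-\<tau>..0}. M s = g s *\<^sub>R tmult3 (idx1 d) (idx1 d) (Y1 s) (\<lambda>i j. Q (Inl i) (Inl j)) (Y1 s)"
    and N: "\<forall>s\<in>{-\<tau>..0}. \<forall>\<theta>\<in>{-\<tau>..0}. N s \<theta> =
                 g s *\<^sub>R tmult3 (idx1 d) (idx2 d) (Y1 s) (\<lambda>i j. Q (Inl i) (Inr j)) (Y2 s \<theta>)
               + g \<theta> *\<^sub>R tmult3 (idx2 d) (idx1 d) (Y2 \<theta> s) (\<lambda>j i. Q (Inl i) (Inr j)) (Y1 \<theta>)
               + (LINT \<omega>:{-\<tau>..0}|lborel.
                    g \<omega> *\<^sub>R tmult3 (idx2 d) (idx2 d) (Y2 \<omega> s) (\<lambda>i j. Q (Inr i) (Inr j)) (Y2 \<omega> \<theta>))"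
    using gen unfolding generated_by_def Let_def by (elim exE conjE) (rule that)
  show thesis
  proof (rule that[OF psd])
    show "v \<bullet> (M s *v w) = g s * (\<Sum>i\<in>idx1 d. \<Sum>j\<in>idx1 d. m1 s v i * Q (Inl i) (Inl j) * m1 s w j)"
      if "s \<in> {-\<tau>..0}" for s v w
      using M that by (simp add: matrix_scaleR_vector inner_tmult3 Y1_apply)
  next
    fix s \<theta> :: real and v w :: "real^'p"
    assume s: "s \<in> {-\<tau>..0}" and t: "\<theta> \<in> {-\<tau>..0}"
    let ?A = "\<lambda>\<omega>. g \<omega> *\<^sub>R tmult3 (idx2 d) (idx2 d) (Y2 \<omega> s) (\<lambda>i j. Q (Inr i) (Inr j)) (Y2 \<omega> \<theta>)"
    have cA: "continuous_on {-\<tau>..0} ?A"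
      unfolding tmult3_def by (intro continuous_intros g continuous_on_Y2)
    have bl: "bounded_linear (\<lambda>A :: real^'p^'p. v \<bullet> (A *v w))"
      by (intro bounded_linear_compose[OF bounded_linear_inner_right]
          bounded_bilinear.bounded_linear_left[OF bounded_bilinear_matrix_vector_mult])
    have "(LINT \<omega>:{-\<tau>..0}|lborel. ?A \<omega>) = integral {-\<tau>..0} ?A"
      by (rule set_borel_integral_eq_integral(2)[OF set_integrable_continuous_compact[OF compact_Icc cA]])
    then have "v \<bullet> ((LINT \<omega>:{-\<tau>..0}|lborel. ?A \<omega>) *v w) = integral {-\<tau>..0} (\<lambda>\<omega>. v \<bullet> (?A \<omega> *v w))"
      using integral_linear[OF integrable_continuous_real[OF cA] bl] by (simp add: o_def)
    also have "\<dots> = integral {-\<tau>..0} (\<lambda>\<omega>. \<Sum>j\<in>idx2 d. \<Sum>k\<in>idx2 d. (Q (Inr j) (Inr k) * (m2 s v j * m2 \<theta> w k)) * (g \<omega> * w2 \<omega> j * w2 \<omega> k))"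
      unfolding matrix_scaleR_vector inner_scaleR_right inner_tmult3 Y2_apply
      by (simp only: sum_distrib_left mult_ac)
    also have "\<dots> = (\<Sum>j\<in>idx2 d. \<Sum>k\<in>idx2 d. (Q (Inr j) (Inr k) * (m2 s v j * m2 \<theta> w k)) * integral {-\<tau>..0} (\<lambda>\<omega>. g \<omega> * w2 \<omega> j * w2 \<omega> k))"
      unfolding w2_def
      by (rule integral_unique, intro has_integral_sum has_integral_mult_right integrable_integral
          integrable_continuous_real continuous_intros g finite_idx2)
    finally have T: "v \<bullet> ((LINT \<omega>:{-\<tau>..0}|lborel. ?A \<omega>) *v w)
      = (\<Sum>j\<in>idx2 d. \<Sum>k\<in>idx2 d. integral {-\<tau>..0} (\<lambda>\<omega>. g \<omega> * w2 \<omega> j * w2 \<omega> k) * Q (Inr j) (Inr k) * (m2 s v j * m2 \<theta> w k))"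
      by (simp only: mult_ac)
    have Nst: "N s \<theta> = g s *\<^sub>R tmult3 (idx1 d) (idx2 d) (Y1 s) (\<lambda>i j. Q (Inl i) (Inr j)) (Y2 s \<theta>)
               + g \<theta> *\<^sub>R tmult3 (idx2 d) (idx1 d) (Y2 \<theta> s) (\<lambda>j i. Q (Inl i) (Inr j)) (Y1 \<theta>)
               + (LINT \<omega>:{-\<tau>..0}|lborel. ?A \<omega>)" using N s t by blast
    show "v \<bullet> (N s \<theta> *v w) =
        g s * (\<Sum>i\<in>idx1 d. \<Sum>j\<in>idx2 d. m1 s v i * Q (Inl i) (Inr j) * (w2 s j * m2 \<theta> w j))
      + g \<theta> * (\<Sum>j\<in>idx2 d. \<Sum>i\<in>idx1 d. (w2 \<theta> j * m2 s v j) * Q (Inl i) (Inr j) * m1 \<theta> w i)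
      + (\<Sum>j\<in>idx2 d. \<Sum>k\<in>idx2 d. integral {-\<tau>..0} (\<lambda>\<omega>. g \<omega> * w2 \<omega> j * w2 \<omega> k) * Q (Inr j) (Inr k) * (m2 s v j * m2 \<theta> w k))"
      unfolding Nst matrix_vector_mult_add_rdistrib inner_add_right T
      unfolding matrix_scaleR_vector inner_scaleR_right inner_tmult3 Y1_apply Y2_apply ..
  qed
qed

text \<open>Carrying out the integrations turns the whole expression into the integral of
  \<open>g s\<close> times the form of \<open>Q\<close> at one vector \<open>U s\<close>. Its upper
  part is \<open>Y1 s\<close> applied to \<open>v s\<close>, its lower part the integral over
  \<open>\<theta>\<close> of \<open>Y2 s \<theta>\<close> applied to
  \<open>v \<theta>\<close>.\<close>

lemma generated_nonneg:
  fixes M :: "real \<Rightarrow> real^'p::finite^'p"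
  assumes gen: "generated_by \<tau> d g M N" and g: "continuous_on {-\<tau>..0} g" and g0: "\<And>s. s \<in> {-\<tau>..0} \<Longrightarrow> 0 \<le> g s"
    and v: "continuous_on {-\<tau>..0} v"
  shows "0 \<le> integral {-\<tau>..0} (\<lambda>s. v s \<bullet> (M s *v v s)) + integral {-\<tau>..0} (\<lambda>s. integral {-\<tau>..0} (\<lambda>\<theta>. v s \<bullet> (N s \<theta> *v v \<theta>)))"
proof -
  let ?I = "{-\<tau>..0}"
  obtain Q where psd: "sym_psd_on (idx1 d <+> idx2 d) Q"
    and M: "\<And>s v w. s \<in> ?I \<Longrightarrow> v \<bullet> (M s *v w) = g s * (\<Sum>i\<in>idx1 d. \<Sum>j\<in>idx1 d. m1 s v i * Q (Inl i) (Inl j) * m1 s w j)"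
    and N: "\<And>s \<theta> v w. s \<in> ?I \<Longrightarrow> \<theta> \<in> ?I \<Longrightarrow> v \<bullet> (N s \<theta> *v w) =
        g s * (\<Sum>i\<in>idx1 d. \<Sum>j\<in>idx2 d. m1 s v i * Q (Inl i) (Inr j) * (w2 s j * m2 \<theta> w j))
      + g \<theta> * (\<Sum>j\<in>idx2 d. \<Sum>i\<in>idx1 d. (w2 \<theta> j * m2 s v j) * Q (Inl i) (Inr j) * m1 \<theta> w i)
      + (\<Sum>j\<in>idx2 d. \<Sum>k\<in>idx2 d. integral ?I (\<lambda>\<omega>. g \<omega> * w2 \<omega> j * w2 \<omega> k) * Q (Inr j) (Inr k) * (m2 s v j * m2 \<theta> w k))"
    by (rule generated_form[OF gen g]) (rule that)
  have cv: "continuous_on ?I (\<lambda>s. v s $ a)" for a using v by (intro continuous_intros)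
  define y where "y s i = m1 s (v s) i" for s i
  define z where "z s j = m2 s (v s) j" for s j
  define \<mu> where "\<mu> j = integral ?I (\<lambda>s. z s j)" for j
  define e where "e j i = integral ?I (\<lambda>s. g s * w2 s j * y s i)" for j :: "(nat \<times> nat) \<times> 'p" and i
  define c where "c j k = integral ?I (\<lambda>s. g s * w2 s j * w2 s k)" for j k :: "(nat \<times> nat) \<times> 'p"
  define U where "U s p = (case p of Inl i \<Rightarrow> y s i | Inr j \<Rightarrow> w2 s j * \<mu> j)" for s p
  have cy: "continuous_on ?I (\<lambda>s. y s i)" and cz: "continuous_on ?I (\<lambda>s. z s j)" and cw: "continuous_on ?I (\<lambda>s. w2 s j)" for i j
    unfolding y_def z_def w2_def m1_def m2_def by (intro continuous_intros cv)+
  have hz: "((\<lambda>s. z s j) has_integral \<mu> j) ?I" for j unfolding \<mu>_def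
    by (intro integrable_integral integrable_continuous_real cz)
  have he: "((\<lambda>s. g s * w2 s j * y s i) has_integral e j i) ?I" for j i unfolding e_def
    by (intro integrable_integral integrable_continuous_real continuous_on_mult g cw cy)
  have hc: "((\<lambda>s. g s * w2 s j * w2 s k) has_integral c j k) ?I" for j k unfolding c_def
    by (intro integrable_integral integrable_continuous_real continuous_on_mult g cw)
  define a where "a s = g s * (\<Sum>i\<in>idx1 d. \<Sum>j\<in>idx1 d. y s i * Q (Inl i) (Inl j) * y s j)" for s
  have ha: "(a has_integral integral ?I a) ?I" unfolding a_def
    by (intro integrable_integral integrable_continuous_real continuous_on_mult continuous_on_sum continuous_on_const g cy)
  \<comment> \<open>\<open>X\<close> is the mixed term, which occurs twice because \<open>N\<close>
    contains it together with its transpose; \<open>Y\<close> is the term of the lower right block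
    of \<open>Q\<close>.\<close>
  define X where "X = (\<Sum>i\<in>idx1 d. \<Sum>j\<in>idx2 d. Q (Inl i) (Inr j) * \<mu> j * e j i)"
  define Y where "Y = (\<Sum>j\<in>idx2 d. \<Sum>k\<in>idx2 d. Q (Inr j) (Inr k) * \<mu> j * \<mu> k * c j k)"
  have inner: "integral ?I (\<lambda>\<theta>. v s \<bullet> (N s \<theta> *v v \<theta>)) = 
      (\<Sum>i\<in>idx1 d. \<Sum>j\<in>idx2 d. (Q (Inl i) (Inr j) * \<mu> j) * (g s * w2 s j * y s i))
      + (\<Sum>j\<in>idx2 d. \<Sum>i\<in>idx1 d. (Q (Inl i) (Inr j) * e j i) * z s j)
      + (\<Sum>j\<in>idx2 d. \<Sum>k\<in>idx2 d. (c j k * Q (Inr j) (Inr k) * \<mu> k) * z s j)" if s: "s \<in> ?I" for s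
  proof -
    have "((\<lambda>\<theta>. (\<Sum>i\<in>idx1 d. \<Sum>j\<in>idx2 d. (Q (Inl i) (Inr j) * (g s * w2 s j * y s i)) * z \<theta> j)
      + (\<Sum>j\<in>idx2 d. \<Sum>i\<in>idx1 d. (Q (Inl i) (Inr j) * z s j) * (g \<theta> * w2 \<theta> j * y \<theta> i))
      + (\<Sum>j\<in>idx2 d. \<Sum>k\<in>idx2 d. (c j k * Q (Inr j) (Inr k) * z s j) * z \<theta> k)) has_integral 
      ((\<Sum>i\<in>idx1 d. \<Sum>j\<in>idx2 d. (Q (Inl i) (Inr j) * (g s * w2 s j * y s i)) * \<mu> j)
      + (\<Sum>j\<in>idx2 d. \<Sum>i\<in>idx1 d. (Q (Inl i) (Inr j) * z s j) * e j i)
      + (\<Sum>j\<in>idx2 d. \<Sum>k\<in>idx2 d. (c j k * Q (Inr j) (Inr k) * z s j) * \<mu> k))) ?I" (is "(?F has_integral ?V) ?I")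
      by (intro has_integral_add has_integral_sum has_integral_mult_right hz he finite_idx1 finite_idx2)
    moreover have "v s \<bullet> (N s \<theta> *v v \<theta>) = ?F \<theta>" if "\<theta> \<in> ?I" for \<theta>
      unfolding N[OF s that] y_def z_def c_def by (simp only: sum_distrib_left mult_ac)
    ultimately have "integral ?I (\<lambda>\<theta>. v s \<bullet> (N s \<theta> *v v \<theta>)) = ?V"
      by (metis (no_types, lifting) integral_cong integral_unique)
    then show ?thesis by (simp only: mult_ac)
  qed
  have outer: "integral ?I (\<lambda>s. integral ?I (\<lambda>\<theta>. v s \<bullet> (N s \<theta> *v v \<theta>))) = X + X + Y"
  proof -
    have "((\<lambda>s. (\<Sum>i\<in>idx1 d. \<Sum>j\<in>idx2 d. (Q (Inl i) (Inr j) * \<mu> j) * (g s * w2 s j * y s i))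
      + (\<Sum>j\<in>idx2 d. \<Sum>i\<in>idx1 d. (Q (Inl i) (Inr j) * e j i) * z s j)
      + (\<Sum>j\<in>idx2 d. \<Sum>k\<in>idx2 d. (c j k * Q (Inr j) (Inr k) * \<mu> k) * z s j)) has_integral
      ((\<Sum>i\<in>idx1 d. \<Sum>j\<in>idx2 d. (Q (Inl i) (Inr j) * \<mu> j) * e j i)
      + (\<Sum>j\<in>idx2 d. \<Sum>i\<in>idx1 d. (Q (Inl i) (Inr j) * e j i) * \<mu> j)
      + (\<Sum>j\<in>idx2 d. \<Sum>k\<in>idx2 d. (c j k * Q (Inr j) (Inr k) * \<mu> k) * \<mu> j))) ?I" (is "(?F has_integral ?V) ?I")
      by (intro has_integral_add has_integral_sum has_integral_mult_right hz he finite_idx1 finite_idx2)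
    then have "integral ?I ?F = ?V" by (rule integral_unique)
    moreover have "integral ?I (\<lambda>s. integral ?I (\<lambda>\<theta>. v s \<bullet> (N s \<theta> *v v \<theta>))) = integral ?I ?F"
      by (rule integral_cong) (rule inner)
    moreover have "(\<Sum>j\<in>idx2 d. \<Sum>i\<in>idx1 d. (Q (Inl i) (Inr j) * e j i) * \<mu> j) = X"
      unfolding X_def by (subst sum.swap) (simp only: mult_ac)
    moreover have "(\<Sum>i\<in>idx1 d. \<Sum>j\<in>idx2 d. (Q (Inl i) (Inr j) * \<mu> j) * e j i) = X"
      unfolding X_def by (simp only: mult_ac)
    moreover have "(\<Sum>j\<in>idx2 d. \<Sum>k\<in>idx2 d. (c j k * Q (Inr j) (Inr k) * \<mu> k) * \<mu> j) = Y"
      unfolding Y_def by (simp only: mult_ac)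
    ultimately show ?thesis by (simp only:)
  qed
  have sq: "integral ?I (\<lambda>s. v s \<bullet> (M s *v v s)) = integral ?I a"
    by (rule integral_cong) (simp only: M a_def y_def)
  have "((\<lambda>s. a s + (\<Sum>i\<in>idx1 d. \<Sum>j\<in>idx2 d. (Q (Inl i) (Inr j) * \<mu> j) * (g s * w2 s j * y s i))
       + (\<Sum>i\<in>idx1 d. \<Sum>j\<in>idx2 d. (Q (Inl i) (Inr j) * \<mu> j) * (g s * w2 s j * y s i))
       + (\<Sum>j\<in>idx2 d. \<Sum>k\<in>idx2 d. (Q (Inr j) (Inr k) * \<mu> j * \<mu> k) * (g s * w2 s j * w2 s k))) has_integral
      (integral ?I a + X + X + Y)) ?I" (is "(?F has_integral _) ?I")
    unfolding X_def Y_def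
    by (intro has_integral_add has_integral_sum has_integral_mult_right ha he hc finite_idx1 finite_idx2)
  moreover have "0 \<le> ?F s" if s: "s \<in> ?I" for s
  proof -
    have sym: "Q (Inr j) (Inl i) = Q (Inl i) (Inr j)" if "i \<in> idx1 d" "j \<in> idx2 d" for i j
      using psd that unfolding sym_psd_on_def by blast
    have "0 \<le> (\<Sum>p\<in>idx1 d <+> idx2 d. \<Sum>q\<in>idx1 d <+> idx2 d. U s p * Q p q * U s q)"
      using psd unfolding sym_psd_on_def by blast
    also have "\<dots> = (\<Sum>i\<in>idx1 d. \<Sum>j\<in>idx1 d. y s i * Q (Inl i) (Inl j) * y s j)
       + (\<Sum>i\<in>idx1 d. \<Sum>j\<in>idx2 d. y s i * Q (Inl i) (Inr j) * (w2 s j * \<mu> j))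
       + ((\<Sum>j\<in>idx2 d. \<Sum>i\<in>idx1 d. (w2 s j * \<mu> j) * Q (Inr j) (Inl i) * y s i)
       + (\<Sum>j\<in>idx2 d. \<Sum>k\<in>idx2 d. (w2 s j * \<mu> j) * Q (Inr j) (Inr k) * (w2 s k * \<mu> k)))"
      by (simp add: sum.Plus finite_idx1 finite_idx2 U_def sum.distrib)
    also have "(\<Sum>j\<in>idx2 d. \<Sum>i\<in>idx1 d. (w2 s j * \<mu> j) * Q (Inr j) (Inl i) * y s i)
       = (\<Sum>i\<in>idx1 d. \<Sum>j\<in>idx2 d. y s i * Q (Inl i) (Inr j) * (w2 s j * \<mu> j))"
      by (subst sum.swap, intro sum.cong refl) (simp add: sym)
    finally have "0 \<le> g s * ((\<Sum>i\<in>idx1 d. \<Sum>j\<in>idx1 d. y s i * Q (Inl i) (Inl j) * y s j)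
       + (\<Sum>i\<in>idx1 d. \<Sum>j\<in>idx2 d. y s i * Q (Inl i) (Inr j) * (w2 s j * \<mu> j))
       + ((\<Sum>i\<in>idx1 d. \<Sum>j\<in>idx2 d. y s i * Q (Inl i) (Inr j) * (w2 s j * \<mu> j))
       + (\<Sum>j\<in>idx2 d. \<Sum>k\<in>idx2 d. (w2 s j * \<mu> j) * Q (Inr j) (Inr k) * (w2 s k * \<mu> k))))"
      by (rule mult_nonneg_nonneg[OF g0[OF s]])
    also have "\<dots> = ?F s" unfolding a_def distrib_left by (simp only: sum_distrib_left mult_ac add_ac)
    finally show ?thesis .
  qed
  ultimately have "0 \<le> integral ?I a + X + X + Y" by (rule has_integral_nonneg)
  then show ?thesis unfolding sq outer by (simp only: add_ac)
qed

text \<open>With lists, closure under addition is concatenation and no index set has to be carried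
  along. The identity is required on the whole plane; kernels are compared with such a function on
  the square only.\<close>

definition poly_separable :: "(real \<Rightarrow> real \<Rightarrow> real) \<Rightarrow> bool" where
  "poly_separable f \<longleftrightarrow> (\<exists>xs :: (real poly \<times> real poly) list. \<forall>s \<theta>. f s \<theta> = (\<Sum>(p, q)\<leftarrow>xs. poly p s * poly q \<theta>))"

lemma poly_separable_prod: "poly_separable (\<lambda>s \<theta>. poly p s * poly q \<theta>)"
  unfolding poly_separable_def by (rule exI[of _ "[(p, q)]"]) simp

lemma poly_separable_zero: "poly_separable (\<lambda>s \<theta>. 0)"
  unfolding poly_separable_def by (rule exI[of _ "[]"]) simp

lemma poly_separable_add: assumes "poly_separable f" "poly_separable g" shows "poly_separable (\<lambda>s \<theta>. f s \<theta> + g s \<theta>)"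
proof -
  obtain xs ys where "\<forall>s \<theta>. f s \<theta> = (\<Sum>(p, q)\<leftarrow>xs. poly p s * poly q \<theta>)"
    "\<forall>s \<theta>. g s \<theta> = (\<Sum>(p, q)\<leftarrow>ys. poly p s * poly q \<theta>)"
    using assms unfolding poly_separable_def by blast
  then show ?thesis unfolding poly_separable_def by (intro exI[of _ "xs @ ys"]) simp
qed

lemma poly_separable_sum:
  assumes "finite A" "\<And>x. x \<in> A \<Longrightarrow> poly_separable (f x)"
  shows "poly_separable (\<lambda>s \<theta>. \<Sum>x\<in>A. f x s \<theta>)"
  using assms by (induction A rule: finite_induct) (simp_all add: poly_separable_zero poly_separable_add)

lemma poly_separable_continuous: assumes "poly_separable f" shows "continuous_on A (\<lambda>(s, \<theta>). f s \<theta>)"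
proof -
  obtain xs where xs: "\<forall>s \<theta>. f s \<theta> = (\<Sum>(p, q)\<leftarrow>xs. poly p s * poly q \<theta>)"
    using assms unfolding poly_separable_def by blast
  have "continuous_on A (\<lambda>z. \<Sum>(p, q)\<leftarrow>ys. poly p (fst z) * poly q (snd z))" for ys :: "(real poly \<times> real poly) list"
    by (induction ys) (simp_all add: split_beta continuous_on_add continuous_on_mult continuous_on_poly continuous_on_fst continuous_on_snd continuous_on_id)
  then show ?thesis using xs by (simp add: split_beta)
qed

text \<open>The weight is written \<open>poly G\<close> so that 1 and
  \<open>- s * (s + \<tau>)\<close> are covered at once.\<close>

lemma generated_poly_diag:
  fixes M :: "real \<Rightarrow> real^'p::finite^'p"
  assumes gen: "generated_by \<tau> d (poly G) M N"
  shows "\<exists>p. \<forall>s\<in>{-\<tau>..0}. v \<bullet> (M s *v w) = poly p s"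
proof -
  obtain Q where psd: "sym_psd_on (idx1 d <+> idx2 d) Q"
    and M: "\<And>s v w. s \<in> {-\<tau>..0} \<Longrightarrow> v \<bullet> (M s *v w) = poly G s * (\<Sum>i\<in>idx1 d. \<Sum>j\<in>idx1 d. m1 s v i * Q (Inl i) (Inl j) * m1 s w j)"
    and N: "\<And>s \<theta> v w. s \<in> {-\<tau>..0} \<Longrightarrow> \<theta> \<in> {-\<tau>..0} \<Longrightarrow> v \<bullet> (N s \<theta> *v w) =
        poly G s * (\<Sum>i\<in>idx1 d. \<Sum>j\<in>idx2 d. m1 s v i * Q (Inl i) (Inr j) * (w2 s j * m2 \<theta> w j))
      + poly G \<theta> * (\<Sum>j\<in>idx2 d. \<Sum>i\<in>idx1 d. (w2 \<theta> j * m2 s v j) * Q (Inl i) (Inr j) * m1 \<theta> w i)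
      + (\<Sum>j\<in>idx2 d. \<Sum>k\<in>idx2 d. integral {-\<tau>..0} (\<lambda>\<omega>. poly G \<omega> * w2 \<omega> j * w2 \<omega> k) * Q (Inr j) (Inr k) * (m2 s v j * m2 \<theta> w k))"
    by (rule generated_form[OF gen continuous_on_poly[OF continuous_on_id]]) (rule that)
  let ?p = "G * (\<Sum>i\<in>idx1 d. \<Sum>j\<in>idx1 d. monom (v $ snd i * Q (Inl i) (Inl j) * w $ snd j) (fst i + fst j))"
  have "v \<bullet> (M s *v w) = poly ?p s" if "s \<in> {-\<tau>..0}" for s
    unfolding M[OF that] m1_def by (simp add: poly_sum poly_monom power_add mult_ac)
  then show ?thesis by blast
qed

lemma generated_sep:
  fixes M :: "real \<Rightarrow> real^'p::finite^'p"
  assumes gen: "generated_by \<tau> d (poly G) M N"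
  shows "\<exists>f. poly_separable f \<and> (\<forall>s\<in>{-\<tau>..0}. \<forall>\<theta>\<in>{-\<tau>..0}. v \<bullet> (N s \<theta> *v w) = f s \<theta>)"
proof -
  obtain Q where psd: "sym_psd_on (idx1 d <+> idx2 d) Q"
    and M: "\<And>s v w. s \<in> {-\<tau>..0} \<Longrightarrow> v \<bullet> (M s *v w) = poly G s * (\<Sum>i\<in>idx1 d. \<Sum>j\<in>idx1 d. m1 s v i * Q (Inl i) (Inl j) * m1 s w j)"
    and N: "\<And>s \<theta> v w. s \<in> {-\<tau>..0} \<Longrightarrow> \<theta> \<in> {-\<tau>..0} \<Longrightarrow> v \<bullet> (N s \<theta> *v w) =
        poly G s * (\<Sum>i\<in>idx1 d. \<Sum>j\<in>idx2 d. m1 s v i * Q (Inl i) (Inr j) * (w2 s j * m2 \<theta> w j))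
      + poly G \<theta> * (\<Sum>j\<in>idx2 d. \<Sum>i\<in>idx1 d. (w2 \<theta> j * m2 s v j) * Q (Inl i) (Inr j) * m1 \<theta> w i)
      + (\<Sum>j\<in>idx2 d. \<Sum>k\<in>idx2 d. integral {-\<tau>..0} (\<lambda>\<omega>. poly G \<omega> * w2 \<omega> j * w2 \<omega> k) * Q (Inr j) (Inr k) * (m2 s v j * m2 \<theta> w k))"
    by (rule generated_form[OF gen continuous_on_poly[OF continuous_on_id]]) (rule that)
  define f where "f s \<theta> =
        (\<Sum>i\<in>idx1 d. \<Sum>j\<in>idx2 d. poly (G * monom (v $ snd i * Q (Inl i) (Inr j)) (fst i + fst (fst j))) s * poly (monom (w $ snd j) (snd (fst j))) \<theta>)
      + (\<Sum>j\<in>idx2 d. \<Sum>i\<in>idx1 d. poly (monom (v $ snd j) (snd (fst j))) s * poly (G * monom (Q (Inl i) (Inr j) * w $ snd i) (fst (fst j) + fst i)) \<theta>)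
      + (\<Sum>j\<in>idx2 d. \<Sum>k\<in>idx2 d. poly (monom (integral {-\<tau>..0} (\<lambda>\<omega>. poly G \<omega> * w2 \<omega> j * w2 \<omega> k) * Q (Inr j) (Inr k) * v $ snd j) (snd (fst j))) s
           * poly (monom (w $ snd k) (snd (fst k))) \<theta>)" for s \<theta>
  have "poly_separable f" unfolding f_def
    by (intro poly_separable_add poly_separable_sum poly_separable_prod finite_idx1 finite_idx2)
  moreover have "v \<bullet> (N s \<theta> *v w) = f s \<theta>" if "s \<in> {-\<tau>..0}" "\<theta> \<in> {-\<tau>..0}" for s \<theta>
  proof -
    have 1: "poly G s * (\<Sum>i\<in>idx1 d. \<Sum>j\<in>idx2 d. m1 s v i * Q (Inl i) (Inr j) * (w2 s j * m2 \<theta> w j))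
      = (\<Sum>i\<in>idx1 d. \<Sum>j\<in>idx2 d. poly (G * monom (v $ snd i * Q (Inl i) (Inr j)) (fst i + fst (fst j))) s * poly (monom (w $ snd j) (snd (fst j))) \<theta>)"
      by (simp add: m1_def m2_def w2_def poly_monom power_add sum_distrib_left mult_ac)
    have 2: "poly G \<theta> * (\<Sum>j\<in>idx2 d. \<Sum>i\<in>idx1 d. (w2 \<theta> j * m2 s v j) * Q (Inl i) (Inr j) * m1 \<theta> w i)
      = (\<Sum>j\<in>idx2 d. \<Sum>i\<in>idx1 d. poly (monom (v $ snd j) (snd (fst j))) s * poly (G * monom (Q (Inl i) (Inr j) * w $ snd i) (fst (fst j) + fst i)) \<theta>)"
      by (simp add: m1_def m2_def w2_def poly_monom power_add sum_distrib_left mult_ac)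
    have 3: "(\<Sum>j\<in>idx2 d. \<Sum>k\<in>idx2 d. integral {-\<tau>..0} (\<lambda>\<omega>. poly G \<omega> * w2 \<omega> j * w2 \<omega> k) * Q (Inr j) (Inr k) * (m2 s v j * m2 \<theta> w k))
      = (\<Sum>j\<in>idx2 d. \<Sum>k\<in>idx2 d. poly (monom (integral {-\<tau>..0} (\<lambda>\<omega>. poly G \<omega> * w2 \<omega> j * w2 \<omega> k) * Q (Inr j) (Inr k) * v $ snd j) (snd (fst j))) s
           * poly (monom (w $ snd k) (snd (fst k))) \<theta>)"
      unfolding m2_def poly_monom by (simp only: mult_ac)
    show ?thesis unfolding N[OF that] f_def 1 2 3 ..
  qed
  ultimately show ?thesis by blast
qed

text \<open>\<open>Q\<close> is tested with a vector whose lower part is zero.\<close>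

lemma generated_psd:
  fixes M :: "real \<Rightarrow> real^'p::finite^'p"
  assumes gen: "generated_by \<tau> d g M N" and g: "continuous_on {-\<tau>..0} g" and g0: "\<And>s. s \<in> {-\<tau>..0} \<Longrightarrow> 0 \<le> g s"
    and s: "s \<in> {-\<tau>..0}"
  shows "0 \<le> v \<bullet> (M s *v v)"
proof -
  obtain Q where psd: "sym_psd_on (idx1 d <+> idx2 d) Q"
    and M: "\<And>s v w. s \<in> {-\<tau>..0} \<Longrightarrow> v \<bullet> (M s *v w) = g s * (\<Sum>i\<in>idx1 d. \<Sum>j\<in>idx1 d. m1 s v i * Q (Inl i) (Inl j) * m1 s w j)"
    and N: "\<And>s \<theta> v w. s \<in> {-\<tau>..0} \<Longrightarrow> \<theta> \<in> {-\<tau>..0} \<Longrightarrow> v \<bullet> (N s \<theta> *v w) =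
        g s * (\<Sum>i\<in>idx1 d. \<Sum>j\<in>idx2 d. m1 s v i * Q (Inl i) (Inr j) * (w2 s j * m2 \<theta> w j))
      + g \<theta> * (\<Sum>j\<in>idx2 d. \<Sum>i\<in>idx1 d. (w2 \<theta> j * m2 s v j) * Q (Inl i) (Inr j) * m1 \<theta> w i)
      + (\<Sum>j\<in>idx2 d. \<Sum>k\<in>idx2 d. integral {-\<tau>..0} (\<lambda>\<omega>. g \<omega> * w2 \<omega> j * w2 \<omega> k) * Q (Inr j) (Inr k) * (m2 s v j * m2 \<theta> w k))"
    by (rule generated_form[OF gen g]) (rule that)
  let ?U = "\<lambda>p. case p of Inl i \<Rightarrow> m1 s v i | Inr j \<Rightarrow> 0"
  have "0 \<le> (\<Sum>p\<in>idx1 d <+> idx2 d. \<Sum>q\<in>idx1 d <+> idx2 d. ?U p * Q p q * ?U q)"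
    using psd unfolding sym_psd_on_def by blast
  also have "\<dots> = (\<Sum>i\<in>idx1 d. \<Sum>j\<in>idx1 d. m1 s v i * Q (Inl i) (Inl j) * m1 s v j)"
    by (simp add: sum.Plus finite_idx1 finite_idx2)
  finally show ?thesis unfolding M[OF s] by (rule mult_nonneg_nonneg[OF g0[OF s]])
qed

lemma matrix_entry: "A $ i $ j = axis i 1 \<bullet> (A *v axis j (1::real))"
  by (simp add: inner_axis' matrix_vector_mult_basis column_def)

lemma continuous_on_matrix_entries:
  fixes A :: "'a::topological_space \<Rightarrow> real^'m^'n"
  assumes "\<And>v w. continuous_on X (\<lambda>z. v \<bullet> (A z *v w))"
  shows "continuous_on X A"
proof -
  have "continuous_on X (\<lambda>z. \<chi> i j. A z $ i $ j)"
    unfolding matrix_entry by (intro continuous_on_vec_lambda assms)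
  then show ?thesis by simp
qed

text \<open>Membership in \<open>Xi\<close> fixes \<open>M\<close> and \<open>N\<close> only almost
  everywhere. The sums of the two generated pairs are the representatives for which statements at
  every point hold: polynomial entries, separability, positivity.\<close>

lemma Xi_representatives:
  fixes M :: "real \<Rightarrow> real^'p::finite^'p"
  assumes tau: "\<tau> > 0" and Xi: "(M, N) \<in> Xi \<tau> d"
  obtains M' :: "real \<Rightarrow> real^'p^'p" and N' :: "real \<Rightarrow> real \<Rightarrow> real^'p^'p"
  where "AE s in lborel. s \<in> {-\<tau>..0} \<longrightarrow> M s = M' s"
    and "AE z in lborel. z \<in> {-\<tau>..0} \<times> {-\<tau>..0} \<longrightarrow> N (fst z) (snd z) = N' (fst z) (snd z)"
    and "continuous_on {-\<tau>..0} M'" and "continuous_on ({-\<tau>..0} \<times> {-\<tau>..0}) (\<lambda>(s, \<theta>). N' s \<theta>)"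
    and "\<And>v w. \<exists>p. \<forall>s\<in>{-\<tau>..0}. v \<bullet> (M' s *v w) = poly p s"
    and "\<And>v w. \<exists>f. poly_separable f \<and> (\<forall>s\<in>{-\<tau>..0}. \<forall>\<theta>\<in>{-\<tau>..0}. v \<bullet> (N' s \<theta> *v w) = f s \<theta>)"
    and "\<And>s v. s \<in> {-\<tau>..0} \<Longrightarrow> 0 \<le> v \<bullet> (M' s *v v)"
    and "\<And>v. continuous_on {-\<tau>..0} v \<Longrightarrow> 0 \<le> integral {-\<tau>..0} (\<lambda>s. v s \<bullet> (M' s *v v s))
        + integral {-\<tau>..0} (\<lambda>s. integral {-\<tau>..0} (\<lambda>\<theta>. v s \<bullet> (N' s \<theta> *v v \<theta>)))"
proof -
  let ?I = "{-\<tau>..0}"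
  obtain M1 N1 M2 N2 where g1': "generated_by \<tau> d (\<lambda>s. 1) M1 N1" and g2': "generated_by \<tau> d (\<lambda>s. - s * (s + \<tau>)) M2 N2"
    and M: "AE s in lborel. s \<in> ?I \<longrightarrow> M s = M1 s + M2 s"
    and N: "AE (s, \<theta>) in lborel. s \<in> ?I \<and> \<theta> \<in> ?I \<longrightarrow> N s \<theta> = N1 s \<theta> + N2 s \<theta>"
    using Xi unfolding Xi_def by blast
  have p1: "poly [:1:] = (\<lambda>s. 1 :: real)" by auto
  have p2: "poly [:0, -\<tau>, -1:] = (\<lambda>s. - s * (s + \<tau>))" by (auto simp: algebra_simps)
  have g1: "generated_by \<tau> d (poly [:1:]) M1 N1" and g2: "generated_by \<tau> d (poly [:0, -\<tau>, -1:]) M2 N2"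
    using g1' g2' unfolding p1 p2 .
  have n1: "0 \<le> poly [:1:] s" for s :: real by simp
  have n2: "0 \<le> poly [:0, -\<tau>, -1:] s" if "s \<in> ?I" for s
  proof -
    have "0 \<le> (- s) * (s + \<tau>)" using that by (intro mult_nonneg_nonneg) auto
    then show ?thesis unfolding p2 .
  qed
  have cp: "continuous_on A (poly p)" for A and p :: "real poly" by (rule continuous_on_poly[OF continuous_on_id])
  have diag: "\<exists>p. \<forall>s\<in>?I. v \<bullet> ((M1 s + M2 s) *v w) = poly p s" for v w
  proof -
    obtain q r where "\<forall>s\<in>?I. v \<bullet> (M1 s *v w) = poly q s" "\<forall>s\<in>?I. v \<bullet> (M2 s *v w) = poly r s"
      using generated_poly_diag[OF g1] generated_poly_diag[OF g2] by metis
    then have "\<forall>s\<in>?I. v \<bullet> ((M1 s + M2 s) *v w) = poly (q + r) s"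
      by (simp add: matrix_vector_mult_add_rdistrib inner_add_right)
    then show ?thesis by blast
  qed
  have off: "\<exists>f. poly_separable f \<and> (\<forall>s\<in>?I. \<forall>\<theta>\<in>?I. v \<bullet> ((N1 s \<theta> + N2 s \<theta>) *v w) = f s \<theta>)" for v w
  proof -
    obtain f h where "poly_separable f" "poly_separable h" "\<forall>s\<in>?I. \<forall>\<theta>\<in>?I. v \<bullet> (N1 s \<theta> *v w) = f s \<theta>" "\<forall>s\<in>?I. \<forall>\<theta>\<in>?I. v \<bullet> (N2 s \<theta> *v w) = h s \<theta>"
      using generated_sep[OF g1] generated_sep[OF g2] by metis
    then show ?thesis
      by (intro exI[of _ "\<lambda>s \<theta>. f s \<theta> + h s \<theta>"]) (simp add: poly_separable_add matrix_vector_mult_add_rdistrib inner_add_right)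
  qed
  have contM: "continuous_on ?I M'" if M': "\<And>v w. \<exists>p. \<forall>s\<in>?I. v \<bullet> (M' s *v w) = poly p s" for M' :: "real \<Rightarrow> real^'p^'p"
  proof (rule continuous_on_matrix_entries)
    fix v w
    obtain p where "\<forall>s\<in>?I. v \<bullet> (M' s *v w) = poly p s" using M' by blast
    then show "continuous_on ?I (\<lambda>z. v \<bullet> (M' z *v w))"
      by (intro continuous_on_eq[OF cp[of ?I p]]) simp
  qed
  have contN: "continuous_on (?I \<times> ?I) (\<lambda>(s, \<theta>). N' s \<theta>)"
    if N': "\<And>v w. \<exists>f. poly_separable f \<and> (\<forall>s\<in>?I. \<forall>\<theta>\<in>?I. v \<bullet> (N' s \<theta> *v w) = f s \<theta>)" for N' :: "real \<Rightarrow> real \<Rightarrow> real^'p^'p"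
  proof (rule continuous_on_matrix_entries)
    fix v w
    obtain f where f: "poly_separable f" "\<forall>s\<in>?I. \<forall>\<theta>\<in>?I. v \<bullet> (N' s \<theta> *v w) = f s \<theta>" using N' by blast
    show "continuous_on (?I \<times> ?I) (\<lambda>z. v \<bullet> ((case z of (s, \<theta>) \<Rightarrow> N' s \<theta>) *v w))"
      by (rule continuous_on_eq[OF poly_separable_continuous[OF f(1)]]) (use f(2) in \<open>auto\<close>)
  qed
  have nonneg: "0 \<le> integral ?I (\<lambda>s. v s \<bullet> ((M1 s + M2 s) *v v s))
        + integral ?I (\<lambda>s. integral ?I (\<lambda>\<theta>. v s \<bullet> ((N1 s \<theta> + N2 s \<theta>) *v v \<theta>)))" if v: "continuous_on ?I v" for v
  proof -
    note cM1 = contM[OF generated_poly_diag[OF g1]] and cM2 = contM[OF generated_poly_diag[OF g2]]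
      and cN1 = contN[OF generated_sep[OF g1]] and cN2 = contN[OF generated_sep[OF g2]]
    have i1: "(\<lambda>s. v s \<bullet> (M1 s *v v s)) integrable_on ?I" and i2: "(\<lambda>s. v s \<bullet> (M2 s *v v s)) integrable_on ?I"
      by (intro integrable_continuous_real continuous_on_inner continuous_on_matrix_vector_mult v cM1 cM2)+
    have e1: "integral ?I (\<lambda>s. v s \<bullet> ((M1 s + M2 s) *v v s)) = integral ?I (\<lambda>s. v s \<bullet> (M1 s *v v s)) + integral ?I (\<lambda>s. v s \<bullet> (M2 s *v v s))"
      unfolding matrix_vector_mult_add_rdistrib inner_add_right by (rule integral_add[OF i1 i2])
    have inner: "integral ?I (\<lambda>\<theta>. v s \<bullet> ((N1 s \<theta> + N2 s \<theta>) *v v \<theta>)) = v s \<bullet> integral ?I (\<lambda>\<theta>. N1 s \<theta> *v v \<theta>) + v s \<bullet> integral ?I (\<lambda>\<theta>. N2 s \<theta> *v v \<theta>)"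
      if s: "s \<in> ?I" for s
    proof -
      have c1: "continuous_on ?I (\<lambda>\<theta>. N1 s \<theta> *v v \<theta>)" and c2: "continuous_on ?I (\<lambda>\<theta>. N2 s \<theta> *v v \<theta>)"
        by (intro continuous_on_matrix_vector_mult v continuous_on_section[OF cN1 s] continuous_on_section[OF cN2 s])+
      show ?thesis unfolding matrix_vector_mult_add_rdistrib inner_add_right inner_integral_right[OF c1] inner_integral_right[OF c2]
        by (intro integral_add integrable_continuous_real continuous_on_inner continuous_on_const c1 c2)
    qed
    have j1: "(\<lambda>s. v s \<bullet> integral ?I (\<lambda>\<theta>. N1 s \<theta> *v v \<theta>)) integrable_on ?I" and j2: "(\<lambda>s. v s \<bullet> integral ?I (\<lambda>\<theta>. N2 s \<theta> *v v \<theta>)) integrable_on ?I"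
      by (intro integrable_continuous_real continuous_on_inner continuous_on_kernel_integral v cN1 cN2)+
    have "integral ?I (\<lambda>s. integral ?I (\<lambda>\<theta>. v s \<bullet> ((N1 s \<theta> + N2 s \<theta>) *v v \<theta>)))
      = integral ?I (\<lambda>s. v s \<bullet> integral ?I (\<lambda>\<theta>. N1 s \<theta> *v v \<theta>) + v s \<bullet> integral ?I (\<lambda>\<theta>. N2 s \<theta> *v v \<theta>))"
      by (rule integral_cong) (rule inner)
    also have "\<dots> = integral ?I (\<lambda>s. integral ?I (\<lambda>\<theta>. v s \<bullet> (N1 s \<theta> *v v \<theta>))) + integral ?I (\<lambda>s. integral ?I (\<lambda>\<theta>. v s \<bullet> (N2 s \<theta> *v v \<theta>)))"
      unfolding double_integral_inner_swap(2)[OF cN1 v v, symmetric] double_integral_inner_swap(2)[OF cN2 v v, symmetric]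
      by (rule integral_add[OF j1 j2])
    finally show ?thesis
      using generated_nonneg[OF g1 cp n1 v] generated_nonneg[OF g2 cp n2 v] unfolding e1 by simp
  qed
  have psd: "0 \<le> v \<bullet> ((M1 s + M2 s) *v v)" if "s \<in> ?I" for s v
    using generated_psd[OF g1 cp n1 that, of v] generated_psd[OF g2 cp n2 that, of v]
    by (simp add: matrix_vector_mult_add_rdistrib inner_add_right)
  have N': "AE z in lborel. z \<in> ?I \<times> ?I \<longrightarrow> N (fst z) (snd z) = N1 (fst z) (snd z) + N2 (fst z) (snd z)"
    using N by eventually_elim auto
  show thesis
    by (rule that[of "\<lambda>s. M1 s + M2 s" "\<lambda>s \<theta>. N1 s \<theta> + N2 s \<theta>", OF M N' contM[OF diag] contN[OF off] diag off psd nonneg])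
qed

section \<open>Eliminating the elements of \<open>\<Theta>\<close>\<close>

definition join :: "real^'a \<Rightarrow> real^'b \<Rightarrow> real^('a + 'b)" where
  "join x y = (\<chi> i. case i of Inl a \<Rightarrow> x $ a | Inr b \<Rightarrow> y $ b)"

lemma sum_UNIV_Plus:
  fixes f :: "'a::finite + 'b::finite \<Rightarrow> 'c::comm_monoid_add"
  shows "(\<Sum>i\<in>UNIV. f i) = (\<Sum>a\<in>UNIV. f (Inl a)) + (\<Sum>b\<in>UNIV. f (Inr b))"
  using sum.Plus[of "UNIV :: 'a set" "UNIV :: 'b set" f] by simp

lemma inner_join_block:
  "join x y \<bullet> (block A B C D *v join x' y') = x \<bullet> (A *v x') + x \<bullet> (B *v y') + y \<bullet> (C *v x') + y \<bullet> (D *v y')"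
  by (simp add: inner_vec_def matrix_vector_mult_def sum_UNIV_Plus block_def join_def distrib_left sum.distrib)

lemma inner_join_join: "join x y \<bullet> join x' y' = x \<bullet> x' + y \<bullet> y'"
  by (simp add: inner_vec_def sum_UNIV_Plus join_def)

lemma continuous_on_join:
  assumes "continuous_on A f" "continuous_on A g"
  shows "continuous_on A (\<lambda>s. join (f s) (g s))"
proof -
  have "continuous_on A (\<lambda>s. join (f s) (g s) $ i)" for i
    by (cases i) (simp_all add: join_def continuous_on_component assms)
  then have "continuous_on A (\<lambda>s. \<chi> i. join (f s) (g s) $ i)" by (rule continuous_on_vec_lambda)
  then show ?thesis by simp
qed

text \<open>The matrix x y^T. By \<open>inner_outer\<close> below, a bilinear form becomes an inner
  product with its matrix, so that integrals of matrices pass through the form as they pass through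
  an inner product.\<close>

definition outer :: "real^'m \<Rightarrow> real^'n \<Rightarrow> real^'n^'m" where
  "outer x y = (\<chi> i j. x $ i * y $ j)"

lemma inner_outer: "x \<bullet> (A *v y) = outer x y \<bullet> A"
  by (simp add: inner_vec_def outer_def matrix_vector_mult_def sum_distrib_left mult_ac)

lemma continuous_on_outer:
  assumes "continuous_on A f" "continuous_on A g"
  shows "continuous_on A (\<lambda>s. outer (f s) (g s))"
  unfolding outer_def by (intro continuous_on_vec_lambda continuous_on_mult continuous_on_component assms)

lemma lborel_swap:
  fixes F :: "real \<times> real \<Rightarrow> 'b::euclidean_space"
  assumes F: "integrable lborel F"
  shows "integrable lborel (\<lambda>z. F (snd z, fst z))" "(LINT z|lborel. F (snd z, fst z)) = (LINT z|lborel. F z)"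
proof -
  have F': "integrable (lborel \<Otimes>\<^sub>M lborel) F" using F unfolding lborel_prod .
  show "integrable lborel (\<lambda>z. F (snd z, fst z))"
    using lborel_pair.integrable_product_swap[OF F'] unfolding lborel_prod case_prod_unfold by simp
  show "(LINT z|lborel. F (snd z, fst z)) = (LINT z|lborel. F z)"
    using lborel_pair.integral_product_swap[OF borel_measurable_integrable[OF F']] unfolding lborel_prod case_prod_unfold by simp
qed

text \<open>Everything is extended by zero to the plane, where \<open>ub\<close> is bounded and the
  weighted kernel therefore integrable. Taking \<open>u\<close> out of the inner integral is
  justified for almost every \<open>s\<close>, namely where the section of the kernel is
  integrable.\<close>

lemma fubini_snd:
  fixes l :: "real \<Rightarrow> real \<Rightarrow> 'b::euclidean_space"
  assumes L: "set_integrable lborel ({a..b} \<times> {a..b}) (\<lambda>z. l (fst z) (snd z))" and u: "continuous_on {a..b} u"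
  shows "set_integrable lborel {a..b} (\<lambda>s. LINT \<omega>:{a..b}|lborel. l \<omega> s)"
    and "set_integrable lborel {a..b} (\<lambda>s. u s \<bullet> (LINT \<omega>:{a..b}|lborel. l \<omega> s))"
    and "set_integrable lborel ({a..b} \<times> {a..b}) (\<lambda>z. u (snd z) \<bullet> l (fst z) (snd z))"
    and "(LINT s:{a..b}|lborel. u s \<bullet> (LINT \<omega>:{a..b}|lborel. l \<omega> s)) = (LINT z:{a..b} \<times> {a..b}|lborel. u (snd z) \<bullet> l (fst z) (snd z))"
proof -
  let ?I = "{a..b}"
  define f where "f \<omega> s = indicator (?I \<times> ?I) (\<omega>, s) *\<^sub>R l \<omega> s" for \<omega> s
  define ub where "ub s = indicator ?I s *\<^sub>R u s" for s
  define k where "k \<omega> s = ub s \<bullet> f \<omega> s" for \<omega> s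
  have f1: "integrable lborel (\<lambda>z. f (fst z) (snd z))" using L unfolding set_integrable_def f_def by simp
  then have f: "integrable (lborel \<Otimes>\<^sub>M lborel) (\<lambda>(\<omega>, s). f \<omega> s)" unfolding lborel_prod split_beta .
  have mu: "ub \<in> borel_measurable borel" unfolding ub_def
    by (rule borel_measurable_continuous_on_indicator[OF _ u]) simp
  have "bounded (u ` ?I)" by (intro compact_imp_bounded compact_continuous_image u compact_Icc)
  then obtain B where B: "\<forall>x\<in>u ` ?I. norm x \<le> B" unfolding bounded_iff by blast
  have ub: "norm (ub s) \<le> \<bar>B\<bar>" for s using B unfolding ub_def by (cases "s \<in> ?I") (auto intro: order_trans[OF _ abs_ge_self])
  have k1: "integrable lborel (\<lambda>z. k (fst z) (snd z))"
  proof (rule Bochner_Integration.integrable_bound)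
    show "integrable lborel (\<lambda>z. \<bar>B\<bar> * norm (f (fst z) (snd z)))"
      by (intro integrable_mult_right integrable_norm f1)
    have "(\<lambda>z :: real \<times> real. ub (snd z)) \<in> borel_measurable borel"
      by (rule measurable_compose[OF _ mu]) (rule borel_measurable_continuous_onI, rule continuous_on_snd, rule continuous_on_id)
    then have "(\<lambda>z :: real \<times> real. ub (snd z)) \<in> borel_measurable lborel" by simp
    then show "(\<lambda>z. k (fst z) (snd z)) \<in> borel_measurable lborel" unfolding k_def
      by (intro borel_measurable_inner borel_measurable_integrable[OF f1])
    show "AE z in lborel. norm (k (fst z) (snd z)) \<le> norm (\<bar>B\<bar> * norm (f (fst z) (snd z)))"
    proof (rule AE_I2)
      fix z
      have "norm (k (fst z) (snd z)) \<le> norm (ub (snd z)) * norm (f (fst z) (snd z))"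
        unfolding k_def real_norm_def by (rule Cauchy_Schwarz_ineq2)
      also have "\<dots> \<le> \<bar>B\<bar> * norm (f (fst z) (snd z))" by (intro mult_right_mono ub) simp
      finally show "norm (k (fst z) (snd z)) \<le> norm (\<bar>B\<bar> * norm (f (fst z) (snd z)))" by simp
    qed
  qed
  then have k: "integrable (lborel \<Otimes>\<^sub>M lborel) (\<lambda>(\<omega>, s). k \<omega> s)" unfolding lborel_prod split_beta .
  have kind: "k (fst z) (snd z) = indicator (?I \<times> ?I) z *\<^sub>R (u (snd z) \<bullet> l (fst z) (snd z))" for z
    unfolding k_def f_def ub_def by (cases z) (auto simp: indicator_def)
  show P: "set_integrable lborel (?I \<times> ?I) (\<lambda>z. u (snd z) \<bullet> l (fst z) (snd z))"
    using k1 unfolding set_integrable_def kind .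
  have Fs: "(LINT \<omega>|lborel. f \<omega> s) = indicator ?I s *\<^sub>R (LINT \<omega>:?I|lborel. l \<omega> s)" for s
  proof (cases "s \<in> ?I")
    case True
    then have "f \<omega> s = indicator ?I \<omega> *\<^sub>R l \<omega> s" for \<omega> unfolding f_def by (auto simp: indicator_def)
    then show ?thesis using True by (simp add: set_lebesgue_integral_def)
  next
    case False
    then have "f \<omega> s = 0" for \<omega> unfolding f_def by (auto simp: indicator_def)
    then show ?thesis using False by simp
  qed
  have Fi: "integrable lborel (\<lambda>s. LINT \<omega>|lborel. f \<omega> s)" by (rule lborel_pair.integrable_snd[OF f])
  then show "set_integrable lborel ?I (\<lambda>s. LINT \<omega>:?I|lborel. l \<omega> s)" unfolding Fs set_integrable_def .
  have Ki: "integrable lborel (\<lambda>s. LINT \<omega>|lborel. k \<omega> s)" by (rule lborel_pair.integrable_snd[OF k])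
  have mG: "(\<lambda>s. ub s \<bullet> (LINT \<omega>|lborel. f \<omega> s)) \<in> borel_measurable lborel"
    using mu by (intro borel_measurable_inner borel_measurable_integrable[OF Fi]) simp
  have ae: "AE s in lborel. (LINT \<omega>|lborel. k \<omega> s) = ub s \<bullet> (LINT \<omega>|lborel. f \<omega> s)"
    using lborel_pair.AE_integrable_snd[OF f]
  proof eventually_elim
    case (elim s)
    then show ?case unfolding k_def by (intro Bochner_Integration.integral_inner_right)
  qed
  have Gs: "ub s \<bullet> (LINT \<omega>|lborel. f \<omega> s) = indicator ?I s *\<^sub>R (u s \<bullet> (LINT \<omega>:?I|lborel. l \<omega> s))" for s
    unfolding Fs ub_def by (simp add: indicator_def)
  show "set_integrable lborel ?I (\<lambda>s. u s \<bullet> (LINT \<omega>:?I|lborel. l \<omega> s))"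
    using integrable_cong_AE_imp[OF Ki mG] ae unfolding Gs set_integrable_def by (auto simp: eq_commute)
  have "(LINT s:?I|lborel. u s \<bullet> (LINT \<omega>:?I|lborel. l \<omega> s)) = (LINT s|lborel. ub s \<bullet> (LINT \<omega>|lborel. f \<omega> s))"
    unfolding set_lebesgue_integral_def[of _ ?I "\<lambda>s. u s \<bullet> _ s"] Gs ..
  also have "\<dots> = (LINT s|lborel. LINT \<omega>|lborel. k \<omega> s)"
    by (rule integral_cong_AE[OF mG borel_measurable_integrable[OF Ki]]) (use ae in \<open>auto simp: eq_commute\<close>)
  also have "\<dots> = (LINT z|lborel. k (fst z) (snd z))"
    using lborel_pair.integral_snd[OF k] unfolding lborel_prod case_prod_unfold .
  also have "\<dots> = (LINT z:?I \<times> ?I|lborel. u (snd z) \<bullet> l (fst z) (snd z))"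
    unfolding set_lebesgue_integral_def kind ..
  finally show "(LINT s:?I|lborel. u s \<bullet> (LINT \<omega>:?I|lborel. l \<omega> s)) = (LINT z:?I \<times> ?I|lborel. u (snd z) \<bullet> l (fst z) (snd z))" .
qed

lemma set_lborel_swap:
  fixes F :: "real \<times> real \<Rightarrow> 'b::euclidean_space"
  assumes F: "set_integrable lborel (A \<times> A) F"
  shows "set_integrable lborel (A \<times> A) (\<lambda>z. F (snd z, fst z))"
    "(LINT z:A \<times> A|lborel. F (snd z, fst z)) = (LINT z:A \<times> A|lborel. F z)"
proof -
  have i: "indicator (A \<times> A) z = (indicator (A \<times> A) (snd z, fst z) :: real)" for z
    by (cases z) (auto simp: indicator_def)
  show "set_integrable lborel (A \<times> A) (\<lambda>z. F (snd z, fst z))"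
    using lborel_swap(1)[OF F[unfolded set_integrable_def]] unfolding set_integrable_def i[symmetric] .
  show "(LINT z:A \<times> A|lborel. F (snd z, fst z)) = (LINT z:A \<times> A|lborel. F z)"
    using lborel_swap(2)[OF F[unfolded set_integrable_def]] unfolding set_lebesgue_integral_def i[symmetric] .
qed

lemma fubini_fst:
  fixes l :: "real \<Rightarrow> real \<Rightarrow> 'b::euclidean_space"
  assumes L: "set_integrable lborel ({a..b} \<times> {a..b}) (\<lambda>z. l (fst z) (snd z))" and u: "continuous_on {a..b} u"
  shows "set_integrable lborel {a..b} (\<lambda>s. u s \<bullet> (LINT \<omega>:{a..b}|lborel. l s \<omega>))"
    and "set_integrable lborel ({a..b} \<times> {a..b}) (\<lambda>z. u (fst z) \<bullet> l (fst z) (snd z))"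
    and "(LINT s:{a..b}|lborel. u s \<bullet> (LINT \<omega>:{a..b}|lborel. l s \<omega>)) = (LINT z:{a..b} \<times> {a..b}|lborel. u (fst z) \<bullet> l (fst z) (snd z))"
proof -
  have L': "set_integrable lborel ({a..b} \<times> {a..b}) (\<lambda>z. l (snd z) (fst z))"
    using set_lborel_swap(1)[OF L] by simp
  note fub = fubini_snd[of a b "\<lambda>\<omega> s. l s \<omega>", OF L' u]
  show "set_integrable lborel {a..b} (\<lambda>s. u s \<bullet> (LINT \<omega>:{a..b}|lborel. l s \<omega>))" by (rule fub(2))
  show "set_integrable lborel ({a..b} \<times> {a..b}) (\<lambda>z. u (fst z) \<bullet> l (fst z) (snd z))"
    using set_lborel_swap(1)[OF fub(3)] by simp
  show "(LINT s:{a..b}|lborel. u s \<bullet> (LINT \<omega>:{a..b}|lborel. l s \<omega>)) = (LINT z:{a..b} \<times> {a..b}|lborel. u (fst z) \<bullet> l (fst z) (snd z))"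
    using set_lborel_swap(2)[OF fub(3)] fub(4) by simp
qed

lemma set_integral_inner_right:
  fixes f :: "'a::euclidean_space \<Rightarrow> 'b::euclidean_space"
  assumes "set_integrable lborel A f"
  shows "set_integrable lborel A (\<lambda>x. c \<bullet> f x)" "(LINT x:A|lborel. c \<bullet> f x) = c \<bullet> (LINT x:A|lborel. f x)"
proof -
  have eq: "indicator A x *\<^sub>R (c \<bullet> f x) = c \<bullet> (indicator A x *\<^sub>R f x)" for x by simp
  show "set_integrable lborel A (\<lambda>x. c \<bullet> f x)" using assms unfolding set_integrable_def eq by (rule integrable_inner_right)
  show "(LINT x:A|lborel. c \<bullet> f x) = c \<bullet> (LINT x:A|lborel. f x)"
    using assms unfolding set_lebesgue_integral_def set_integrable_def eq by (intro Bochner_Integration.integral_inner_right)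
qed

text \<open>With an upper part \<open>x\<close> not depending on \<open>s\<close>, all terms cancel:
  \<open>K\<close> has mean zero, the average of \<open>L11\<close> integrates to its double
  integral, the entries with \<open>L12\<close> and \<open>L21\<close> integrate to double integrals
  by Fubini, and \<open>H\<close> contains the same terms with the opposite sign. Representatives
  are chosen because \<open>Theta\<close> prescribes \<open>F\<close> and \<open>H\<close> only
  almost everywhere.\<close>

lemma Theta_representatives:
  fixes F :: "real \<Rightarrow> real^('m::finite + 'n::finite)^('m + 'n)"
  assumes tau: "\<tau> > 0" and FH: "(F, H) \<in> Theta \<tau>"
  obtains F' H' where
    "AE s in lborel. s \<in> {-\<tau>..0} \<longrightarrow> F s = F' s"
    "AE z in lborel. z \<in> {-\<tau>..0} \<times> {-\<tau>..0} \<longrightarrow> H (fst z) (snd z) = H' (fst z) (snd z)"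
    "\<And>s w w'. join (0 :: real^'m) w \<bullet> (F' s *v join (0 :: real^'m) w') = 0"
    "\<And>s \<theta> w w'. join (0 :: real^'m) w \<bullet> (H' s \<theta> *v join (0 :: real^'m) w') = 0"
    "\<And>(x :: real^'m) \<phi>. continuous_on {-\<tau>..0} \<phi> \<Longrightarrow> set_integrable lborel {-\<tau>..0} (\<lambda>s. join x (\<phi> s) \<bullet> (F' s *v join x (\<phi> s)))"
    "\<And>(x :: real^'m) \<phi>. continuous_on {-\<tau>..0} \<phi> \<Longrightarrow> set_integrable lborel ({-\<tau>..0} \<times> {-\<tau>..0})
        (\<lambda>z. join x (\<phi> (fst z)) \<bullet> (H' (fst z) (snd z) *v join x (\<phi> (snd z))))"
    "\<And>(x :: real^'m) \<phi>. continuous_on {-\<tau>..0} \<phi> \<Longrightarrow> (LINT s:{-\<tau>..0}|lborel. join x (\<phi> s) \<bullet> (F' s *v join x (\<phi> s)))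
        + (LINT z:{-\<tau>..0} \<times> {-\<tau>..0}|lborel. join x (\<phi> (fst z)) \<bullet> (H' (fst z) (snd z) *v join x (\<phi> (snd z)))) = 0"
proof -
  let ?I = "{-\<tau>..0}" and ?Q = "{-\<tau>..0} \<times> {-\<tau>..0}"
  obtain K :: "real \<Rightarrow> real^'m^'m" and L11 :: "real \<Rightarrow> real \<Rightarrow> real^'m^'m" and L12 :: "real \<Rightarrow> real \<Rightarrow> real^'n^'m" and L21 :: "real \<Rightarrow> real \<Rightarrow> real^'m^'n"
    where K: "L2_on ?I K" and L11: "L2_on ?Q (case_prod L11)" and L12: "L2_on ?Q (case_prod L12)" and L21: "L2_on ?Q (case_prod L21)"
      and K0: "(LINT s:?I|lborel. K s) = 0"
      and F: "AE s in lborel. s \<in> ?I \<longrightarrow> F s = block (K s + (1 / \<tau>) *\<^sub>R (LINT t:?I|lborel. (LINT \<omega>:?I|lborel. L11 \<omega> t)))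
            (LINT \<omega>:?I|lborel. L12 \<omega> s) (LINT \<omega>:?I|lborel. L21 s \<omega>) 0"
      and H: "AE (s, \<theta>) in lborel. s \<in> ?I \<and> \<theta> \<in> ?I \<longrightarrow> H s \<theta> = - block (L11 s \<theta>) (L12 s \<theta>) (L21 s \<theta>) 0"
    using FH unfolding Theta_def by blast
  have cI: "compact ?I" and cQ: "compact ?Q" by (intro compact_Times compact_Icc)+
  have iK: "set_integrable lborel ?I K" by (rule L2_on_imp_set_integrable[OF K cI])
  have i11: "set_integrable lborel ?Q (\<lambda>z. L11 (fst z) (snd z))" and i12: "set_integrable lborel ?Q (\<lambda>z. L12 (fst z) (snd z))"
    and i21: "set_integrable lborel ?Q (\<lambda>z. L21 (fst z) (snd z))"
    using L2_on_imp_set_integrable[OF L11 cQ] L2_on_imp_set_integrable[OF L12 cQ] L2_on_imp_set_integrable[OF L21 cQ]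
    unfolding case_prod_unfold .
  define c where "c = (LINT t:?I|lborel. (LINT \<omega>:?I|lborel. L11 \<omega> t))"
  define F' where "F' s = block (K s + (1 / \<tau>) *\<^sub>R c) (LINT \<omega>:?I|lborel. L12 \<omega> s) (LINT \<omega>:?I|lborel. L21 s \<omega>) 0" for s
  define H' where "H' s \<theta> = - block (L11 s \<theta>) (L12 s \<theta>) (L21 s \<theta>) 0" for s \<theta>
  have mneg: "(- A) *v w = - (A *v w)" for A :: "real^('m + 'n)^('m + 'n)" and w
    using matrix_scaleR_vector[of "-1" A w] by simp
  have qF: "join x (\<phi> s) \<bullet> (F' s *v join x (\<phi> s)) = outer x x \<bullet> K s + (1 / \<tau>) * (outer x x \<bullet> c)
      + outer x (\<phi> s) \<bullet> (LINT \<omega>:?I|lborel. L12 \<omega> s) + outer (\<phi> s) x \<bullet> (LINT \<omega>:?I|lborel. L21 s \<omega>)" for x \<phi> s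
    unfolding F'_def inner_join_block by (simp add: inner_outer[symmetric] matrix_vector_mult_add_rdistrib matrix_scaleR_vector inner_add_right)
  have qH: "join x (\<phi> s) \<bullet> (H' s \<theta> *v join x (\<phi> \<theta>)) = - (outer x x \<bullet> L11 s \<theta> + outer x (\<phi> \<theta>) \<bullet> L12 s \<theta> + outer (\<phi> s) x \<bullet> L21 s \<theta>)" for x \<phi> s \<theta>
    unfolding H'_def mneg inner_minus_right inner_join_block by (simp add: inner_outer[symmetric])
  show thesis
  proof (rule that[of F' H'])
    show "AE s in lborel. s \<in> ?I \<longrightarrow> F s = F' s" using F unfolding F'_def c_def .
    show "AE z in lborel. z \<in> ?Q \<longrightarrow> H (fst z) (snd z) = H' (fst z) (snd z)"
      using H unfolding H'_def by eventually_elim auto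
    show "join (0 :: real^'m) w \<bullet> (F' s *v join (0 :: real^'m) w') = 0" for s w w' unfolding F'_def inner_join_block by simp
    show "join (0 :: real^'m) w \<bullet> (H' s \<theta> *v join (0 :: real^'m) w') = 0" for s \<theta> w w' unfolding H'_def mneg inner_minus_right inner_join_block by simp
    fix x :: "real^'m" and \<phi> :: "real \<Rightarrow> real^'n"
    assume \<phi>: "continuous_on ?I \<phi>"
    have cO: "continuous_on ?I (\<lambda>s. outer x x)" and cO1: "continuous_on ?I (\<lambda>s. outer x (\<phi> s))" and cO2: "continuous_on ?I (\<lambda>s. outer (\<phi> s) x)"
      by (intro continuous_on_outer continuous_on_const \<phi>)+
    note f11 = fubini_snd[OF i11 cO] and f12 = fubini_snd[OF i12 cO1] and f21 = fubini_fst[OF i21 cO2]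
    note k = set_integral_inner_right[OF iK, of "outer x x"]
    have ic: "set_integrable lborel ?I (\<lambda>s. (1 / \<tau>) * (outer x x \<bullet> c))"
      by (rule set_integrable_continuous_compact[OF cI continuous_on_const])
    have intc: "(LINT s:?I|lborel. (1 / \<tau>) * (outer x x \<bullet> c)) = outer x x \<bullet> c"
      unfolding set_borel_integral_eq_integral(2)[OF ic] using tau by simp
    have c11: "outer x x \<bullet> c = (LINT z:?Q|lborel. outer x x \<bullet> L11 (fst z) (snd z))"
      unfolding c_def set_integral_inner_right(2)[OF f11(1), symmetric] by (rule f11(4))
    note F1 = set_integral_add[OF k(1) ic] 
    note F2 = set_integral_add[OF F1(1) f12(2)]
    note F3 = set_integral_add[OF F2(1) f21(1)]
    note H1 = set_integral_add[OF f11(3) f12(3)]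
    note H2 = set_integral_add[OF H1(1) f21(2)]
    show "set_integrable lborel ?I (\<lambda>s. join x (\<phi> s) \<bullet> (F' s *v join x (\<phi> s)))" unfolding qF by (rule F3(1))
    show "set_integrable lborel ?Q (\<lambda>z. join x (\<phi> (fst z)) \<bullet> (H' (fst z) (snd z) *v join x (\<phi> (snd z))))"
      unfolding qH using Bochner_Integration.integrable_minus[OF H2(1)[unfolded set_integrable_def]]
      unfolding set_integrable_def scaleR_minus_right .
    have "(LINT s:?I|lborel. join x (\<phi> s) \<bullet> (F' s *v join x (\<phi> s))) = (LINT z:?Q|lborel. outer x x \<bullet> L11 (fst z) (snd z))
        + (LINT z:?Q|lborel. outer x (\<phi> (snd z)) \<bullet> L12 (fst z) (snd z)) + (LINT z:?Q|lborel. outer (\<phi> (fst z)) x \<bullet> L21 (fst z) (snd z))"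
      unfolding qF F3(2) F2(2) F1(2) k(2) K0 intc unfolding c11 f12(4) f21(3) by simp
    moreover have "(LINT z:?Q|lborel. join x (\<phi> (fst z)) \<bullet> (H' (fst z) (snd z) *v join x (\<phi> (snd z)))) =
        - ((LINT z:?Q|lborel. outer x x \<bullet> L11 (fst z) (snd z))
        + (LINT z:?Q|lborel. outer x (\<phi> (snd z)) \<bullet> L12 (fst z) (snd z)) + (LINT z:?Q|lborel. outer (\<phi> (fst z)) x \<bullet> L21 (fst z) (snd z)))"
      unfolding qH H1(2)[symmetric] H2(2)[symmetric] by (rule set_integral_uminus[OF H2(1)])
    ultimately show "(LINT s:?I|lborel. join x (\<phi> s) \<bullet> (F' s *v join x (\<phi> s)))
        + (LINT z:?Q|lborel. join x (\<phi> (fst z)) \<bullet> (H' (fst z) (snd z) *v join x (\<phi> (snd z)))) = 0" by simp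
  qed
qed

text \<open>Serves both conditions: \<open>c\<close> is the sign with which the element of
  \<open>Theta\<close> occurs, 1 for \<open>{M, N}\<close> and -1 for \<open>{-D, -E}\<close>. As
  the part from \<open>Theta\<close> is merely integrable, it is split off under Lebesgue integrals;
  the continuous parts then return to iterated integrals.\<close>

lemma Xi_Theta_nonneg:
  fixes M :: "real \<Rightarrow> real^('m::finite + 'n::finite)^('m + 'n)" and x :: "real^'m" and \<phi> :: "real \<Rightarrow> real^'n"
  assumes tau: "\<tau> > 0" and Xi: "(M, N) \<in> Xi \<tau> d" and FH: "(F, H) \<in> Theta \<tau>"
    and M: "AE s in lborel. s \<in> {-\<tau>..0} \<longrightarrow> M s = M0 s + c *\<^sub>R F s"
    and N: "AE z in lborel. z \<in> {-\<tau>..0} \<times> {-\<tau>..0} \<longrightarrow> N (fst z) (snd z) = N0 (fst z) (snd z) + c *\<^sub>R H (fst z) (snd z)"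
    and M0: "continuous_on {-\<tau>..0} M0" and N0: "continuous_on ({-\<tau>..0} \<times> {-\<tau>..0}) (\<lambda>(s, \<theta>). N0 s \<theta>)"
    and \<phi>: "continuous_on {-\<tau>..0} \<phi>"
  shows "0 \<le> integral {-\<tau>..0} (\<lambda>s. join x (\<phi> s) \<bullet> (M0 s *v join x (\<phi> s)))
    + integral {-\<tau>..0} (\<lambda>s. integral {-\<tau>..0} (\<lambda>\<theta>. join x (\<phi> s) \<bullet> (N0 s \<theta> *v join x (\<phi> \<theta>))))"
proof -
  let ?I = "{-\<tau>..0}" and ?Q = "{-\<tau>..0} \<times> {-\<tau>..0}"
  define v where "v s = join x (\<phi> s)" for s
  have v: "continuous_on ?I v" unfolding v_def by (intro continuous_on_join continuous_on_const \<phi>)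
  obtain M' N' where M': "AE s in lborel. s \<in> ?I \<longrightarrow> M s = M' s"
    and N': "AE z in lborel. z \<in> ?Q \<longrightarrow> N (fst z) (snd z) = N' (fst z) (snd z)"
    and cM: "continuous_on ?I M'" and cN: "continuous_on ?Q (\<lambda>(s, \<theta>). N' s \<theta>)"
    and "\<And>v w. \<exists>p. \<forall>s\<in>?I. v \<bullet> (M' s *v w) = poly p s"
    and "\<And>v w. \<exists>f. poly_separable f \<and> (\<forall>s\<in>?I. \<forall>\<theta>\<in>?I. v \<bullet> (N' s \<theta> *v w) = f s \<theta>)"
    and "\<And>s v. s \<in> ?I \<Longrightarrow> 0 \<le> v \<bullet> (M' s *v v)"
    and nonneg: "\<And>v. continuous_on ?I v \<Longrightarrow> 0 \<le> integral ?I (\<lambda>s. v s \<bullet> (M' s *v v s))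
        + integral ?I (\<lambda>s. integral ?I (\<lambda>\<theta>. v s \<bullet> (N' s \<theta> *v v \<theta>)))"
    by (rule Xi_representatives[OF tau Xi]) (rule that)
  obtain F' H' where F': "AE s in lborel. s \<in> ?I \<longrightarrow> F s = F' s"
    and H': "AE z in lborel. z \<in> ?Q \<longrightarrow> H (fst z) (snd z) = H' (fst z) (snd z)"
    and "\<And>s w w'. join (0 :: real^'m) w \<bullet> (F' s *v join (0 :: real^'m) w') = 0"
    and "\<And>s \<theta> w w'. join (0 :: real^'m) w \<bullet> (H' s \<theta> *v join (0 :: real^'m) w') = 0"
    and iF0: "\<And>(x :: real^'m) \<phi>. continuous_on ?I \<phi> \<Longrightarrow> set_integrable lborel ?I (\<lambda>s. join x (\<phi> s) \<bullet> (F' s *v join x (\<phi> s)))"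
    and iH0: "\<And>(x :: real^'m) \<phi>. continuous_on ?I \<phi> \<Longrightarrow> set_integrable lborel ?Q
        (\<lambda>z. join x (\<phi> (fst z)) \<bullet> (H' (fst z) (snd z) *v join x (\<phi> (snd z))))"
    and FH0: "\<And>(x :: real^'m) \<phi>. continuous_on ?I \<phi> \<Longrightarrow> (LINT s:?I|lborel. join x (\<phi> s) \<bullet> (F' s *v join x (\<phi> s)))
        + (LINT z:?Q|lborel. join x (\<phi> (fst z)) \<bullet> (H' (fst z) (snd z) *v join x (\<phi> (snd z)))) = 0"
    by (rule Theta_representatives[OF tau FH]) (rule that)
  note iF = iF0[OF \<phi>, of x, folded v_def] and iH = iH0[OF \<phi>, of x, folded v_def] and FH' = FH0[OF \<phi>, of x, folded v_def]
  have c2: "continuous_on ?Q (\<lambda>z. v (fst z) \<bullet> (B (fst z) (snd z) *v v (snd z)))" if "continuous_on ?Q (\<lambda>(s, \<theta>). B s \<theta>)" for B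
    using that by (intro continuous_on_inner continuous_on_matrix_vector_mult continuous_on_compose2[OF v] continuous_on_fst continuous_on_snd continuous_on_id)
      (auto simp: split_beta)
  have c1: "continuous_on ?I (\<lambda>s. v s \<bullet> (B s *v v s))" if "continuous_on ?I B" for B
    by (intro continuous_on_inner continuous_on_matrix_vector_mult v that)
  have cI: "compact ?I" and cQ: "compact ?Q" by (intro compact_Times compact_Icc)+
  note j1 = set_integrable_continuous_compact[OF cI c1] and j2 = set_integrable_continuous_compact[OF cQ c2]
  have cmult: "set_integrable lborel A (\<lambda>z. c * f z)" "(LINT z:A|lborel. c * f z) = c * (LINT z:A|lborel. f z)"
    if "set_integrable lborel A f" for A :: "'z::euclidean_space set" and f
    using that by simp_all
  have congr: "(LINT z:A|lborel. f z) = (LINT z:A|lborel. g z)"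
    if "set_integrable lborel A f" "set_integrable lborel A g" "AE z in lborel. z \<in> A \<longrightarrow> f z = g z" for A :: "'z::euclidean_space set" and f g :: "'z \<Rightarrow> real"
    unfolding set_lebesgue_integral_def
  proof (rule integral_cong_AE)
    show "(\<lambda>z. indicator A z *\<^sub>R f z) \<in> borel_measurable lborel" "(\<lambda>z. indicator A z *\<^sub>R g z) \<in> borel_measurable lborel"
      using that(1,2) unfolding set_integrable_def by auto
    show "AE z in lborel. indicator A z *\<^sub>R f z = indicator A z *\<^sub>R g z"
      using that(3) by eventually_elim (auto simp: indicator_def)
  qed
  note aF = set_integral_add[OF j1[OF M0] cmult(1)[OF iF]] and aH = set_integral_add[OF j2[OF N0] cmult(1)[OF iH]]
  have 1: "integral ?I (\<lambda>s. v s \<bullet> (M' s *v v s)) = integral ?I (\<lambda>s. v s \<bullet> (M0 s *v v s)) + c * (LINT s:?I|lborel. v s \<bullet> (F' s *v v s))"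
  proof -
    have "AE s in lborel. s \<in> ?I \<longrightarrow> v s \<bullet> (M' s *v v s) = v s \<bullet> (M0 s *v v s) + c * (v s \<bullet> (F' s *v v s))"
      using M M' F' by eventually_elim
        (metis inner_add_right inner_scaleR_right matrix_scaleR_vector matrix_vector_mult_add_rdistrib)
    from congr[OF j1[OF cM] aF(1) this] show ?thesis
      unfolding aF(2) cmult(2)[OF iF] set_borel_integral_eq_integral(2)[OF j1[OF cM]] set_borel_integral_eq_integral(2)[OF j1[OF M0]] .
  qed
  have 2: "integral ?I (\<lambda>s. integral ?I (\<lambda>\<theta>. v s \<bullet> (N' s \<theta> *v v \<theta>))) = integral ?I (\<lambda>s. integral ?I (\<lambda>\<theta>. v s \<bullet> (N0 s \<theta> *v v \<theta>)))
     + c * (LINT z:?Q|lborel. v (fst z) \<bullet> (H' (fst z) (snd z) *v v (snd z)))"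
  proof -
    have "AE z in lborel. z \<in> ?Q \<longrightarrow> v (fst z) \<bullet> (N' (fst z) (snd z) *v v (snd z)) = v (fst z) \<bullet> (N0 (fst z) (snd z) *v v (snd z)) + c * (v (fst z) \<bullet> (H' (fst z) (snd z) *v v (snd z)))"
      using N N' H' by eventually_elim
        (metis inner_add_right inner_scaleR_right matrix_scaleR_vector matrix_vector_mult_add_rdistrib)
    from congr[OF j2[OF cN] aH(1) this] show ?thesis
      unfolding aH(2) cmult(2)[OF iH] using set_integral_square_iterated(1)[OF c2[OF cN]] set_integral_square_iterated(1)[OF c2[OF N0]] by simp
  qed
  have "0 \<le> integral ?I (\<lambda>s. v s \<bullet> (M0 s *v v s)) + integral ?I (\<lambda>s. integral ?I (\<lambda>\<theta>. v s \<bullet> (N0 s \<theta> *v v \<theta>)))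
     + c * ((LINT s:?I|lborel. v s \<bullet> (F' s *v v s)) + (LINT z:?Q|lborel. v (fst z) \<bullet> (H' (fst z) (snd z) *v v (snd z))))"
    using nonneg[OF v] unfolding 1 2 by (simp add: algebra_simps)
  then show ?thesis unfolding FH' by (simp add: v_def)
qed

lemma inner_join_block_col: "join a b \<bullet> (block_col A B *v y) = a \<bullet> (A *v y) + b \<bullet> (B *v y)"
  by (simp add: inner_vec_def matrix_vector_mult_def sum_UNIV_Plus block_col_def join_def)

lemma continuous_on_block:
  assumes "continuous_on X A" "continuous_on X B" "continuous_on X C" "continuous_on X D"
  shows "continuous_on X (\<lambda>s. block (A s) (B s) (C s) (D s))"
  unfolding block_def
proof (intro continuous_on_vec_lambda)
  fix i j
  show "continuous_on X (\<lambda>s. case i of Inl a \<Rightarrow> (case j of Inl c \<Rightarrow> A s $ a $ c | Inr d \<Rightarrow> B s $ a $ d)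
     | Inr b \<Rightarrow> (case j of Inl c \<Rightarrow> C s $ b $ c | Inr d \<Rightarrow> D s $ b $ d))"
    by (cases i; cases j) (simp_all add: continuous_on_component assms)
qed

lemma continuous_on_block_col:
  assumes "continuous_on X A" "continuous_on X B"
  shows "continuous_on X (\<lambda>s. block_col (A s) (B s))"
  unfolding block_col_def
proof (rule continuous_on_vec_lambda)
  fix i
  show "continuous_on X (\<lambda>s. case i of Inl a \<Rightarrow> A s $ a | Inr b \<Rightarrow> B s $ b)"
    by (cases i) (simp_all add: continuous_on_component assms)
qed

lemma continuous_on_matrix_mult_left:
  fixes A :: "real^'m^'n" and B :: "'a::topological_space \<Rightarrow> real^'k^'m"
  assumes "continuous_on X B"
  shows "continuous_on X (\<lambda>s. A ** B s)"
proof (rule continuous_on_matrix_entries)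
  fix v w
  show "continuous_on X (\<lambda>s. v \<bullet> ((A ** B s) *v w))"
    unfolding matrix_vector_mul_assoc[symmetric]
    by (intro continuous_on_inner continuous_on_matrix_vector_mult continuous_on_const assms)
qed

lemma has_vector_derivative_matrix:
  fixes A :: "real \<Rightarrow> real^'m^'n"
  assumes "\<And>i j. ((\<lambda>s. A s $ i $ j) has_real_derivative A' $ i $ j) (at s within T)"
  shows "(A has_vector_derivative A') (at s within T)"
  unfolding has_vector_derivative_def
proof (subst has_derivative_componentwise_within, rule ballI)
  fix b :: "real^'m^'n" assume "b \<in> Basis"
  then obtain i u where "b = axis i u" "u \<in> Basis" unfolding Basis_vec_def by blast
  moreover from this obtain j where "u = axis j 1" unfolding Basis_vec_def by auto
  ultimately have b: "X \<bullet> b = X $ i $ j" for X by (simp add: inner_axis)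
  show "((\<lambda>x. A x \<bullet> b) has_derivative (\<lambda>x. (x *\<^sub>R A') \<bullet> b)) (at s within T)"
    using assms[of i j] unfolding b has_field_derivative_def by (simp add: mult.commute[of _ "A' $ i $ j"])
qed

text \<open>Counterpart of \<open>poly_separable\<close> for matrix values: the first factor is
  scalar and the second carries the matrix, as \<open>R_separable\<close> demands.\<close>

definition separable_on :: "real set \<Rightarrow> (real \<Rightarrow> real \<Rightarrow> 'a::real_normed_vector) \<Rightarrow> bool" where
  "separable_on X g \<longleftrightarrow> (\<exists>ys :: ((real \<Rightarrow> real) \<times> (real \<Rightarrow> 'a)) list. (\<forall>y\<in>set ys. continuous_on X (fst y) \<and> continuous_on X (snd y)) \<and>
     (\<forall>s \<theta>. g s \<theta> = (\<Sum>y\<leftarrow>ys. fst y s *\<^sub>R snd y \<theta>)))"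

lemma separable_on_zero: "separable_on X (\<lambda>s \<theta>. 0)"
  unfolding separable_on_def by (rule exI[of _ "[]"]) simp

lemma separable_on_add: assumes "separable_on X f" "separable_on X g" shows "separable_on X (\<lambda>s \<theta>. f s \<theta> + g s \<theta>)"
proof -
  obtain xs ys where "\<forall>y\<in>set xs. continuous_on X (fst y) \<and> continuous_on X (snd y)" "\<forall>s \<theta>. f s \<theta> = (\<Sum>y\<leftarrow>xs. fst y s *\<^sub>R snd y \<theta>)"
    "\<forall>y\<in>set ys. continuous_on X (fst y) \<and> continuous_on X (snd y)" "\<forall>s \<theta>. g s \<theta> = (\<Sum>y\<leftarrow>ys. fst y s *\<^sub>R snd y \<theta>)"
    using assms unfolding separable_on_def by blast
  then show ?thesis unfolding separable_on_def by (intro exI[of _ "xs @ ys"]) auto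
qed

lemma separable_on_sum:
  assumes "finite A" "\<And>x. x \<in> A \<Longrightarrow> separable_on X (f x)"
  shows "separable_on X (\<lambda>s \<theta>. \<Sum>x\<in>A. f x s \<theta>)"
  using assms by (induction A rule: finite_induct) (simp_all add: separable_on_zero separable_on_add)

lemma separable_on_poly: "separable_on X (\<lambda>s \<theta>. (\<Sum>(p, q)\<leftarrow>xs. poly p s * poly q \<theta>) *\<^sub>R c)"
proof (induction xs)
  case Nil
  then show ?case by (simp add: separable_on_zero)
next
  case (Cons x xs)
  have "separable_on X (\<lambda>s \<theta>. (poly (fst x) s * poly (snd x) \<theta>) *\<^sub>R c)"
    unfolding separable_on_def
    by (rule exI[of _ "[(poly (fst x), \<lambda>\<theta>. poly (snd x) \<theta> *\<^sub>R c)]"])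
      (simp add: continuous_on_scaleR continuous_on_poly[OF continuous_on_id])
  from separable_on_add[OF this Cons.IH] show ?case by (simp add: split_beta scaleR_add_left)
qed

lemma separable_on_indexed:
  assumes "separable_on X g"
  shows "\<exists>(K::nat) p q. (\<forall>k<K. continuous_on X (p k) \<and> continuous_on X (q k)) \<and> (\<forall>s \<theta>. g s \<theta> = (\<Sum>k<K. p k s *\<^sub>R q k \<theta>))"
proof -
  obtain ys where ys: "\<forall>y\<in>set ys. continuous_on X (fst y) \<and> continuous_on X (snd y)" "\<forall>s \<theta>. g s \<theta> = (\<Sum>y\<leftarrow>ys. fst y s *\<^sub>R snd y \<theta>)"
    using assms unfolding separable_on_def by blast
  have "g s \<theta> = (\<Sum>k<length ys. fst (ys ! k) s *\<^sub>R snd (ys ! k) \<theta>)" for s \<theta>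
    using ys(2) by (simp add: sum_list_sum_nth atLeast0LessThan)
  then show ?thesis using ys(1)
    by (intro exI[of _ "length ys"] exI[of _ "\<lambda>k. fst (ys ! k)"] exI[of _ "\<lambda>k. snd (ys ! k)"]) auto
qed

lemma poly_separable_deriv:
  "((\<lambda>s. \<Sum>(p, q)\<leftarrow>xs. poly p s * poly q \<theta>) has_real_derivative (\<Sum>(p, q)\<leftarrow>xs. poly (pderiv p) s * poly q \<theta>)) (at s within T)"
proof (induction xs)
  case Nil
  then show ?case by simp
next
  case (Cons x xs)
  have "((\<lambda>s. poly (fst x) s * poly (snd x) \<theta>) has_real_derivative poly (pderiv (fst x)) s * poly (snd x) \<theta>) (at s within T)"
    by (rule DERIV_cmult_right) (rule has_field_derivative_at_within[OF poly_DERIV])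
  from DERIV_add[OF this Cons.IH] show ?case by (simp add: split_beta)
qed

lemma matrix_sum_entries: "(\<Sum>i\<in>UNIV. \<Sum>j\<in>UNIV. (A $ i $ j) *\<^sub>R axis i (axis j (1::real))) = (A :: real^'m^'n)"
proof -
  have entry: "((A $ i $ j) *\<^sub>R axis i (axis j (1::real)) :: real^'m^'n) $ k $ l = (if i = k then (if j = l then A $ i $ j else 0) else 0)" for i j k l
    by (simp add: axis_def)
  have inner: "(\<Sum>j\<in>UNIV. if i = k then (if j = l then A $ i $ j else 0) else 0) = (if i = k then A $ i $ l else 0)" for i k l
    by (cases "i = k") simp_all
  show ?thesis
    unfolding vec_eq_iff sum_component entry inner by simp
qed

section \<open>The stability theorem\<close>

text \<open>\<open>dS\<close>, \<open>R\<^sub>s\<close>, \<open>R\<^sub>\<theta>\<close> and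
  \<open>dR0\<close> are weak derivatives. \<open>dR0\<close> is a separate function because
  \<open>R\<^sub>s\<close> is determined only almost everywhere on the square, where a line is a
  null set, so that it has no meaningful section at \<open>\<theta> = 0\<close>. In the proof all
  four give way to classical derivatives.\<close>

theorem theorem11:
  fixes \<tau> \<epsilon> :: real
    and d :: nat
    and A0 A1 :: "real^'n^'n"
    and S dS :: "real \<Rightarrow> real^'n^'n"
    and R R\<^sub>s R\<^sub>\<theta> :: "real \<Rightarrow> real \<Rightarrow> real^'n^'n"
    and dR0 :: "real \<Rightarrow> real^'n^'n"
    and F1 :: "real \<Rightarrow> real^('n + 'n)^('n + 'n)"
    and H1 :: "real \<Rightarrow> real \<Rightarrow> real^('n + 'n)^('n + 'n)"
    and F2 :: "real \<Rightarrow> real^(('n + 'n) + 'n)^(('n + 'n) + 'n)"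
    and H2 :: "real \<Rightarrow> real \<Rightarrow> real^(('n + 'n) + 'n)^(('n + 'n) + 'n)"
    and M :: "real \<Rightarrow> real^('n + 'n)^('n + 'n)"
    and N :: "real \<Rightarrow> real \<Rightarrow> real^('n + 'n)^('n + 'n)"
    and D :: "real \<Rightarrow> real^(('n + 'n) + 'n)^(('n + 'n) + 'n)"
    and E :: "real \<Rightarrow> real \<Rightarrow> real^(('n + 'n) + 'n)^(('n + 'n) + 'n)"
    and D0 :: "real^('n + 'n)^('n + 'n)"
    and V :: "real \<Rightarrow> real^'n^('n + 'n)"
    and S11 S12 S22 :: "real^'n^'n"
    and S13 :: "real \<Rightarrow> real^'n^'n"
    and G :: "real \<Rightarrow> real \<Rightarrow> real^'n^'n"
  assumes "\<tau> > 0" and "\<epsilon> > 0"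
    and "W2_interval \<tau> S dS"
    and "W2_square \<tau> R R\<^sub>s R\<^sub>\<theta>"
    and "W2_interval \<tau> (\<lambda>s. R s 0) dR0"
    and "\<exists>r. W2_interval \<tau> (\<lambda>s. R 0 s) r"
    and "\<exists>r. W2_interval \<tau> (\<lambda>s. R (- \<tau>) s) r"
    and "\<forall>s\<in>{-\<tau>..0}. \<forall>\<theta>\<in>{-\<tau>..0}. R s \<theta> = transpose (R \<theta> s)"
    and "\<forall>s\<in>{-\<tau>..0}. transpose (S s) = S s"
    and "(F1, H1) \<in> Theta \<tau>"
    and "(F2, H2) \<in> Theta \<tau>"
    and "M = (\<lambda>s. block (\<tau> *\<^sub>R R 0 0 + \<tau> *\<^sub>R S 0) (\<tau> *\<^sub>R R 0 s)
                        (\<tau> *\<^sub>R R s 0)               (\<tau> *\<^sub>R S s)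
                  + F1 s - \<epsilon> *\<^sub>R mat 1)"
    and "N = (\<lambda>s \<theta>. block 0 0 0 (R s \<theta>) + H1 s \<theta>)"
    and "S11 = \<tau> *\<^sub>R (A0 ** (R 0 0 + S 0)) + \<tau> *\<^sub>R (A1 ** R (- \<tau>) 0) + (1 / 2) *\<^sub>R S 0"
    and "S12 = \<tau> *\<^sub>R (A1 ** S (- \<tau>))"
    and "S22 = - S (- \<tau>)"
    and "S13 = (\<lambda>s. A0 ** R 0 s + A1 ** R (- \<tau>) s + transpose (dR0 s))"
    and "D0 = block (S11 + transpose S11 + \<epsilon> *\<^sub>R mat 1) S12
                    (transpose S12)                     S22"
    and "V = (\<lambda>s. block_col (S13 s) 0)"
    and "D = (\<lambda>s. block D0                       (\<tau> *\<^sub>R V s)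
                        (\<tau> *\<^sub>R transpose (V s)) (\<tau> *\<^sub>R dS s + \<epsilon> *\<^sub>R mat 1)
                  + F2 s)"
    and "G = (\<lambda>s \<theta>. R\<^sub>s s \<theta> + R\<^sub>\<theta> s \<theta>)"
    and "E = (\<lambda>s \<theta>. block 0 0 0 (G s \<theta>) + H2 s \<theta>)"
    and "(M, N) \<in> Xi \<tau> d"
    and "((\<lambda>s. - D s), (\<lambda>s \<theta>. - E s \<theta>)) \<in> Xi \<tau> d"
  shows "exponentially_stable \<tau> A0 A1"
proof -
  let ?I = "{-\<tau>..0}" and ?Q = "{-\<tau>..0} \<times> {-\<tau>..0}"
  note tau = assms(1) and eps = assms(2) and WS = assms(3) and WR = assms(4) and WR0 = assms(5)
    and Rsym = assms(8) and Ssym = assms(9) and T1 = assms(10) and T2 = assms(11) and Mdef = assms(12) and Ndef = assms(13)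
    and S11 = assms(14) and S12 = assms(15) and S22 = assms(16) and S13 = assms(17) and D0 = assms(18) and V = assms(19)
    and Ddef = assms(20) and Gdef = assms(21) and Edef = assms(22) and X1 = assms(23) and X2 = assms(24)
  have cS: "continuous_on ?I S" and L2dS: "L2_on ?I dS" and wS: "weak_partial_deriv_on ?I 1 S dS"
    using WS unfolding W2_interval_def by auto
  have L2dR0: "L2_on ?I dR0" and wR0: "weak_partial_deriv_on ?I 1 (\<lambda>s. R s 0) dR0"
    using WR0 unfolding W2_interval_def by auto
  have cR: "continuous_on ?Q (case_prod R)" and L2Rs: "L2_on ?Q (case_prod R\<^sub>s)" and L2Rt: "L2_on ?Q (case_prod R\<^sub>\<theta>)"
    and wRs: "weak_partial_deriv_on ?Q (1, 0) (case_prod R) (case_prod R\<^sub>s)"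
    and wRt: "weak_partial_deriv_on ?Q (0, 1) (case_prod R) (case_prod R\<^sub>\<theta>)"
    using WR unfolding W2_square_def Let_def by auto
  have z0: "0 \<in> ?I" and zt: "-\<tau> \<in> ?I" using tau by auto
  have Qc: "?Q = cbox (-\<tau>, -\<tau>) (0, 0)" by (simp add: cbox_Pair_eq)
  have neQ: "box (-\<tau>, -\<tau>) (0::real, 0::real) \<noteq> {}" using tau by (simp add: box_ne_empty Basis_prod_def)

  \<comment> \<open>Polynomial form of \<open>R\<close> and \<open>S\<close>\<close>
  obtain M' N' where M': "AE s in lborel. s \<in> ?I \<longrightarrow> M s = M' s"
    and N': "AE z in lborel. z \<in> ?Q \<longrightarrow> N (fst z) (snd z) = N' (fst z) (snd z)"
    and "continuous_on ?I M'" and "continuous_on ?Q (\<lambda>(s, \<theta>). N' s \<theta>)"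
    and Mp: "\<And>v w. \<exists>p. \<forall>s\<in>?I. v \<bullet> (M' s *v w) = poly p s"
    and Np: "\<And>v w. \<exists>f. poly_separable f \<and> (\<forall>s\<in>?I. \<forall>\<theta>\<in>?I. v \<bullet> (N' s \<theta> *v w) = f s \<theta>)"
    and Mpsd: "\<And>s v. s \<in> ?I \<Longrightarrow> 0 \<le> v \<bullet> (M' s *v v)"
    and "\<And>v. continuous_on ?I v \<Longrightarrow> 0 \<le> integral ?I (\<lambda>s. v s \<bullet> (M' s *v v s))
        + integral ?I (\<lambda>s. integral ?I (\<lambda>\<theta>. v s \<bullet> (N' s \<theta> *v v \<theta>)))"
    by (rule Xi_representatives[OF tau X1]) (rule that)
  obtain F' H' where F': "AE s in lborel. s \<in> ?I \<longrightarrow> F1 s = F' s"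
    and H': "AE z in lborel. z \<in> ?Q \<longrightarrow> H1 (fst z) (snd z) = H' (fst z) (snd z)"
    and F0: "\<And>s w w'. join (0 :: real^'n) w \<bullet> (F' s *v join (0 :: real^'n) w') = 0"
    and H0: "\<And>s \<theta> w w'. join (0 :: real^'n) w \<bullet> (H' s \<theta> *v join (0 :: real^'n) w') = 0"
    and "\<And>(x :: real^'n) \<phi>. continuous_on ?I \<phi> \<Longrightarrow> set_integrable lborel ?I (\<lambda>s. join x (\<phi> s) \<bullet> (F' s *v join x (\<phi> s)))"
    and "\<And>(x :: real^'n) \<phi>. continuous_on ?I \<phi> \<Longrightarrow> set_integrable lborel ?Q
        (\<lambda>z. join x (\<phi> (fst z)) \<bullet> (H' (fst z) (snd z) *v join x (\<phi> (snd z))))"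
    and "\<And>(x :: real^'n) \<phi>. continuous_on ?I \<phi> \<Longrightarrow> (LINT s:?I|lborel. join x (\<phi> s) \<bullet> (F' s *v join x (\<phi> s)))
        + (LINT z:?Q|lborel. join x (\<phi> (fst z)) \<bullet> (H' (fst z) (snd z) *v join x (\<phi> (snd z)))) = 0"
    by (rule Theta_representatives[OF tau T1]) (rule that)
  \<comment> \<open>Vectors with upper part 0 see only the lower right block, where the element of
    \<open>Theta\<close> vanishes. The identity is first obtained almost everywhere and then at
    every point, both sides being continuous.\<close>
  have eqR: "v \<bullet> (R s \<theta> *v w) = f s \<theta>"
    if f: "poly_separable f" and fN: "\<forall>s\<in>?I. \<forall>\<theta>\<in>?I. join 0 v \<bullet> (N' s \<theta> *v join 0 w) = f s \<theta>" and s: "s \<in> ?I" "\<theta> \<in> ?I"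
    for v w :: "real^'n" and f s \<theta>
  proof -
    have "AE z in lborel. z \<in> ?Q \<longrightarrow> v \<bullet> (case_prod R z *v w) = case_prod f z"
      using N' H'
    proof eventually_elim
      case (elim z)
      show ?case
      proof
        assume z: "z \<in> ?Q"
        obtain a b where ab: "z = (a, b)" "a \<in> ?I" "b \<in> ?I" using z by auto
        have "f a b = join 0 v \<bullet> (N' a b *v join 0 w)" using fN ab by simp
        also have "\<dots> = join 0 v \<bullet> ((block 0 0 0 (R a b) + H' a b) *v join 0 w)"
          using elim z ab(1) unfolding Ndef by simp
        also have "\<dots> = v \<bullet> (R a b *v w)"
          unfolding matrix_vector_mult_add_rdistrib inner_add_right H0 inner_join_block by simp
        finally show "v \<bullet> (case_prod R z *v w) = case_prod f z" using ab by simp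
      qed
    qed
    moreover have "continuous_on ?Q (\<lambda>z. v \<bullet> (case_prod R z *v w))"
      by (intro continuous_on_inner continuous_on_matrix_vector_mult continuous_on_const cR)
    moreover have "continuous_on ?Q (case_prod f)" by (rule poly_separable_continuous[OF f])
    moreover have "(s, \<theta>) \<in> ?Q" using s by simp
    ultimately show ?thesis
      using AE_eq_imp_eq_on_cbox[of "(-\<tau>, -\<tau>)" "(0, 0)" "\<lambda>z. v \<bullet> (case_prod R z *v w)" "case_prod f" "(s, \<theta>)"] neQ
      unfolding Qc by simp
  qed
  have "\<exists>xs. \<forall>s\<in>?I. \<forall>\<theta>\<in>?I. R s \<theta> $ i $ j = (\<Sum>(p, q)\<leftarrow>xs. poly p s * poly q \<theta>)" for i j
  proof -
    obtain f where f: "poly_separable f" "\<forall>s\<in>?I. \<forall>\<theta>\<in>?I. join 0 (axis i 1) \<bullet> (N' s \<theta> *v join 0 (axis j 1)) = f s \<theta>"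
      using Np by blast
    obtain xs where xs: "\<forall>s \<theta>. f s \<theta> = (\<Sum>(p, q)\<leftarrow>xs. poly p s * poly q \<theta>)" using f(1) unfolding poly_separable_def by blast
    have "R s \<theta> $ i $ j = (\<Sum>(p, q)\<leftarrow>xs. poly p s * poly q \<theta>)" if "s \<in> ?I" "\<theta> \<in> ?I" for s \<theta>
      unfolding matrix_entry using eqR[OF f that] xs by simp
    then show ?thesis by blast
  qed
  then obtain X where X: "\<And>i j s \<theta>. s \<in> ?I \<Longrightarrow> \<theta> \<in> ?I \<Longrightarrow> R s \<theta> $ i $ j = (\<Sum>(p, q)\<leftarrow>X i j. poly p s * poly q \<theta>)"
    by metis
  \<comment> \<open>The same argument for \<open>S\<close>; the term with \<open>\<epsilon>\<close>
    is the lower right part of \<open>- \<epsilon> *\<^sub>R mat 1\<close> in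
    \<open>M\<close>.\<close>
  have eqS: "\<tau> * (v \<bullet> (S s *v w)) - \<epsilon> * (v \<bullet> w) = join 0 v \<bullet> (M' s *v join 0 w)" if s: "s \<in> ?I" for v w :: "real^'n" and s
  proof -
    obtain p where p: "\<forall>s\<in>?I. join 0 v \<bullet> (M' s *v join 0 w) = poly p s" using Mp by blast
    have "AE s in lborel. s \<in> cbox (-\<tau>) 0 \<longrightarrow> \<tau> * (v \<bullet> (S s *v w)) - \<epsilon> * (v \<bullet> w) = poly p s"
      using M' F'
    proof eventually_elim
      case (elim s)
      show ?case
      proof
        assume "s \<in> cbox (-\<tau>) 0"
        then have s: "s \<in> ?I" by simp
        have "poly p s = join 0 v \<bullet> ((block (\<tau> *\<^sub>R R 0 0 + \<tau> *\<^sub>R S 0) (\<tau> *\<^sub>R R 0 s) (\<tau> *\<^sub>R R s 0) (\<tau> *\<^sub>R S s)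
                  + F' s - \<epsilon> *\<^sub>R mat 1) *v join 0 w)"
          using elim s p unfolding Mdef by simp
        also have "\<dots> = \<tau> * (v \<bullet> (S s *v w)) - \<epsilon> * (v \<bullet> w)"
          unfolding matrix_vector_mult_diff_rdistrib matrix_vector_mult_add_rdistrib inner_add_right inner_diff_right F0 inner_join_block
          by (simp add: matrix_scaleR_vector inner_join_join)
        finally show "\<tau> * (v \<bullet> (S s *v w)) - \<epsilon> * (v \<bullet> w) = poly p s" by simp
      qed
    qed
    moreover have "continuous_on (cbox (-\<tau>) 0) (\<lambda>s. \<tau> * (v \<bullet> (S s *v w)) - \<epsilon> * (v \<bullet> w))"
      using cS by (intro continuous_on_diff continuous_on_mult continuous_on_const continuous_on_inner continuous_on_matrix_vector_mult) simp
    moreover have "continuous_on (cbox (-\<tau>) 0) (poly p)" by (rule continuous_on_poly[OF continuous_on_id])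
    ultimately have "\<tau> * (v \<bullet> (S s *v w)) - \<epsilon> * (v \<bullet> w) = poly p s"
      using AE_eq_imp_eq_on_cbox[of "-\<tau>" 0 "\<lambda>s. \<tau> * (v \<bullet> (S s *v w)) - \<epsilon> * (v \<bullet> w)" "poly p" s] tau s by simp
    then show ?thesis using p s by simp
  qed
  have "\<exists>p. \<forall>s\<in>?I. S s $ i $ j = poly p s" for i j
  proof -
    obtain p where p: "\<forall>s\<in>?I. join 0 (axis i 1) \<bullet> (M' s *v join 0 (axis j 1)) = poly p s" using Mp by blast
    \<comment> \<open>This solves \<open>eqS\<close> for the entry; the constant summand undoes the
      shift by \<open>\<epsilon>\<close>.\<close>
    have "S s $ i $ j = poly (smult (1 / \<tau>) (p + [:\<epsilon> * (axis i 1 \<bullet> axis j (1::real)):])) s" if "s \<in> ?I" for s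
      unfolding matrix_entry using eqS[OF that, of "axis i 1" "axis j 1"] p that tau by (simp add: field_simps)
    then show ?thesis by blast
  qed
  then obtain P where P: "\<And>i j s. s \<in> ?I \<Longrightarrow> S s $ i $ j = poly (P i j) s" by metis

  \<comment> \<open>Classical derivatives of \<open>S\<close> and \<open>R\<close>\<close>
  define S' :: "real \<Rightarrow> real^'n^'n" where "S' s = (\<chi> i j. poly (pderiv (P i j)) s)" for s
  define Rs :: "real \<Rightarrow> real \<Rightarrow> real^'n^'n" where "Rs s \<theta> = (\<chi> i j. \<Sum>(p, q)\<leftarrow>X i j. poly (pderiv p) s * poly q \<theta>)" for s \<theta>
  have dS: "(S has_vector_derivative S' s) (at s within ?I)" if s: "s \<in> ?I" for s
  proof (rule has_vector_derivative_matrix)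
    fix i j
    have "(poly (P i j) has_real_derivative poly (pderiv (P i j)) s) (at s within ?I)"
      by (rule has_field_derivative_at_within[OF poly_DERIV])
    from has_field_derivative_transform_within[OF this zero_less_one s, of "\<lambda>s. S s $ i $ j"]
    show "((\<lambda>s. S s $ i $ j) has_real_derivative S' s $ i $ j) (at s within ?I)"
      unfolding S'_def using P by simp
  qed
  have cS': "continuous_on ?I S'"
    unfolding S'_def by (intro continuous_on_vec_lambda continuous_on_poly continuous_on_id)
  have dR: "((\<lambda>s. R s \<theta>) has_vector_derivative Rs s \<theta>) (at s within ?I)" if s: "s \<in> ?I" and t: "\<theta> \<in> ?I" for s \<theta>
  proof (rule has_vector_derivative_matrix)
    fix i j
    from has_field_derivative_transform_within[OF poly_separable_deriv[where xs = "X i j" and \<theta> = \<theta> and s = s and T = ?I] zero_less_one s, of "\<lambda>s. R s \<theta> $ i $ j"]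
    show "((\<lambda>s. R s \<theta> $ i $ j) has_real_derivative Rs s \<theta> $ i $ j) (at s within ?I)"
      unfolding Rs_def using X[OF _ t] by simp
  qed
  have cRs: "continuous_on ?Q (\<lambda>(s, \<theta>). Rs s \<theta>)"
  proof -
    have "poly_separable (\<lambda>s \<theta>. \<Sum>(p, q)\<leftarrow>xs. poly (pderiv p) s * poly q \<theta>)" for xs
      unfolding poly_separable_def by (rule exI[of _ "map (\<lambda>(p, q). (pderiv p, q)) xs"]) (simp add: case_prod_unfold o_def)
    from poly_separable_continuous[OF this] show ?thesis
      unfolding Rs_def split_beta by (intro continuous_on_vec_lambda)
  qed
  have swapc: "continuous_on ?Q (\<lambda>z. Rs (snd z) (fst z))"
  proof -
    have "continuous_on ?Q (\<lambda>z. (snd z, fst z))" by (intro continuous_on_Pair continuous_on_snd continuous_on_fst continuous_on_id)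
    moreover have "(\<lambda>z. (snd z, fst z)) ` ?Q \<subseteq> ?Q" by (rule image_subsetI) (simp add: mem_Times_iff)
    ultimately show ?thesis using continuous_on_compose2[OF cRs, of ?Q "\<lambda>z. (snd z, fst z)"] by simp
  qed
  have cRt: "continuous_on ?Q (case_prod (\<lambda>s \<theta>. transpose (Rs \<theta> s)))"
    unfolding split_beta by (rule continuous_on_transpose[OF swapc])
  \<comment> \<open>The derivative in the second variable follows from the first by
    \<open>R s \<theta> = transpose (R \<theta> s)\<close>. Hence \<open>G\<close> becomes a kernel
    plus its adjoint.\<close>
  have dRt: "((\<lambda>\<theta>. R s \<theta>) has_vector_derivative transpose (Rs \<theta> s)) (at \<theta> within ?I)" if s: "s \<in> ?I" and t: "\<theta> \<in> ?I" for s \<theta>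
  proof -
    have "((\<lambda>\<theta>. transpose (R \<theta> s)) has_vector_derivative transpose (Rs \<theta> s)) (at \<theta> within ?I)"
      by (rule bounded_linear.has_vector_derivative[OF bounded_linear_transpose dR[OF t s]])
    then show ?thesis by (rule has_vector_derivative_transform[OF t, rotated]) (use Rsym s in blast)
  qed
  \<comment> \<open>Agreement almost everywhere suffices, as membership in \<open>Xi\<close> is
    itself a statement almost everywhere.\<close>
  have aeS: "AE s in lborel. s \<in> ?I \<longrightarrow> dS s = S' s"
    by (rule weak_deriv_eq_classical_interval[OF tau wS L2dS dS cS'])
  have aeR0: "AE s in lborel. s \<in> ?I \<longrightarrow> dR0 s = Rs s 0"
    by (rule weak_deriv_eq_classical_interval[OF tau wR0 L2dR0 dR[OF _ z0] continuous_on_section'[OF cRs z0]])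
  have aeRs: "AE z in lborel. z \<in> ?Q \<longrightarrow> case_prod R\<^sub>s z = case_prod Rs z"
    by (rule weak_deriv_eq_classical_fst[OF tau wRs L2Rs dR cR cRs])
  have aeRt: "AE z in lborel. z \<in> ?Q \<longrightarrow> case_prod R\<^sub>\<theta> z = case_prod (\<lambda>s \<theta>. transpose (Rs \<theta> s)) z"
    by (rule weak_deriv_eq_classical_snd[OF tau wRt L2Rt dRt cR cRt])
  have Rsep: "\<exists>(K::nat) p q. (\<forall>k<K. continuous_on ?I (p k) \<and> continuous_on ?I (q k)) \<and>
      (\<forall>s\<in>?I. \<forall>\<theta>\<in>?I. R s \<theta> = (\<Sum>k<K. p k s *\<^sub>R q k \<theta>))"
  proof -
    \<comment> \<open>Expansion in elementary matrices turns separability of the entries into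
      separability of \<open>R\<close>.\<close>
    let ?g = "\<lambda>s \<theta>. \<Sum>i\<in>UNIV. \<Sum>j\<in>UNIV. (\<Sum>(p, q)\<leftarrow>X i j. poly p s * poly q \<theta>) *\<^sub>R axis i (axis j (1::real)) :: real^'n^'n"
    have "separable_on ?I ?g" by (intro separable_on_sum separable_on_poly finite)
    from separable_on_indexed[OF this] obtain K :: nat and p q where pq: "\<forall>k<K. continuous_on ?I (p k) \<and> continuous_on ?I (q k)"
      and g: "\<forall>s \<theta>. ?g s \<theta> = (\<Sum>k<K. p k s *\<^sub>R q k \<theta>)"
      by (elim exE conjE) (rule that)
    have "R s \<theta> = (\<Sum>k<K. p k s *\<^sub>R q k \<theta>)" if "s \<in> ?I" "\<theta> \<in> ?I" for s \<theta>
    proof -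
      have "R s \<theta> = ?g s \<theta>" unfolding X[OF that, symmetric] by (rule matrix_sum_entries[symmetric])
      then show ?thesis by (rule trans[OF _ g[rule_format]])
    qed
    then show ?thesis using pq by (intro exI[of _ K] exI[of _ p] exI[of _ q]) simp
  qed
  have R0: "continuous_on ?I (\<lambda>s. R s 0)" "continuous_on ?I (\<lambda>s. R 0 s)" "continuous_on ?I (\<lambda>s. R (-\<tau>) s)"
    by (rule continuous_on_section'[OF cR z0] continuous_on_section[OF cR z0] continuous_on_section[OF cR zt])+

  \<comment> \<open>Verification of the assumptions of \<open>dual_lyapunov\<close>\<close>
  interpret dual_lyapunov \<tau> \<epsilon> A0 A1 S S' R Rs
  proof
    show "0 < \<tau>" "0 < \<epsilon>" by (rule tau eps)+
    show "(S has_vector_derivative S' s) (at s within ?I)" if "s \<in> ?I" for s by (rule dS[OF that])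
    show "continuous_on ?I S'" by (rule cS')
    show "continuous_on ?Q (\<lambda>(s, \<theta>). R s \<theta>)" by (rule cR)
    show "((\<lambda>s. R s \<theta>) has_vector_derivative Rs s \<theta>) (at s within ?I)" if "s \<in> ?I" "\<theta> \<in> ?I" for s \<theta> by (rule dR[OF that])
    show "continuous_on ?Q (\<lambda>(s, \<theta>). Rs s \<theta>)" by (rule cRs)
    show "R s \<theta> = transpose (R \<theta> s)" if "s \<in> ?I" "\<theta> \<in> ?I" for s \<theta> using Rsym that by blast
    show "transpose (S s) = S s" if "s \<in> ?I" for s using Ssym that by blast
    \<comment> \<open>Pointwise positivity of \<open>M'\<close>, tested on vectors with upper part
      0, becomes a lower bound for \<open>S\<close> through \<open>eqS\<close>.\<close>
    show "\<epsilon> * (w \<bullet> w) \<le> \<tau> * (w \<bullet> (S s *v w))" if "s \<in> ?I" for s w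
      using Mpsd[OF that, of "join 0 w"] eqS[OF that, of w w] by simp
    show "\<exists>(K::nat) p q. (\<forall>k<K. continuous_on ?I (p k) \<and> continuous_on ?I (q k)) \<and>
      (\<forall>s\<in>?I. \<forall>\<theta>\<in>?I. R s \<theta> = (\<Sum>k<K. p k s *\<^sub>R q k \<theta>))" by (rule Rsep)
  next
    fix \<phi> :: "real \<Rightarrow> real^'n" assume \<phi>: "continuous_on ?I \<phi>"
    let ?M0 = "\<lambda>s. block (\<tau> *\<^sub>R R 0 0 + \<tau> *\<^sub>R S 0) (\<tau> *\<^sub>R R 0 s) (\<tau> *\<^sub>R R s 0) (\<tau> *\<^sub>R S s) - \<epsilon> *\<^sub>R mat 1"
    let ?N0 = "\<lambda>s \<theta>. block 0 0 0 (R s \<theta>) :: real^('n + 'n)^('n + 'n)"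
    have nn: "0 \<le> integral ?I (\<lambda>s. join (\<phi> 0) (\<phi> s) \<bullet> (?M0 s *v join (\<phi> 0) (\<phi> s)))
      + integral ?I (\<lambda>s. integral ?I (\<lambda>\<theta>. join (\<phi> 0) (\<phi> s) \<bullet> (?N0 s \<theta> *v join (\<phi> 0) (\<phi> \<theta>))))"
    proof (rule Xi_Theta_nonneg[OF tau X1 T1, where c = 1])
      show "AE s in lborel. s \<in> ?I \<longrightarrow> M s = ?M0 s + 1 *\<^sub>R F1 s" unfolding Mdef by simp
      show "AE z in lborel. z \<in> ?Q \<longrightarrow> N (fst z) (snd z) = ?N0 (fst z) (snd z) + 1 *\<^sub>R H1 (fst z) (snd z)" unfolding Ndef by simp
      show "continuous_on ?I ?M0"
        by (intro continuous_on_diff continuous_on_block continuous_on_scaleR continuous_on_const R0 cS)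
      show "continuous_on ?Q (\<lambda>(s, \<theta>). ?N0 s \<theta>)"
        using cR unfolding split_beta by (intro continuous_on_block continuous_on_const)
      show "continuous_on ?I \<phi>" by (rule \<phi>)
    qed
    have e1: "join (\<phi> 0) (\<phi> s) \<bullet> (?M0 s *v join (\<phi> 0) (\<phi> s)) = \<phi> 0 \<bullet> ((\<tau> *\<^sub>R R 0 0 + \<tau> *\<^sub>R S 0) *v \<phi> 0) + \<phi> 0 \<bullet> ((\<tau> *\<^sub>R R 0 s) *v \<phi> s)
              + \<phi> s \<bullet> ((\<tau> *\<^sub>R R s 0) *v \<phi> 0) + \<phi> s \<bullet> ((\<tau> *\<^sub>R S s) *v \<phi> s)
              - \<epsilon> * (\<phi> 0 \<bullet> \<phi> 0 + \<phi> s \<bullet> \<phi> s)" for s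
      unfolding matrix_vector_mult_diff_rdistrib inner_diff_right inner_join_block
      unfolding matrix_scaleR_vector[of \<epsilon>] matrix_vector_mul_lid inner_scaleR_right[of _ \<epsilon>] inner_join_join ..
    have e2: "join (\<phi> 0) (\<phi> s) \<bullet> (?N0 s \<theta> *v join (\<phi> 0) (\<phi> \<theta>)) = \<phi> s \<bullet> (R s \<theta> *v \<phi> \<theta>)" for s \<theta>
      unfolding inner_join_block by simp
    show "0 \<le> integral ?I (\<lambda>s. \<phi> 0 \<bullet> ((\<tau> *\<^sub>R R 0 0 + \<tau> *\<^sub>R S 0) *v \<phi> 0) + \<phi> 0 \<bullet> ((\<tau> *\<^sub>R R 0 s) *v \<phi> s)
              + \<phi> s \<bullet> ((\<tau> *\<^sub>R R s 0) *v \<phi> 0) + \<phi> s \<bullet> ((\<tau> *\<^sub>R S s) *v \<phi> s)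
              - \<epsilon> * (\<phi> 0 \<bullet> \<phi> 0 + \<phi> s \<bullet> \<phi> s))
          + integral ?I (\<lambda>s. integral ?I (\<lambda>\<theta>. \<phi> s \<bullet> (R s \<theta> *v \<phi> \<theta>)))"
      using nn unfolding e1 e2 .
  next
    fix \<phi> :: "real \<Rightarrow> real^'n" assume \<phi>: "continuous_on ?I \<phi>"
    \<comment> \<open>\<open>T\<close>, \<open>W\<close>, \<open>M0\<close> and \<open>N0\<close>
      are \<open>S13\<close>, \<open>V\<close>, \<open>-D\<close> and \<open>-E\<close> with
      classical derivatives and without the element of \<open>Theta\<close>.\<close>
    define T where "T s = A0 ** R 0 s + A1 ** R (-\<tau>) s + transpose (Rs s 0)" for s
    define W :: "real \<Rightarrow> real^'n^('n + 'n)" where "W s = block_col (T s) 0" for s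
    define M0 where "M0 s = - block D0 (\<tau> *\<^sub>R W s) (\<tau> *\<^sub>R transpose (W s)) (\<tau> *\<^sub>R S' s + \<epsilon> *\<^sub>R mat 1)" for s
    define N0 where "N0 s \<theta> = - (block 0 0 0 (Rs s \<theta> + transpose (Rs \<theta> s)) :: real^(('n + 'n) + 'n)^(('n + 'n) + 'n))" for s \<theta>
    \<comment> \<open>The constant upper part has both end values of \<open>\<phi>\<close>, matching
      the two block rows of \<open>D0\<close>.\<close>
    define x where "x = join (\<phi> 0) (\<phi> (-\<tau>))"
    have cT: "continuous_on ?I T" unfolding T_def
      by (intro continuous_on_add continuous_on_matrix_mult_left R0 continuous_on_transpose continuous_on_section'[OF cRs z0])
    have cW: "continuous_on ?I W" unfolding W_def by (intro continuous_on_block_col cT continuous_on_const)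
    have nn: "0 \<le> integral ?I (\<lambda>s. join x (\<phi> s) \<bullet> (M0 s *v join x (\<phi> s)))
      + integral ?I (\<lambda>s. integral ?I (\<lambda>\<theta>. join x (\<phi> s) \<bullet> (N0 s \<theta> *v join x (\<phi> \<theta>))))"
    proof (rule Xi_Theta_nonneg[OF tau X2 T2, where c = "-1"])
      show "AE s in lborel. s \<in> ?I \<longrightarrow> - D s = M0 s + (- 1) *\<^sub>R F2 s"
        using aeS aeR0
      proof eventually_elim
        case (elim s)
        then show ?case unfolding Ddef V S13 M0_def W_def T_def by simp
      qed
      show "AE z in lborel. z \<in> ?Q \<longrightarrow> - E (fst z) (snd z) = N0 (fst z) (snd z) + (- 1) *\<^sub>R H2 (fst z) (snd z)"
        using aeRs aeRt
      proof eventually_elim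
        case (elim z)
        then show ?case unfolding Edef Gdef N0_def by (simp add: split_beta)
      qed
      show "continuous_on ?I M0" unfolding M0_def
        by (intro continuous_on_minus continuous_on_block continuous_on_scaleR continuous_on_add continuous_on_const cW continuous_on_transpose cS')
      show "continuous_on ?Q (\<lambda>(s, \<theta>). N0 s \<theta>)" unfolding N0_def split_beta
        using cRs unfolding split_beta
        by (intro continuous_on_minus continuous_on_block continuous_on_add continuous_on_const continuous_on_transpose swapc)
      show "continuous_on ?I \<phi>" by (rule \<phi>)
    qed
    have mneg: "(- A) *v w = - (A *v w)" for A :: "real^(('n + 'n) + 'n)^(('n + 'n) + 'n)" and w
      using matrix_scaleR_vector[of "-1" A w] by simp
    define q where "q s = 2 * (\<phi> 0 \<bullet> ((\<tau> *\<^sub>R (A0 ** (R 0 0 + S 0)) + \<tau> *\<^sub>R (A1 ** R (- \<tau>) 0) + (1/2) *\<^sub>R S 0) *v \<phi> 0))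
              + \<epsilon> * (\<phi> 0 \<bullet> \<phi> 0)
              + 2 * (\<phi> 0 \<bullet> ((\<tau> *\<^sub>R (A1 ** S (-\<tau>))) *v \<phi> (-\<tau>)))
              - \<phi> (-\<tau>) \<bullet> (S (-\<tau>) *v \<phi> (-\<tau>))
              + 2 * (\<phi> 0 \<bullet> ((\<tau> *\<^sub>R (A0 ** R 0 s + A1 ** R (-\<tau>) s + transpose (Rs s 0))) *v \<phi> s))
              + \<phi> s \<bullet> ((\<tau> *\<^sub>R S' s) *v \<phi> s) + \<epsilon> * (\<phi> s \<bullet> \<phi> s)" for s
    have e1: "join x (\<phi> s) \<bullet> (M0 s *v join x (\<phi> s)) = - q s" for s
    proof -
      have W1: "x \<bullet> (W s *v \<phi> s) = \<phi> 0 \<bullet> (T s *v \<phi> s)"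
        unfolding x_def W_def inner_join_block_col by simp
      have W2: "\<phi> s \<bullet> (transpose (W s) *v x) = \<phi> 0 \<bullet> (T s *v \<phi> s)"
        unfolding inner_transpose W1[symmetric] by (rule inner_commute)
      have t11: "\<phi> 0 \<bullet> (transpose S11 *v \<phi> 0) = \<phi> 0 \<bullet> (S11 *v \<phi> 0)"
        unfolding inner_transpose by (rule inner_commute)
      have t12: "\<phi> (-\<tau>) \<bullet> (transpose S12 *v \<phi> 0) = \<phi> 0 \<bullet> (S12 *v \<phi> (-\<tau>))"
        unfolding inner_transpose by (rule inner_commute)
      have n22: "\<phi> (-\<tau>) \<bullet> (S22 *v \<phi> (-\<tau>)) = - (\<phi> (-\<tau>) \<bullet> (S (-\<tau>) *v \<phi> (-\<tau>)))"
        unfolding S22 using matrix_scaleR_vector[of "-1" "S (-\<tau>)"] by simp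
      have D0x: "x \<bullet> (D0 *v x) = 2 * (\<phi> 0 \<bullet> (S11 *v \<phi> 0)) + \<epsilon> * (\<phi> 0 \<bullet> \<phi> 0) + 2 * (\<phi> 0 \<bullet> (S12 *v \<phi> (-\<tau>)))
          - \<phi> (-\<tau>) \<bullet> (S (-\<tau>) *v \<phi> (-\<tau>))"
        unfolding D0 x_def inner_join_block matrix_vector_mult_add_rdistrib inner_add_right t11 t12 n22
          matrix_scaleR_vector matrix_vector_mul_lid inner_scaleR_right by simp
      have "join x (\<phi> s) \<bullet> (M0 s *v join x (\<phi> s)) = - (x \<bullet> (D0 *v x) + \<tau> * (\<phi> 0 \<bullet> (T s *v \<phi> s)) + \<tau> * (\<phi> 0 \<bullet> (T s *v \<phi> s))
          + (\<phi> s \<bullet> ((\<tau> *\<^sub>R S' s) *v \<phi> s) + \<epsilon> * (\<phi> s \<bullet> \<phi> s)))"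
        unfolding M0_def mneg inner_minus_right inner_join_block matrix_vector_mult_add_rdistrib inner_add_right
        unfolding matrix_scaleR_vector inner_scaleR_right W1 W2 matrix_vector_mul_lid ..
      also have "\<dots> = - q s"
        unfolding D0x q_def S11[symmetric] S12[symmetric] T_def[symmetric] matrix_scaleR_vector[of \<tau> "T s"] inner_scaleR_right[of _ \<tau> "T s *v _"] by simp
      finally show ?thesis .
    qed
    have e2: "join x (\<phi> s) \<bullet> (N0 s \<theta> *v join x (\<phi> \<theta>)) = - (\<phi> s \<bullet> ((Rs s \<theta> + transpose (Rs \<theta> s)) *v \<phi> \<theta>))" for s \<theta>
      unfolding N0_def mneg inner_minus_right inner_join_block by simp
    have "integral ?I q + integral ?I (\<lambda>s. integral ?I (\<lambda>\<theta>. \<phi> s \<bullet> ((Rs s \<theta> + transpose (Rs \<theta> s)) *v \<phi> \<theta>))) \<le> 0"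
      using nn unfolding e1 e2 integral_neg by simp
    then show "integral ?I (\<lambda>s. 2 * (\<phi> 0 \<bullet> ((\<tau> *\<^sub>R (A0 ** (R 0 0 + S 0)) + \<tau> *\<^sub>R (A1 ** R (- \<tau>) 0) + (1/2) *\<^sub>R S 0) *v \<phi> 0))
              + \<epsilon> * (\<phi> 0 \<bullet> \<phi> 0)
              + 2 * (\<phi> 0 \<bullet> ((\<tau> *\<^sub>R (A1 ** S (-\<tau>))) *v \<phi> (-\<tau>)))
              - \<phi> (-\<tau>) \<bullet> (S (-\<tau>) *v \<phi> (-\<tau>))
              + 2 * (\<phi> 0 \<bullet> ((\<tau> *\<^sub>R (A0 ** R 0 s + A1 ** R (-\<tau>) s + transpose (Rs s 0))) *v \<phi> s))
              + \<phi> s \<bullet> ((\<tau> *\<^sub>R S' s) *v \<phi> s) + \<epsilon> * (\<phi> s \<bullet> \<phi> s))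
          + integral ?I (\<lambda>s. integral ?I (\<lambda>\<theta>. \<phi> s \<bullet> ((Rs s \<theta> + transpose (Rs \<theta> s)) *v \<phi> \<theta>))) \<le> 0"
      unfolding q_def .
  qed
  show ?thesis by (rule stable)
qed

end
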